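(* Let $R$ be a commutative Noetherian local ring with positive depth and let $M$ be a finitely generated two-periodic $R$-module with finite Gorenstein dimension. Let $N$ be any finitely generated $R$-module such that the pair $(M,N)$ is Tor-independent over $R$, i.e. $\operatorname{Tor}_i^R(M,N)=0$ for all $i\ge 1$. Then the pair $(M,N)$ satisfies the depth formula: $$\operatorname{depth} M+\operatorname{depth} N=\operatorname{depth} R+\operatorname{depth}(M\otimes_R N).$$
   Context: For a finitely generated module $M$ over a local ring, $\Omega^i_R M$ denotes the $i$-th syzygy of $M$ in its minimal free resolution. $M$ is two-periodic if $M\cong\Omega^2_R M$. The depth of the zero module is, as usual, $\infty$. *)

theory Defs
  imports "HOL-Algebra.Module" "HOL-Algebra.Ring_Divisibility" "HOL-Library.Extended_Nat"
begin

text \<open>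
  Modules are the records of \<^theory>\<open>HOL-Algebra.Module\<close>. These extend ring records, but the locale
  \<^locale>\<open>module\<close> ignores the multiplicative fields, which are therefore left undefined below.
\<close>

section \<open>Local rings and modules\<close>

definition noetherian_local_ring :: "('r, 's) ring_scheme \<Rightarrow> bool"
  where "noetherian_local_ring R \<longleftrightarrow>
    cring R \<and> noetherian_ring R \<and> (\<exists>!I. maximalideal I R)"

definition max_ideal :: "('r, 's) ring_scheme \<Rightarrow> 'r set"
  where "max_ideal R = (THE I. maximalideal I R)"

definition self_module :: "('r, 's) ring_scheme \<Rightarrow> ('r, 'r) module"
  where "self_module R = \<lparr>carrier = carrier R, monoid.mult = monoid.mult R, one = one R,
    ring.zero = ring.zero R, add = add R, smult = monoid.mult R\<rparr>"

definition zero_module :: "('r, 'm, 'c) module_scheme \<Rightarrow> bool"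
  where "zero_module M \<longleftrightarrow> carrier M = {\<zero>\<^bsub>M\<^esub>}"

definition module_span :: "('r, 's) ring_scheme \<Rightarrow> ('r, 'm, 'c) module_scheme \<Rightarrow> 'm set \<Rightarrow> 'm set"
  where "module_span R M S = \<Inter>{H. submodule H R M \<and> S \<subseteq> H}"

definition fg_module :: "('r, 's) ring_scheme \<Rightarrow> ('r, 'm, 'c) module_scheme \<Rightarrow> bool"
  where "fg_module R M \<longleftrightarrow>
    module R M \<and> (\<exists>S. finite S \<and> S \<subseteq> carrier M \<and> module_span R M S = carrier M)"

text \<open>The submodule \<open>(A)M\<close>, where \<open>A\<close> is any subset of \<open>R\<close> and \<open>(A)\<close> the ideal it generates.\<close>

definition ideal_smult :: "('r, 's) ring_scheme \<Rightarrow> 'r set \<Rightarrow> ('r, 'm, 'c) module_scheme \<Rightarrow> 'm set"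
  where "ideal_smult R A M = module_span R M {a \<odot>\<^bsub>M\<^esub> x | a x. a \<in> A \<and> x \<in> carrier M}"

text \<open>
  The quotient \<open>M/K\<close>, whose elements are the cosets of \<open>K\<close>. Since \<open>{a \<odot> y | y \<in> x + K}\<close> may be
  smaller than a coset (for instance if \<open>a = 0\<close>), \<open>K\<close> is added to it.
\<close>

definition quot_module :: "('r, 'm, 'c) module_scheme \<Rightarrow> 'm set \<Rightarrow> ('r, 'm set) module"
  where "quot_module M K = \<lparr>carrier = a_rcosets\<^bsub>M\<^esub> K, monoid.mult = undefined, one = undefined,
    ring.zero = K, add = (\<lambda>C D. C <+>\<^bsub>M\<^esub> D), smult = (\<lambda>a C. K <+>\<^bsub>M\<^esub> ((\<lambda>y. a \<odot>\<^bsub>M\<^esub> y) ` C))\<rparr>"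

text \<open>Homomorphisms are extensional functions, so that they are determined by their values on
  the carrier and \<open>hom_module\<close> below is a module.\<close>

definition mod_hom :: "('r, 's) ring_scheme \<Rightarrow> ('r, 'm, 'c) module_scheme \<Rightarrow>
    ('r, 'n, 'd) module_scheme \<Rightarrow> ('m \<Rightarrow> 'n) set"
  where "mod_hom R M N = {f \<in> carrier M \<rightarrow>\<^sub>E carrier N.
    (\<forall>x\<in>carrier M. \<forall>y\<in>carrier M. f (x \<oplus>\<^bsub>M\<^esub> y) = f x \<oplus>\<^bsub>N\<^esub> f y) \<and>
    (\<forall>a\<in>carrier R. \<forall>x\<in>carrier M. f (a \<odot>\<^bsub>M\<^esub> x) = a \<odot>\<^bsub>N\<^esub> f x)}"

definition mod_isomorphic :: "('r, 's) ring_scheme \<Rightarrow> ('r, 'm, 'c) module_scheme \<Rightarrow>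
    ('r, 'n, 'd) module_scheme \<Rightarrow> bool"
  where "mod_isomorphic R M N \<longleftrightarrow> (\<exists>f\<in>mod_hom R M N. bij_betw f (carrier M) (carrier N))"

definition hom_module :: "('r, 's) ring_scheme \<Rightarrow> ('r, 'm, 'c) module_scheme \<Rightarrow>
    ('r, 'n, 'd) module_scheme \<Rightarrow> ('r, 'm \<Rightarrow> 'n) module"
  where "hom_module R M N = \<lparr>carrier = mod_hom R M N, monoid.mult = undefined, one = undefined,
    ring.zero = (\<lambda>x\<in>carrier M. \<zero>\<^bsub>N\<^esub>), add = (\<lambda>f g. \<lambda>x\<in>carrier M. f x \<oplus>\<^bsub>N\<^esub> g x),
    smult = (\<lambda>a f. \<lambda>x\<in>carrier M. a \<odot>\<^bsub>N\<^esub> f x)\<rparr>"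

section \<open>Free modules and tensor products\<close>

text \<open>The free module on a set \<open>S\<close>: finitely supported functions vanishing outside \<open>S\<close>.
  In particular \<open>free_module R {..<n}\<close> is \<open>R\<^sup>n\<close>.\<close>

definition free_module :: "('r, 's) ring_scheme \<Rightarrow> 'b set \<Rightarrow> ('r, 'b \<Rightarrow> 'r) module"
  where "free_module R S = \<lparr>carrier = {f. range f \<subseteq> carrier R \<and> finite {s. f s \<noteq> \<zero>\<^bsub>R\<^esub>} \<and>
      (\<forall>s. s \<notin> S \<longrightarrow> f s = \<zero>\<^bsub>R\<^esub>)},
    monoid.mult = undefined, one = undefined, ring.zero = (\<lambda>s. \<zero>\<^bsub>R\<^esub>),
    add = (\<lambda>f g s. f s \<oplus>\<^bsub>R\<^esub> g s), smult = (\<lambda>a f s. a \<otimes>\<^bsub>R\<^esub> f s)\<rparr>"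

definition free_gen :: "('r, 's) ring_scheme \<Rightarrow> 'b \<Rightarrow> 'b \<Rightarrow> 'r"
  where "free_gen R s = (\<lambda>t. if t = s then \<one>\<^bsub>R\<^esub> else \<zero>\<^bsub>R\<^esub>)"

definition tensor_relations :: "('r, 's) ring_scheme \<Rightarrow> ('r, 'm, 'c) module_scheme \<Rightarrow>
    ('r, 'n, 'd) module_scheme \<Rightarrow> ('m \<times> 'n \<Rightarrow> 'r) set"
  where "tensor_relations R M N =
    (let F = free_module R (carrier M \<times> carrier N); e = (\<lambda>x y. free_gen R (x, y)) in
      {e (x \<oplus>\<^bsub>M\<^esub> x') y \<ominus>\<^bsub>F\<^esub> (e x y \<oplus>\<^bsub>F\<^esub> e x' y) | x x' y.
         x \<in> carrier M \<and> x' \<in> carrier M \<and> y \<in> carrier N} \<union>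
      {e x (y \<oplus>\<^bsub>N\<^esub> y') \<ominus>\<^bsub>F\<^esub> (e x y \<oplus>\<^bsub>F\<^esub> e x y') | x y y'.
         x \<in> carrier M \<and> y \<in> carrier N \<and> y' \<in> carrier N} \<union>
      {e (a \<odot>\<^bsub>M\<^esub> x) y \<ominus>\<^bsub>F\<^esub> a \<odot>\<^bsub>F\<^esub> e x y | a x y.
         a \<in> carrier R \<and> x \<in> carrier M \<and> y \<in> carrier N} \<union>
      {e x (a \<odot>\<^bsub>N\<^esub> y) \<ominus>\<^bsub>F\<^esub> a \<odot>\<^bsub>F\<^esub> e x y | a x y.
         a \<in> carrier R \<and> x \<in> carrier M \<and> y \<in> carrier N})"

definition tensor_kernel :: "('r, 's) ring_scheme \<Rightarrow> ('r, 'm, 'c) module_scheme \<Rightarrow>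
    ('r, 'n, 'd) module_scheme \<Rightarrow> ('m \<times> 'n \<Rightarrow> 'r) set"
  where "tensor_kernel R M N =
    module_span R (free_module R (carrier M \<times> carrier N)) (tensor_relations R M N)"

definition tensor :: "('r, 's) ring_scheme \<Rightarrow> ('r, 'm, 'c) module_scheme \<Rightarrow>
    ('r, 'n, 'd) module_scheme \<Rightarrow> ('r, ('m \<times> 'n \<Rightarrow> 'r) set) module"
  where "tensor R M N =
    quot_module (free_module R (carrier M \<times> carrier N)) (tensor_kernel R M N)"

definition pure_tensor :: "('r, 's) ring_scheme \<Rightarrow> ('r, 'm, 'c) module_scheme \<Rightarrow>
    ('r, 'n, 'd) module_scheme \<Rightarrow> 'm \<Rightarrow> 'n \<Rightarrow> ('m \<times> 'n \<Rightarrow> 'r) set"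
  where "pure_tensor R M N x y =
    tensor_kernel R M N +>\<^bsub>free_module R (carrier M \<times> carrier N)\<^esub> free_gen R (x, y)"

text \<open>The homomorphism \<open>f \<otimes> N : M \<otimes> N \<rightarrow> M' \<otimes> N\<close> induced by \<open>f : M \<rightarrow> M'\<close>.\<close>

definition tensor_map :: "('r, 's) ring_scheme \<Rightarrow> ('r, 'm, 'c) module_scheme \<Rightarrow>
    ('r, 'k, 'e) module_scheme \<Rightarrow> ('r, 'n, 'd) module_scheme \<Rightarrow> ('m \<Rightarrow> 'k) \<Rightarrow>
    ('m \<times> 'n \<Rightarrow> 'r) set \<Rightarrow> ('k \<times> 'n \<Rightarrow> 'r) set"
  where "tensor_map R M M' N f = (THE h. h \<in> mod_hom R (tensor R M N) (tensor R M' N) \<and>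
    (\<forall>x\<in>carrier M. \<forall>y\<in>carrier N. h (pure_tensor R M N x y) = pure_tensor R M' N (f x) y))"

section \<open>Resolutions and syzygies\<close>

text \<open>
  Exactness of \<open>\<dots> \<rightarrow> X 2 \<rightarrow> X 1 \<rightarrow> X 0 \<rightarrow> M \<rightarrow> 0\<close>, where \<open>d i : X i \<rightarrow> X (i - 1)\<close> for \<open>i \<ge> 1\<close>
  and \<open>e : X 0 \<rightarrow> M\<close>. The value \<open>d 0\<close> is irrelevant.
\<close>

definition is_resolution :: "('r, 's) ring_scheme \<Rightarrow> ('r, 'm, 'c) module_scheme \<Rightarrow>
    (nat \<Rightarrow> ('r, 'x) module) \<Rightarrow> (nat \<Rightarrow> 'x \<Rightarrow> 'x) \<Rightarrow> ('x \<Rightarrow> 'm) \<Rightarrow> bool"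
  where "is_resolution R M X d e \<longleftrightarrow>
    (\<forall>i. module R (X i)) \<and>
    (\<forall>i\<ge>1. d i \<in> mod_hom R (X i) (X (i - 1))) \<and>
    e \<in> mod_hom R (X 0) M \<and>
    e ` carrier (X 0) = carrier M \<and>
    a_kernel (X 0) M e = d 1 ` carrier (X 1) \<and>
    (\<forall>i\<ge>1. a_kernel (X i) (X (i - 1)) (d i) = d (i + 1) ` carrier (X (i + 1)))"

record ('r, 'm) free_res =
  rank :: "nat \<Rightarrow> nat"
  diff :: "nat \<Rightarrow> (nat \<Rightarrow> 'r) \<Rightarrow> (nat \<Rightarrow> 'r)"
  aug :: "(nat \<Rightarrow> 'r) \<Rightarrow> 'm"

definition res_module :: "('r, 's) ring_scheme \<Rightarrow> ('r, 'm) free_res \<Rightarrow> nat \<Rightarrow> ('r, nat \<Rightarrow> 'r) module"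
  where "res_module R F i = free_module R {..<rank F i}"

definition minimal_free_resolution ::
    "('r, 's) ring_scheme \<Rightarrow> ('r, 'm, 'c) module_scheme \<Rightarrow> ('r, 'm) free_res \<Rightarrow> bool"
  where "minimal_free_resolution R M F \<longleftrightarrow>
    is_resolution R M (res_module R F) (diff F) (aug F) \<and>
    (\<forall>i\<ge>1. diff F i ` carrier (res_module R F i) \<subseteq>
            ideal_smult R (max_ideal R) (res_module R F (i - 1)))"

text \<open>
  A finitely generated module over a Noetherian local ring has a minimal free resolution by
  modules \<open>R\<^sup>n\<close>, unique up to isomorphism. We fix one; up to isomorphism, the syzygies and the
  modules Tor and Ext below do not depend on this choice.
\<close>

definition min_res :: "('r, 's) ring_scheme \<Rightarrow> ('r, 'm, 'c) module_scheme \<Rightarrow> ('r, 'm) free_res"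
  where "min_res R M = (SOME F. minimal_free_resolution R M F)"

text \<open>For \<open>i \<ge> 1\<close>, the \<open>i\<close>-th syzygy is the image of \<open>F\<^sub>i \<rightarrow> F\<^sub>i\<^sub>-\<^sub>1\<close>. The zeroth syzygy
  would be \<open>M\<close> itself, whose elements have another type; it is not covered.\<close>

definition syzygy :: "('r, 's) ring_scheme \<Rightarrow> ('r, 'm, 'c) module_scheme \<Rightarrow> nat \<Rightarrow>
    ('r, nat \<Rightarrow> 'r) module"
  where "syzygy R M i = (let F = min_res R M in
    (res_module R F (i - 1))\<lparr>carrier := diff F i ` carrier (res_module R F i)\<rparr>)"

definition two_periodic :: "('r, 's) ring_scheme \<Rightarrow> ('r, 'm, 'c) module_scheme \<Rightarrow> bool"
  where "two_periodic R M \<longleftrightarrow> mod_isomorphic R M (syzygy R M 2)"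

section \<open>Tor and Ext\<close>

text \<open>The homology at \<open>C\<close> of a complex with cycles \<open>Z\<close> and boundaries \<open>B\<close> in \<open>C\<close>.\<close>

definition homology :: "('r, 'm, 'c) module_scheme \<Rightarrow> 'm set \<Rightarrow> 'm set \<Rightarrow> ('r, 'm set) module"
  where "homology C Z B = quot_module (C\<lparr>carrier := Z\<rparr>) B"

text \<open>\<open>tor R M N i\<close> is \<open>H\<^sub>i(F \<otimes> N)\<close>, where \<open>F\<close> is the resolution of \<open>M\<close> fixed above.\<close>

definition tor :: "('r, 's) ring_scheme \<Rightarrow> ('r, 'm, 'c) module_scheme \<Rightarrow>
    ('r, 'n, 'd) module_scheme \<Rightarrow> nat \<Rightarrow> ('r, ((nat \<Rightarrow> 'r) \<times> 'n \<Rightarrow> 'r) set set) module"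
  where "tor R M N i = (let F = min_res R M;
      C = (\<lambda>j. tensor R (res_module R F j) N);
      bd = (\<lambda>j. tensor_map R (res_module R F j) (res_module R F (j - 1)) N (diff F j)) in
    homology (C i)
      (if i = 0 then carrier (C 0) else a_kernel (C i) (C (i - 1)) (bd i))
      (bd (i + 1) ` carrier (C (i + 1))))"

definition tor_independent :: "('r, 's) ring_scheme \<Rightarrow> ('r, 'm, 'c) module_scheme \<Rightarrow>
    ('r, 'n, 'd) module_scheme \<Rightarrow> bool"
  where "tor_independent R M N \<longleftrightarrow> (\<forall>i\<ge>1. zero_module (tor R M N i))"

text \<open>\<open>ext_module R M N i\<close> is \<open>H\<^sup>i(Hom(F, N))\<close>, where \<open>F\<close> is the resolution of \<open>M\<close> fixed above.\<close>

definition ext_module :: "('r, 's) ring_scheme \<Rightarrow> ('r, 'm, 'c) module_scheme \<Rightarrow>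
    ('r, 'n, 'd) module_scheme \<Rightarrow> nat \<Rightarrow> ('r, ((nat \<Rightarrow> 'r) \<Rightarrow> 'n) set) module"
  where "ext_module R M N i = (let F = min_res R M;
      C = (\<lambda>j. hom_module R (res_module R F j) N);
      cobd = (\<lambda>j f. compose (carrier (res_module R F (j + 1))) f (diff F (j + 1))) in
    homology (C i)
      (a_kernel (C i) (C (i + 1)) (cobd i))
      (if i = 0 then {\<zero>\<^bsub>C 0\<^esub>} else cobd (i - 1) ` carrier (C (i - 1))))"

section \<open>Gorenstein dimension\<close>

definition dual :: "('r, 's) ring_scheme \<Rightarrow> ('r, 'm, 'c) module_scheme \<Rightarrow> ('r, 'm \<Rightarrow> 'r) module"
  where "dual R M = hom_module R M (self_module R)"

definition biduality :: "('r, 's) ring_scheme \<Rightarrow> ('r, 'm, 'c) module_scheme \<Rightarrow>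
    'm \<Rightarrow> ('m \<Rightarrow> 'r) \<Rightarrow> 'r"
  where "biduality R M = (\<lambda>x\<in>carrier M. \<lambda>f\<in>carrier (dual R M). f x)"

definition totally_reflexive :: "('r, 's) ring_scheme \<Rightarrow> ('r, 'm, 'c) module_scheme \<Rightarrow> bool"
  where "totally_reflexive R M \<longleftrightarrow>
    fg_module R M \<and>
    bij_betw (biduality R M) (carrier M) (carrier (dual R (dual R M))) \<and>
    (\<forall>i\<ge>1. zero_module (ext_module R M (self_module R) i)) \<and>
    (\<forall>i\<ge>1. zero_module (ext_module R (dual R M) (self_module R) i))"

text \<open>
  A resolution \<open>0 \<rightarrow> X n \<rightarrow> \<dots> \<rightarrow> X 0 \<rightarrow> M \<rightarrow> 0\<close> by totally reflexive modules. Taking the elements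
  of the \<open>X i\<close> to be sets of functions \<open>nat \<Rightarrow> 'r\<close> is no restriction: a finitely generated
  module is isomorphic to a quotient of some \<open>R\<^sup>k\<close>, and the elements of such a quotient are
  cosets in \<open>R\<^sup>k\<close>.
\<close>

definition has_G_resolution :: "('r, 's) ring_scheme \<Rightarrow> ('r, 'm, 'c) module_scheme \<Rightarrow> nat \<Rightarrow> bool"
  where "has_G_resolution R M n \<longleftrightarrow>
    (\<exists>(X :: nat \<Rightarrow> ('r, (nat \<Rightarrow> 'r) set) module) d e.
      is_resolution R M X d e \<and>
      (\<forall>i\<le>n. totally_reflexive R (X i)) \<and>
      (\<forall>i>n. zero_module (X i)))"

text \<open>The zero module gets Gorenstein dimension 0 here; all that matters below is finiteness.\<close>

definition Gdim :: "('r, 's) ring_scheme \<Rightarrow> ('r, 'm, 'c) module_scheme \<Rightarrow> enat"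
  where "Gdim R M = (INF n\<in>{n. has_G_resolution R M n}. enat n)"

section \<open>Depth\<close>

definition nonzerodivisor_on :: "('r, 'm, 'c) module_scheme \<Rightarrow> 'r \<Rightarrow> bool"
  where "nonzerodivisor_on M a \<longleftrightarrow> (\<forall>x\<in>carrier M. a \<odot>\<^bsub>M\<^esub> x = \<zero>\<^bsub>M\<^esub> \<longrightarrow> x = \<zero>\<^bsub>M\<^esub>)"

definition regular_sequence ::
    "('r, 's) ring_scheme \<Rightarrow> ('r, 'm, 'c) module_scheme \<Rightarrow> 'r list \<Rightarrow> bool"
  where "regular_sequence R M as \<longleftrightarrow>
    set as \<subseteq> carrier R \<and>
    (\<forall>i<length as.
      nonzerodivisor_on (quot_module M (ideal_smult R (set (take i as)) M)) (as ! i)) \<and>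
    \<not> zero_module (quot_module M (ideal_smult R (set as) M))"

text \<open>The supremum of the lengths of regular sequences in the maximal ideal, except that the
  zero module, which has no regular sequence in the above sense, has depth \<open>\<infinity>\<close>.\<close>

definition depth :: "('r, 's) ring_scheme \<Rightarrow> ('r, 'm, 'c) module_scheme \<Rightarrow> enat"
  where "depth R M = (if zero_module M then \<infinity> else
    (SUP as\<in>{as. regular_sequence R M as \<and> set as \<subseteq> max_ideal R}. enat (length as)))"

end

theory Submission
  imports Defs
begin

text \<open>
  A two-periodic \<open>M \<noteq> 0\<close> is the cokernel of a map \<open>d : R\<^sup>a \<rightarrow> R\<^sup>b\<close> with entries in the maximal ideal
  which, together with some \<open>e : R\<^sup>b \<rightarrow> R\<^sup>a\<close>, forms an exact complex of period two. Since \<open>Tor\<close>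
  vanishes, \<open>d \<otimes> N\<close> and \<open>e \<otimes> N\<close> still form an exact complex, and \<open>C = M \<otimes> N\<close> is the cokernel of
  \<open>d \<otimes> N\<close>. Exactness passes to \<open>N/xN\<close> for every \<open>N\<close>-regular \<open>x\<close>, and \<open>e\<close> embeds \<open>C\<close> into \<open>N\<^sup>a\<close>,
  so \<open>N\<close>-regular sequences are \<open>C\<close>-regular. If \<open>J = (x\<^sub>1, \<dots>, x\<^sub>n)N\<close> for a maximal \<open>N\<close>-regular
  sequence, then \<open>N/J\<close> contains some \<open>s \<noteq> 0\<close> that the maximal ideal kills. As \<open>d\<close> has its entries
  there, a unit vector times \<open>s\<close> is a cycle modulo \<open>J\<close>, hence equal to \<open>e v\<close> modulo \<open>J\<close> for
  some \<open>v\<close>, and the class of \<open>v\<close> is killed by the maximal ideal too. Thus the sequence is also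
  maximal for \<open>C\<close>, and all maximal regular sequences on a module have the same length. This gives
  \<open>depth (M \<otimes> N) = depth N\<close>, and \<open>depth M = depth R\<close> is the case \<open>N = R\<close>.
\<close>

section \<open>Submodules of finitely generated modules\<close>

text \<open>The map \<open>e\<close> is the composite of the augmentation of R^b onto M with the
  isomorphism of M onto its second syzygy inside R^a. Tor-independence speaks only of the resolution
  of M. The vanishing of Tor_1 is exactness at N^a, since \<open>e\<close> has the image of the
  second differential. Exactness at N^b is different: there \<open>e\<close> itself takes the place
  of a differential, and two resolutions of its cokernel have to be compared. Depth is treated
  elementwise, without Ext: depth zero is detected by a nonzero element that the maximal ideal
  kills, and lengths of regular sequences are compared by exchanging members. Iterated quotients
  would change the type at every step and so block an induction along a sequence; quotients of a
  fixed module are therefore represented by its submodules. Finiteness of depth is not established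
  beforehand: the bound that yields a longest sequence on N comes from a sequence on the cokernel
  that is assumed to be too long.\<close>

lemma (in cring) cring_idealI:
  assumes sub: "I \<subseteq> carrier R" and zero: "\<zero> \<in> I"
    and add: "\<And>a b. a \<in> I \<Longrightarrow> b \<in> I \<Longrightarrow> a \<oplus> b \<in> I"
    and mult: "\<And>r a. r \<in> carrier R \<Longrightarrow> a \<in> I \<Longrightarrow> r \<otimes> a \<in> I"
  shows "ideal I R"
proof (rule idealI[OF ring_axioms])
  have "\<ominus> a \<in> I" if "a \<in> I" for a
    using mult[of "\<ominus> \<one>", OF _ that] that sub by (auto simp: l_minus)
  then show "subgroup I (add_monoid R)"
    using sub zero add by (auto intro!: subgroup.intro simp: a_inv_def[symmetric])
  fix a x assume "a \<in> I" "x \<in> carrier R"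
  then show "x \<otimes> a \<in> I" "a \<otimes> x \<in> I" using mult[of x a] sub m_comm[of a x] by auto
qed

text \<open>Zorn's lemma applies to the ideals with any property \<open>P\<close>, because over a
  noetherian ring a nonempty chain of ideals contains its own union.\<close>

lemma (in noetherian_ring) maximal_ideal_exists:
  assumes "P I0" "\<And>I. P I \<Longrightarrow> ideal I R"
  obtains I where "P I" "\<And>J. P J \<Longrightarrow> I \<subseteq> J \<Longrightarrow> J = I"
proof -
  define F where "F = Collect P"
  have F: "F \<noteq> {}" "F \<subseteq> {I. ideal I R}" using assms unfolding F_def by auto
  have "\<exists>I\<in>F. \<forall>J\<in>F. I \<subseteq> J \<longrightarrow> J = I"
  proof (rule subset_Zorn_nonempty[OF F(1)])
    fix C assume C: "C \<noteq> {}" "subset.chain F C"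
    then have "subset.chain {I. ideal I R} C" using F(2) by (auto simp: subset.chain_def)
    then have "\<Union>C \<in> C" by (rule ideal_chain_is_trivial[OF C(1)])
    then show "\<Union>C \<in> F" using C(2) unfolding subset.chain_def by blast
  qed
  then obtain I where "I \<in> F" and max: "\<forall>J\<in>F. I \<subseteq> J \<longrightarrow> J = I" by (rule bexE)
  show thesis
  proof (rule that)
    show "P I" using \<open>I \<in> F\<close> by (simp add: F_def)
    show "J = I" if "P J" "I \<subseteq> J" for J
      using bspec[OF max, of "J"] that by (simp add: F_def)
  qed
qed

section \<open>Submodules, spans and the submodules K + xM\<close>

context module
begin

lemma submodule_subset: "submodule K R M \<Longrightarrow> K \<subseteq> carrier M"
  by (rule submoduleE(1))

lemma submodule_mem: "submodule K R M \<Longrightarrow> u \<in> K \<Longrightarrow> u \<in> carrier M"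
  using submodule_subset by blast

lemma submodule_zero: "submodule K R M \<Longrightarrow> \<zero>\<^bsub>M\<^esub> \<in> K"
  by (metis equals0I smult_l_null submodule_mem submoduleE(2,4) R.zero_closed)

lemmas submodule_add = submoduleE(5)
lemmas submodule_smult = submoduleE(4)
lemmas submodule_neg = submoduleE(3)

lemma submodule_diff:
  assumes "submodule K R M" "u \<in> K" "v \<in> K"
  shows "u \<ominus>\<^bsub>M\<^esub> v \<in> K"
  using assms by (simp add: M.minus_eq submodule_add submodule_neg)

lemma submodule_cancel:
  assumes K: "submodule K R M" and k: "k \<in> K" and u: "u \<in> carrier M" and "k \<oplus>\<^bsub>M\<^esub> u \<in> K"
  shows "u \<in> K"
proof -
  have "\<ominus>\<^bsub>M\<^esub> k \<oplus>\<^bsub>M\<^esub> (k \<oplus>\<^bsub>M\<^esub> u) \<in> K"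
    by (rule submodule_add[OF K submodule_neg[OF K k]]) fact
  then show ?thesis using submodule_mem[OF K k] u by (simp add: M.r_neg1)
qed

lemma submodule_diff_cancel:
  assumes K: "submodule K R M" and k: "k \<in> K" and u: "u \<in> carrier M" and "u \<ominus>\<^bsub>M\<^esub> k \<in> K"
  shows "u \<in> K"
  using submodule_cancel[OF K submodule_neg[OF K k] u] assms submodule_mem[OF K k]
  by (simp add: M.minus_eq M.a_comm)

lemma zero_submodule: "submodule {\<zero>\<^bsub>M\<^esub>} R M"
  by (rule submoduleI) auto

lemma submodule_Inter:
  assumes "\<And>K. K \<in> F \<Longrightarrow> submodule K R M" "F \<noteq> {}"
  shows "submodule (\<Inter>F) R M"
proof (rule submoduleI)
  show "\<Inter>F \<subseteq> carrier M" using assms submodule_subset by blast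
qed (use assms in \<open>auto intro: submodule_zero submodule_neg submodule_add submodule_smult\<close>)

lemma submodule_Int:
  assumes "submodule K R M" "submodule L R M"
  shows "submodule (K \<inter> L) R M"
  using submodule_Inter[of "{K, L}"] assms by auto

lemma span_submodule: "S \<subseteq> carrier M \<Longrightarrow> submodule (module_span R M S) R M"
  unfolding module_span_def by (rule submodule_Inter) (use carrier_is_submodule in auto)

lemma span_superset: "S \<subseteq> module_span R M S"
  unfolding module_span_def by blast

lemma span_minimal: "submodule K R M \<Longrightarrow> S \<subseteq> K \<Longrightarrow> module_span R M S \<subseteq> K"
  unfolding module_span_def by blast

lemma span_eqI: "submodule K R M \<Longrightarrow> S \<subseteq> K \<Longrightarrow> (\<And>H. submodule H R M \<Longrightarrow> S \<subseteq> H \<Longrightarrow> K \<subseteq> H)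
   \<Longrightarrow> module_span R M S = K"
  unfolding module_span_def by blast

lemma span_empty: "module_span R M {} = {\<zero>\<^bsub>M\<^esub>}"
  by (rule span_eqI) (auto simp: zero_submodule submodule_zero)

text \<open>With \<open>K\<close> standing for M/K, this submodule K + xM stands for the quotient of
  M/K by the multiples of \<open>x\<close>.\<close>

definition adjoin
  where "adjoin K x = {k \<oplus>\<^bsub>M\<^esub> x \<odot>\<^bsub>M\<^esub> u | k u. k \<in> K \<and> u \<in> carrier M}"

lemma add_add_swap: "\<lbrakk>a \<in> carrier M; b \<in> carrier M; c \<in> carrier M; d \<in> carrier M\<rbrakk> \<Longrightarrow>
   (a \<oplus>\<^bsub>M\<^esub> b) \<oplus>\<^bsub>M\<^esub> (c \<oplus>\<^bsub>M\<^esub> d) = (a \<oplus>\<^bsub>M\<^esub> c) \<oplus>\<^bsub>M\<^esub> (b \<oplus>\<^bsub>M\<^esub> d)"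
  by (simp add: M.a_ac)

lemma submodule_sum:
  assumes K: "submodule K R M" and L: "submodule L R M"
  shows "submodule {k \<oplus>\<^bsub>M\<^esub> l | k l. k \<in> K \<and> l \<in> L} R M" (is "submodule ?A R M")
proof (rule submoduleI)
  note [simp] = submodule_mem[OF K] submodule_mem[OF L]
  show "?A \<subseteq> carrier M" by auto
  show "\<zero>\<^bsub>M\<^esub> \<in> ?A"
    using submodule_zero[OF K] submodule_zero[OF L] by (force intro!: exI[of _ "\<zero>\<^bsub>M\<^esub>"])
  fix a assume "a \<in> ?A"
  then obtain k l where a: "a = k \<oplus>\<^bsub>M\<^esub> l" "k \<in> K" "l \<in> L" by blast
  then have "\<ominus>\<^bsub>M\<^esub> a = \<ominus>\<^bsub>M\<^esub> k \<oplus>\<^bsub>M\<^esub> \<ominus>\<^bsub>M\<^esub> l" by (simp add: M.minus_add)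
  then show "\<ominus>\<^bsub>M\<^esub> a \<in> ?A" using a submodule_neg[OF K] submodule_neg[OF L] by blast
  {
    fix b assume "b \<in> ?A"
    then obtain k' l' where b: "b = k' \<oplus>\<^bsub>M\<^esub> l'" "k' \<in> K" "l' \<in> L" by blast
    have "a \<oplus>\<^bsub>M\<^esub> b = (k \<oplus>\<^bsub>M\<^esub> k') \<oplus>\<^bsub>M\<^esub> (l \<oplus>\<^bsub>M\<^esub> l')"
      using a b by (simp add: add_add_swap)
    then show "a \<oplus>\<^bsub>M\<^esub> b \<in> ?A"
      using a b submodule_add[OF K] submodule_add[OF L] by blast
  }
  fix r assume "r \<in> carrier R"
  then show "r \<odot>\<^bsub>M\<^esub> a \<in> ?A"
    using a submodule_smult[OF K] submodule_smult[OF L] by (force simp: smult_r_distr)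
qed

lemma smult_commute: "\<lbrakk>x \<in> carrier R; y \<in> carrier R; u \<in> carrier M\<rbrakk> \<Longrightarrow>
    x \<odot>\<^bsub>M\<^esub> (y \<odot>\<^bsub>M\<^esub> u) = y \<odot>\<^bsub>M\<^esub> (x \<odot>\<^bsub>M\<^esub> u)"
  by (metis R.m_comm smult_assoc1)

lemma smult_image_submodule: "x \<in> carrier R \<Longrightarrow> submodule ((\<odot>\<^bsub>M\<^esub>) x ` carrier M) R M"
proof (rule submoduleI)
  assume x: "x \<in> carrier R"
  show "(\<odot>\<^bsub>M\<^esub>) x ` carrier M \<subseteq> carrier M" using x by auto
  show "\<zero>\<^bsub>M\<^esub> \<in> (\<odot>\<^bsub>M\<^esub>) x ` carrier M" using x by (intro image_eqI[of _ _ "\<zero>\<^bsub>M\<^esub>"]) auto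
  fix a assume "a \<in> (\<odot>\<^bsub>M\<^esub>) x ` carrier M"
  then obtain u where u: "a = x \<odot>\<^bsub>M\<^esub> u" "u \<in> carrier M" by blast
  show "\<ominus>\<^bsub>M\<^esub> a \<in> (\<odot>\<^bsub>M\<^esub>) x ` carrier M"
    using u x by (metis M.a_inv_closed imageI smult_r_minus)
  { fix b assume "b \<in> (\<odot>\<^bsub>M\<^esub>) x ` carrier M"
    then show "a \<oplus>\<^bsub>M\<^esub> b \<in> (\<odot>\<^bsub>M\<^esub>) x ` carrier M"
      using u x by (auto simp flip: smult_r_distr) }
  fix r assume "r \<in> carrier R"
  then show "r \<odot>\<^bsub>M\<^esub> a \<in> (\<odot>\<^bsub>M\<^esub>) x ` carrier M"
    using u x by (auto simp: smult_commute[of r x])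
qed

lemma adjoin_eq_sum: "adjoin K x = {k \<oplus>\<^bsub>M\<^esub> l | k l. k \<in> K \<and> l \<in> (\<odot>\<^bsub>M\<^esub>) x ` carrier M}"
  unfolding adjoin_def by auto

lemma adjoin_submodule:
  assumes "submodule K R M" "x \<in> carrier R"
  shows "submodule (adjoin K x) R M"
  unfolding adjoin_eq_sum by (intro submodule_sum smult_image_submodule assms)

lemma adjoin_superset:
  assumes "submodule K R M" "x \<in> carrier R" shows "K \<subseteq> adjoin K x"
proof
  fix k assume "k \<in> K"
  then have "k = k \<oplus>\<^bsub>M\<^esub> x \<odot>\<^bsub>M\<^esub> \<zero>\<^bsub>M\<^esub>" using assms submodule_mem by simp
  then show "k \<in> adjoin K x" unfolding adjoin_def using \<open>k \<in> K\<close> by blast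
qed

lemma smult_in_adjoin:
  assumes "submodule K R M" "x \<in> carrier R" "u \<in> carrier M" shows "x \<odot>\<^bsub>M\<^esub> u \<in> adjoin K x"
proof -
  have "x \<odot>\<^bsub>M\<^esub> u = \<zero>\<^bsub>M\<^esub> \<oplus>\<^bsub>M\<^esub> x \<odot>\<^bsub>M\<^esub> u" using assms by simp
  then show ?thesis unfolding adjoin_def using assms submodule_zero by blast
qed

lemma adjoin_minimal:
  assumes "submodule H R M" "K \<subseteq> H" "\<And>u. u \<in> carrier M \<Longrightarrow> x \<odot>\<^bsub>M\<^esub> u \<in> H"
  shows "adjoin K x \<subseteq> H"
  unfolding adjoin_def using assms submodule_add by blast

lemma adjoin_mono: "K \<subseteq> K' \<Longrightarrow> adjoin K x \<subseteq> adjoin K' x"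
  unfolding adjoin_def by blast

lemma adjoin_commute:
  assumes K: "submodule K R M" and x: "x \<in> carrier R" and y: "y \<in> carrier R"
  shows "adjoin (adjoin K x) y = adjoin (adjoin K y) x"
proof -
  have "adjoin (adjoin K x) y \<subseteq> adjoin (adjoin K y) x"
    if x: "x \<in> carrier R" and y: "y \<in> carrier R" for x y
  proof (rule adjoin_minimal)
    show "submodule (adjoin (adjoin K y) x) R M" using K x y by (intro adjoin_submodule)
    show "adjoin K x \<subseteq> adjoin (adjoin K y) x" using K y by (intro adjoin_mono adjoin_superset)
    fix u assume "u \<in> carrier M"
    then have "y \<odot>\<^bsub>M\<^esub> u \<in> adjoin K y" using K y by (rule_tac smult_in_adjoin)
    then show "y \<odot>\<^bsub>M\<^esub> u \<in> adjoin (adjoin K y) x"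
      using adjoin_superset[OF adjoin_submodule[OF K y] x] by blast
  qed
  then show ?thesis using x y by blast
qed

lemma cyclic_submodule:
  assumes x: "x \<in> carrier M"
  shows "submodule ((\<lambda>r. r \<odot>\<^bsub>M\<^esub> x) ` carrier R) R M"
proof (rule submoduleI)
  show "(\<lambda>r. r \<odot>\<^bsub>M\<^esub> x) ` carrier R \<subseteq> carrier M" using x by auto
  show "\<zero>\<^bsub>M\<^esub> \<in> (\<lambda>r. r \<odot>\<^bsub>M\<^esub> x) ` carrier R" using x by (intro image_eqI[of _ _ \<zero>]) auto
  fix a assume "a \<in> (\<lambda>r. r \<odot>\<^bsub>M\<^esub> x) ` carrier R"
  then obtain r where r: "a = r \<odot>\<^bsub>M\<^esub> x" "r \<in> carrier R" by blast
  show "\<ominus>\<^bsub>M\<^esub> a \<in> (\<lambda>r. r \<odot>\<^bsub>M\<^esub> x) ` carrier R"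
    using r x by (metis R.a_inv_closed imageI smult_l_minus)
  { fix b assume "b \<in> (\<lambda>r. r \<odot>\<^bsub>M\<^esub> x) ` carrier R"
    then show "a \<oplus>\<^bsub>M\<^esub> b \<in> (\<lambda>r. r \<odot>\<^bsub>M\<^esub> x) ` carrier R"
      using r x by (auto simp flip: smult_l_distr) }
  fix s assume "s \<in> carrier R"
  then show "s \<odot>\<^bsub>M\<^esub> a \<in> (\<lambda>r. r \<odot>\<^bsub>M\<^esub> x) ` carrier R"
    using r x by (auto simp flip: smult_assoc1)
qed

lemma span_insert:
  assumes S: "S \<subseteq> carrier M" and x: "x \<in> carrier M"
  shows "module_span R M (insert x S) =
    {h \<oplus>\<^bsub>M\<^esub> r \<odot>\<^bsub>M\<^esub> x | h r. h \<in> module_span R M S \<and> r \<in> carrier R}"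
proof (rule span_eqI)
  let ?A = "{h \<oplus>\<^bsub>M\<^esub> r \<odot>\<^bsub>M\<^esub> x | h r. h \<in> module_span R M S \<and> r \<in> carrier R}"
  from submodule_sum[OF span_submodule[OF S] cyclic_submodule[OF x]]
  have "submodule {k \<oplus>\<^bsub>M\<^esub> l |k l. k \<in> module_span R M S \<and> l \<in> (\<lambda>r. r \<odot>\<^bsub>M\<^esub> x) ` carrier R} R M" .
  also have "{k \<oplus>\<^bsub>M\<^esub> l |k l. k \<in> module_span R M S \<and> l \<in> (\<lambda>r. r \<odot>\<^bsub>M\<^esub> x) ` carrier R} = ?A"
    by auto
  finally show "submodule ?A R M" .
  have sp: "submodule (module_span R M S) R M" by (rule span_submodule[OF S])
  have "y \<in> ?A" if y: "y \<in> S" for y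
  proof -
    have "y = y \<oplus>\<^bsub>M\<^esub> \<zero> \<odot>\<^bsub>M\<^esub> x" using y S x by auto
    then show ?thesis using y span_superset[of S] by blast
  qed
  moreover have "x \<in> ?A"
  proof -
    have "x = \<zero>\<^bsub>M\<^esub> \<oplus>\<^bsub>M\<^esub> \<one> \<odot>\<^bsub>M\<^esub> x" using x by auto
    then show ?thesis using submodule_zero[OF sp] by blast
  qed
  ultimately show "insert x S \<subseteq> ?A" by blast
  fix H assume H: "submodule H R M" "insert x S \<subseteq> H"
  then have "module_span R M S \<subseteq> H" by (intro span_minimal) auto
  then show "?A \<subseteq> H" using H by (auto intro!: submodule_add submodule_smult)
qed

text \<open>A quotient \<open>M/K\<close> is represented by \<open>K\<close>. This keeps the type fixed when one
  passes to successive quotients by the members of a sequence.\<close>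

definition regular_mod :: "'c set \<Rightarrow> 'a \<Rightarrow> bool"
  where "regular_mod K x \<longleftrightarrow> (\<forall>u\<in>carrier M. x \<odot>\<^bsub>M\<^esub> u \<in> K \<longrightarrow> u \<in> K)"

lemma regular_modD: "regular_mod K x \<Longrightarrow> u \<in> carrier M \<Longrightarrow> x \<odot>\<^bsub>M\<^esub> u \<in> K \<Longrightarrow> u \<in> K"
  unfolding regular_mod_def by blast

definition adjoins :: "'c set \<Rightarrow> 'a list \<Rightarrow> 'c set"
  where "adjoins K xs = foldl adjoin K xs"

lemma adjoins_simps [simp]:
  "adjoins K [] = K" "adjoins K (x # xs) = adjoins (adjoin K x) xs"
  "adjoins K (xs @ [x]) = adjoin (adjoins K xs) x"
  by (simp_all add: adjoins_def)

lemma adjoins_submodule: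
  "submodule K R M \<Longrightarrow> set xs \<subseteq> carrier R \<Longrightarrow> submodule (adjoins K xs) R M"
  by (induction xs arbitrary: K) (auto intro: adjoin_submodule)

fun regular_seq :: "'c set \<Rightarrow> 'a list \<Rightarrow> bool" where
  "regular_seq K [] \<longleftrightarrow> True"
| "regular_seq K (x # xs) \<longleftrightarrow> regular_mod K x \<and> regular_seq (adjoin K x) xs"

lemma regular_seq_append:
  "regular_seq K (xs @ ys) \<longleftrightarrow> regular_seq K xs \<and> regular_seq (adjoins K xs) ys"
  by (induction xs arbitrary: K) auto

lemma regular_seq_iff:
  "regular_seq K xs \<longleftrightarrow> (\<forall>i<length xs. regular_mod (adjoins K (take i xs)) (xs ! i))"
proof (induction xs arbitrary: K)
  case (Cons x xs)
  show ?case unfolding regular_seq.simps Cons.IH by (auto simp: less_Suc_eq_0_disj)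
qed auto

text \<open>The coefficients with which the last generator \<open>x\<close> occurs in elements of
  \<open>K\<close> form an ideal, which is finitely generated. Lifts of its generators to
  \<open>K\<close>, together with generators of the part of \<open>K\<close> inside the span
  \<open>L\<close> of the remaining generators, generate \<open>K\<close>.\<close>

lemma submodules_fg:
  assumes "noetherian_ring R" "finite S" "S \<subseteq> carrier M"
    and "submodule K R M" "K \<subseteq> module_span R M S"
  shows "\<exists>T. finite T \<and> T \<subseteq> K \<and> module_span R M T = K"
  using assms(2-5)
proof (induction S arbitrary: K)
  case empty
  then have "K = {\<zero>\<^bsub>M\<^esub>}" using submodule_zero[of K] by (auto simp: span_empty)
  then show ?case using span_empty by blast
next
  case (insert x S)
  interpret N: noetherian_ring R by fact
  have S: "S \<subseteq> carrier M" and x: "x \<in> carrier M" using insert.prems by auto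
  define L where "L = module_span R M S"
  have L: "submodule L R M" unfolding L_def by (rule span_submodule[OF S])
  note K = \<open>submodule K R M\<close>
  \<comment> \<open>The coefficient ideal is defined for every submodule \<open>H\<close>, since it
    is needed for \<open>K\<close> and for the span of the candidate generators
    \<open>U\<close>.\<close>
  define I where "I H = {r \<in> carrier R. \<exists>h\<in>L. h \<oplus>\<^bsub>M\<^esub> r \<odot>\<^bsub>M\<^esub> x \<in> H}" for H
  have idl: "ideal (I H) R" if H: "submodule H R M" for H
  proof (rule R.cring_idealI)
    show "r \<otimes> a \<in> I H" if a: "a \<in> I H" and r: "r \<in> carrier R" for r a
    proof -
      obtain h where h: "h \<in> L" "h \<oplus>\<^bsub>M\<^esub> a \<odot>\<^bsub>M\<^esub> x \<in> H" and aR: "a \<in> carrier R"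
        using a unfolding I_def by blast
      have "r \<odot>\<^bsub>M\<^esub> h \<oplus>\<^bsub>M\<^esub> (r \<otimes> a) \<odot>\<^bsub>M\<^esub> x = r \<odot>\<^bsub>M\<^esub> (h \<oplus>\<^bsub>M\<^esub> a \<odot>\<^bsub>M\<^esub> x)"
        using submodule_mem[OF L h(1)] r aR x by (simp add: smult_r_distr smult_assoc1)
      also have "\<dots> \<in> H" using h r by (intro submodule_smult[OF H])
      finally show ?thesis using r aR submodule_smult[OF L r h(1)] unfolding I_def by blast
    qed
    show "a \<oplus> b \<in> I H" if ab: "a \<in> I H" "b \<in> I H" for a b
    proof -
      obtain h g where h: "h \<in> L" "h \<oplus>\<^bsub>M\<^esub> a \<odot>\<^bsub>M\<^esub> x \<in> H"
        and g: "g \<in> L" "g \<oplus>\<^bsub>M\<^esub> b \<odot>\<^bsub>M\<^esub> x \<in> H" and aR: "a \<in> carrier R" "b \<in> carrier R"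
        using ab unfolding I_def by blast
      have "(h \<oplus>\<^bsub>M\<^esub> g) \<oplus>\<^bsub>M\<^esub> (a \<oplus> b) \<odot>\<^bsub>M\<^esub> x
        = (h \<oplus>\<^bsub>M\<^esub> a \<odot>\<^bsub>M\<^esub> x) \<oplus>\<^bsub>M\<^esub> (g \<oplus>\<^bsub>M\<^esub> b \<odot>\<^bsub>M\<^esub> x)"
        using submodule_mem[OF L h(1)] submodule_mem[OF L g(1)] aR x
        by (simp add: smult_l_distr add_add_swap)
      also have "\<dots> \<in> H" by (rule submodule_add[OF H h(2) g(2)])
      finally show ?thesis using aR submodule_add[OF L h(1) g(1)] unfolding I_def by blast
    qed
    show "I H \<subseteq> carrier R" by (auto simp: I_def)
    show "\<zero> \<in> I H"
      using submodule_zero[OF L] submodule_zero[OF H] x unfolding I_def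
      by (auto intro!: bexI[of _ "\<zero>\<^bsub>M\<^esub>"])
  qed
  obtain A where A: "A \<subseteq> carrier R" "finite A" "I K = Idl A"
    using N.finetely_gen[OF idl[OF K]] by blast
  have AI: "A \<subseteq> I K" using A by (simp add: R.genideal_self)
  then have "\<forall>a\<in>A. \<exists>h. h \<in> L \<and> h \<oplus>\<^bsub>M\<^esub> a \<odot>\<^bsub>M\<^esub> x \<in> K" unfolding I_def by blast
  then obtain h where h: "\<And>a. a \<in> A \<Longrightarrow> h a \<in> L \<and> h a \<oplus>\<^bsub>M\<^esub> a \<odot>\<^bsub>M\<^esub> x \<in> K" by metis
  define k where "k a = h a \<oplus>\<^bsub>M\<^esub> a \<odot>\<^bsub>M\<^esub> x" for a
  obtain T where T: "finite T" "T \<subseteq> K \<inter> L" "module_span R M T = K \<inter> L"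
    using insert.IH[OF S submodule_Int[OF K L]] unfolding L_def by blast
  define U where "U = T \<union> k ` A"
  have UK: "U \<subseteq> K" using T h unfolding U_def k_def by blast
  then have UM: "U \<subseteq> carrier M" using submodule_subset[OF K] by blast
  have sU: "submodule (module_span R M U) R M" by (rule span_submodule[OF UM])
  have "a \<in> I (module_span R M U)" if a: "a \<in> A" for a
  proof -
    have "k a \<in> module_span R M U" using a span_superset[of U] unfolding U_def by blast
    then show ?thesis using a A h[OF a] unfolding I_def k_def by blast
  qed
  \<comment> \<open>The span of \<open>U\<close> realizes every coefficient that \<open>K\<close>
    realizes, so an element of \<open>K\<close> can be corrected by an element of this span to lie
    in \<open>L\<close>.\<close>
  then have IU: "I K \<subseteq> I (module_span R M U)"
    unfolding A(3) by (intro R.genideal_minimal idl[OF sU]) auto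
  have "K \<subseteq> module_span R M U"
  proof
    fix u assume u: "u \<in> K"
    then have "u \<in> module_span R M (insert x S)" using insert.prems by blast
    then obtain l r where l: "l \<in> L" "r \<in> carrier R" and ul: "u = l \<oplus>\<^bsub>M\<^esub> r \<odot>\<^bsub>M\<^esub> x"
      unfolding span_insert[OF S x] L_def by blast
    then have "r \<in> I K" using u unfolding I_def by blast
    then obtain g where g: "g \<in> L" "g \<oplus>\<^bsub>M\<^esub> r \<odot>\<^bsub>M\<^esub> x \<in> module_span R M U"
      using IU unfolding I_def by blast
    define v where "v = g \<oplus>\<^bsub>M\<^esub> r \<odot>\<^bsub>M\<^esub> x"
    have vK: "v \<in> K" using g span_minimal[OF K UK] unfolding v_def by blast
    note mem = submodule_mem[OF L l(1)] submodule_mem[OF L g(1)]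
    have "u \<ominus>\<^bsub>M\<^esub> v = l \<ominus>\<^bsub>M\<^esub> g"
      unfolding ul v_def using l x mem
      by (simp add: M.minus_eq M.minus_add M.a_ac M.r_neg M.r_neg1 M.r_neg2)
    then have "u \<ominus>\<^bsub>M\<^esub> v \<in> L" using submodule_diff[OF L l(1) g(1)] by simp
    moreover have "u \<ominus>\<^bsub>M\<^esub> v \<in> K" using u vK by (rule submodule_diff[OF K])
    ultimately have "u \<ominus>\<^bsub>M\<^esub> v \<in> module_span R M T" using T by blast
    also have "\<dots> \<subseteq> module_span R M U"
      by (intro span_minimal[OF sU]) (use span_superset[of U] in \<open>auto simp: U_def\<close>)
    finally show "u \<in> module_span R M U"
      by (intro submodule_diff_cancel[OF sU, of v u]) (use g v_def submodule_mem[OF K u] in auto)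
  qed
  then have "module_span R M U = K" using span_minimal[OF K UK] by blast
  moreover have "finite U" unfolding U_def using T A by auto
  ultimately show ?case using UK by blast
qed

lemma chain_Union_submodule:
  assumes "subset.chain {K. submodule K R M} C" "C \<noteq> {}"
  shows "submodule (\<Union>C) R M"
proof -
  have sub: "submodule K R M" if "K \<in> C" for K using that assms by (auto simp: subset.chain_def)
  have dir: "\<exists>K\<in>C. a \<in> K \<and> b \<in> K" if ab: "a \<in> \<Union>C" "b \<in> \<Union>C" for a b
  proof -
    obtain A B where "A \<in> C" "B \<in> C" "a \<in> A" "b \<in> B" using ab by blast
    moreover then have "A \<subseteq> B \<or> B \<subseteq> A" using assms unfolding subset.chain_def by blast
    ultimately show ?thesis by blast
  qed
  show ?thesis
  proof (rule submoduleI)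
    show "\<Union>C \<subseteq> carrier M" using sub submodule_subset by blast
    show "\<zero>\<^bsub>M\<^esub> \<in> \<Union>C" using assms(2) sub submodule_zero by blast
    fix a assume a: "a \<in> \<Union>C"
    show "\<ominus>\<^bsub>M\<^esub> a \<in> \<Union>C" using a sub submodule_neg by blast
    show "a \<oplus>\<^bsub>M\<^esub> b \<in> \<Union>C" if "b \<in> \<Union>C" for b
      using dir[OF a that] sub submodule_add by blast
  next
    fix r a assume "r \<in> carrier R" "a \<in> \<Union>C"
    then show "r \<odot>\<^bsub>M\<^esub> a \<in> \<Union>C" using sub submodule_smult by blast
  qed
qed

text \<open>The union of a chain is finitely generated, and its finitely many generators already lie
  in one member of the chain, which is then the union itself. So Zorn's lemma applies.\<close>

lemma noetherian_maximal:
  assumes "noetherian_ring R" "fg_module R M"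
    and "P K0" "\<And>K. P K \<Longrightarrow> submodule K R M"
  obtains K where "P K" "\<And>K'. P K' \<Longrightarrow> K \<subseteq> K' \<Longrightarrow> K' = K"
proof -
  define F where "F = Collect P"
  have F: "F \<noteq> {}" "\<And>K. K \<in> F \<Longrightarrow> submodule K R M" using assms unfolding F_def by auto
  have "\<exists>K\<in>F. \<forall>K'\<in>F. K \<subseteq> K' \<longrightarrow> K' = K"
  proof (rule subset_Zorn_nonempty[OF F(1)])
    fix C assume C: "C \<noteq> {}" "subset.chain F C"
    then have ch: "subset.chain {K. submodule K R M} C" using F by (auto simp: subset.chain_def)
    have sub: "submodule (\<Union>C) R M" by (rule chain_Union_submodule[OF ch C(1)])
    obtain S where S: "finite S" "S \<subseteq> carrier M" "module_span R M S = carrier M"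
      using assms(2) unfolding fg_module_def by blast
    obtain T where T: "finite T" "T \<subseteq> \<Union>C" "module_span R M T = \<Union>C"
      using submodules_fg[OF assms(1) S(1,2) sub] S(3) submodule_subset[OF sub] by blast
    have "\<exists>K\<in>C. T \<subseteq> K"
      using T(1,2)
    proof (induction T)
      case empty
      then show ?case using C by blast
    next
      case (insert t T)
      then obtain K K' where "K \<in> C" "T \<subseteq> K" "K' \<in> C" "t \<in> K'" by blast
      moreover then have "K \<subseteq> K' \<or> K' \<subseteq> K" using C unfolding subset.chain_def by blast
      ultimately show ?case by blast
    qed
    then obtain K where K: "K \<in> C" "T \<subseteq> K" by blast
    have "submodule K R M" using K(1) ch unfolding subset.chain_def by blast
    then have "\<Union>C \<subseteq> K" using span_minimal[of K T] K T by blast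
    then have "\<Union>C = K" using K by blast
    then show "\<Union>C \<in> F" using K(1) C(2) unfolding subset.chain_def by blast
  qed
  then obtain K where "K \<in> F" and max: "\<forall>K'\<in>F. K \<subseteq> K' \<longrightarrow> K' = K" by (rule bexE)
  show thesis
  proof (rule that)
    show "P K" using \<open>K \<in> F\<close> by (simp add: F_def)
    show "K' = K" if "P K'" "K \<subseteq> K'" for K'
      using bspec[OF max, of "K'"] that by (simp add: F_def)
  qed
qed

end

section \<open>Regular sequences over a local ring\<close>

lemma noetherian_local_maximalideal:
  "noetherian_local_ring R \<Longrightarrow> maximalideal (max_ideal R) R"
  unfolding noetherian_local_ring_def max_ideal_def by (elim conjE) (rule theI')

section \<open>Units, the maximal ideal and prime avoidance\<close>

context cring
begin

text \<open>The principal ideal of a nonunit is proper, so it lies in a maximal ideal, and there is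
  only one of these.\<close>

lemma nonunit_in_max_ideal:
  assumes R: "noetherian_local_ring R" and x: "x \<in> carrier R" "x \<notin> Units R"
  shows "x \<in> max_ideal R"
proof -
  interpret N: noetherian_ring R using R unfolding noetherian_local_ring_def by blast
  have "\<one> \<notin> PIdl x"
  proof
    assume "\<one> \<in> PIdl x"
    then obtain y where "y \<in> carrier R" "\<one> = y \<otimes> x" unfolding cgenideal_def by blast
    then have "y \<otimes> x = \<one>" "x \<otimes> y = \<one>" using x m_comm[of x y] by simp_all
    then have "x \<in> Units R" using x \<open>y \<in> carrier R\<close> unfolding Units_def by blast
    then show False using x by blast
  qed
  then have "PIdl x \<noteq> carrier R" by auto
  define Q where "Q I \<longleftrightarrow> ideal I R \<and> PIdl x \<subseteq> I \<and> I \<noteq> carrier R" for I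
  have "Q (PIdl x)" using \<open>PIdl x \<noteq> carrier R\<close> cgenideal_ideal[OF x(1)] by (simp add: Q_def)
  moreover have "ideal I R" if "Q I" for I using that by (simp add: Q_def)
  ultimately obtain I where QI: "Q I" and max: "\<And>J. Q J \<Longrightarrow> I \<subseteq> J \<Longrightarrow> J = I"
    using N.maximal_ideal_exists[of Q "PIdl x"] by blast
  then have I: "ideal I R" "PIdl x \<subseteq> I" "I \<noteq> carrier R" by (simp_all add: Q_def)
  have "maximalideal I R"
  proof (rule maximalidealI)
    show "ideal I R" "carrier R \<noteq> I" using I by auto
    fix J assume "ideal J R" "I \<subseteq> J" "J \<subseteq> carrier R"
    then show "J = I \<or> J = carrier R" using I max[of J] by (auto simp: Q_def)
  qed
  moreover have "\<exists>!I. maximalideal I R" using R unfolding noetherian_local_ring_def by blast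
  ultimately have "I = max_ideal R" using noetherian_local_maximalideal[OF R] by metis
  then show ?thesis using I(2) cgenideal_self[OF x(1)] by blast
qed

lemma max_ideal_nonunit:
  assumes R: "noetherian_local_ring R" and x: "x \<in> max_ideal R"
  shows "x \<in> carrier R" "x \<notin> Units R"
proof -
  interpret m: maximalideal "max_ideal R" R by (rule noetherian_local_maximalideal[OF R])
  show xR: "x \<in> carrier R" using x m.a_subset by blast
  show "x \<notin> Units R"
  proof
    assume "x \<in> Units R"
    then have "\<one> \<in> max_ideal R" using m.I_l_closed[OF x, of "inv x"] by (simp add: Units_l_inv)
    then show False using m.one_imp_carrier m.I_notcarr by blast
  qed
qed

lemma one_minus_unit:
  assumes R: "noetherian_local_ring R" and x: "x \<in> max_ideal R"
  shows "\<one> \<ominus> x \<in> Units R"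
proof (rule ccontr)
  interpret m: maximalideal "max_ideal R" R by (rule noetherian_local_maximalideal[OF R])
  have xR: "x \<in> carrier R" by (rule max_ideal_nonunit[OF R x])
  assume "\<one> \<ominus> x \<notin> Units R"
  then have "\<one> \<ominus> x \<in> max_ideal R" using xR by (intro nonunit_in_max_ideal[OF R]) auto
  then have "(\<one> \<ominus> x) \<oplus> x \<in> max_ideal R" using x by (rule m.a_closed)
  also have "(\<one> \<ominus> x) \<oplus> x = \<one>" using xR by (simp add: minus_eq a_assoc l_neg)
  finally show False using max_ideal_nonunit[OF R, of \<one>] by simp
qed

lemma prime_pow_notin:
  assumes "primeideal P R" "z \<in> carrier R" "z \<notin> P"
  shows "z [^] (n::nat) \<notin> P"
proof -
  interpret primeideal P R by fact
  show ?thesis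
  proof (induction n)
    case 0
    then show ?case using one_imp_carrier I_notcarr by auto
  next
    case (Suc n)
    then show ?case using I_prime[of "z [^] n" z] assms by auto
  qed
qed

text \<open>If \<open>z\<close> avoids all but one of the primes and \<open>w\<close> the last one, then each prime contains at most
  one of the elements \<open>w + z\<^sup>i\<close>, because \<open>1 - z\<^sup>j\<close> is a unit.\<close>

lemma prime_avoidance:
  assumes R: "noetherian_local_ring R" and P: "finite P"
    "\<And>p. p \<in> P \<Longrightarrow> primeideal p R \<and> p \<noteq> max_ideal R"
  shows "\<exists>z\<in>max_ideal R. \<forall>p\<in>P. z \<notin> p"
  using P
proof (induction P)
  case empty
  interpret m: maximalideal "max_ideal R" R by (rule noetherian_local_maximalideal[OF R])
  show ?case using m.zero_closed by blast
next
  case (insert p P)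
  interpret m: maximalideal "max_ideal R" R by (rule noetherian_local_maximalideal[OF R])
  have pr: "primeideal p R" "p \<noteq> max_ideal R" using insert.prems by auto
  interpret p: primeideal p R by fact
  obtain z where z: "z \<in> max_ideal R" "\<forall>p\<in>P. z \<notin> p" using insert by blast
  have zR: "z \<in> carrier R" by (rule max_ideal_nonunit[OF R z(1)])
  show ?case
  proof (cases "z \<in> p")
    case False
    then show ?thesis using z by blast
  next
    case zp: True
    have "p \<subseteq> carrier R" by (rule p.a_subset)
    have "x \<notin> Units R" if "x \<in> p" for x
    proof
      assume "x \<in> Units R"
      then have "\<one> \<in> p" using p.I_l_closed[OF that, of "inv x"] by (simp add: Units_l_inv)
      then show False using p.one_imp_carrier p.I_notcarr by blast
    qed
    then have "p \<subseteq> max_ideal R" using nonunit_in_max_ideal[OF R] \<open>p \<subseteq> carrier R\<close> by blast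
    then obtain w where w: "w \<in> max_ideal R" "w \<notin> p" using pr by blast
    have wR: "w \<in> carrier R" by (rule max_ideal_nonunit[OF R w(1)])
    \<comment> \<open>The exponents start at one, so every \<open>z [^] Suc i\<close> lies in the
      maximal ideal and in \<open>p\<close>. Each \<open>y i\<close> therefore stays in the maximal
      ideal and, like \<open>w\<close>, outside \<open>p\<close>.\<close>
    define y where "y i = w \<oplus> z [^] Suc i" for i :: nat
    have yR: "y i \<in> carrier R" for i unfolding y_def using wR zR by simp
    have zpow: "z [^] Suc i \<in> max_ideal R" "z [^] Suc i \<in> p" for i
      using m.I_l_closed[OF z(1), of "z [^] i"] p.I_l_closed[OF zp, of "z [^] i"] zR by auto
    have ym: "y i \<in> max_ideal R" for i
      unfolding y_def by (rule m.a_closed[OF w(1) zpow(1)])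
    have yp: "y i \<notin> p" for i
    proof
      assume "y i \<in> p"
      then have "y i \<oplus> (\<ominus> (z [^] Suc i)) \<in> p" using zpow by (intro p.a_closed) auto
      also have "y i \<oplus> (\<ominus> (z [^] Suc i)) = w" unfolding y_def using wR zR
        by (simp add: a_assoc r_neg)
      finally show False using w by blast
    qed
    have "\<exists>i. \<forall>q\<in>P. y i \<notin> q"
    proof (rule ccontr)
      assume "\<not> (\<exists>i. \<forall>q\<in>P. y i \<notin> q)"
      then obtain f where f: "\<And>i. f i \<in> P \<and> y i \<in> f i" by metis
      have "finite (range f)" by (rule finite_subset[OF _ insert.hyps(1)]) (use f in blast)
      then have "\<not> inj f" using finite_imageD[of f UNIV] by auto
      then obtain i j where ij: "f i = f j" "i < j" unfolding inj_def by (metis nat_neq_iff)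
      define q where "q = f i"
      have q: "q \<in> P" "y i \<in> q" "y j \<in> q" using f[of i] f[of j] ij by (auto simp: q_def)
      interpret q: primeideal q R using q insert.prems by blast
      have zq: "z \<notin> q" using q z by blast
      obtain k where k: "j = i + Suc k" using ij(2) less_imp_Suc_add by auto
      have "y i \<ominus> y j \<in> q" using q unfolding minus_eq by (intro q.a_closed) auto
      also have "y i \<ominus> y j = z [^] Suc i \<ominus> z [^] Suc j"
        unfolding y_def using wR zR by (simp add: minus_eq minus_add a_ac r_neg r_neg1 r_neg2)
      also have "z [^] Suc j = z [^] Suc i \<otimes> z [^] Suc k"
        using zR k by (subst nat_pow_mult) auto
      also have "z [^] Suc i \<ominus> z [^] Suc i \<otimes> z [^] Suc k = z [^] Suc i \<otimes> (\<one> \<ominus> z [^] Suc k)"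
        using zR by (simp add: minus_eq r_distr r_minus del: nat_pow_Suc)
      finally have "z [^] Suc i \<in> q \<or> \<one> \<ominus> z [^] Suc k \<in> q" using zR by (intro q.I_prime) auto
      then have "\<one> \<ominus> z [^] Suc k \<in> q"
        using prime_pow_notin[OF q.primeideal zR zq, of "Suc i"] by blast
      then have "\<one> \<in> q" using q.I_l_closed[of "\<one> \<ominus> z [^] Suc k" "inv (\<one> \<ominus> z [^] Suc k)"]
          one_minus_unit[OF R zpow(1)[of k]] by (metis Units_inv_closed Units_l_inv)
      then show False using q.one_imp_carrier q.I_notcarr by blast
    qed
    then show ?thesis using ym yp by blast
  qed
qed

end

section \<open>Finitely generated modules over a local ring\<close>

locale fg_local_module = module R M for R (structure) and M (structure) +
  assumes local_ring: "noetherian_local_ring R"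
    and fg: "fg_module R M"
begin

lemma noeth: "noetherian_ring R"
  using local_ring unfolding noetherian_local_ring_def by blast

lemma max_ideal_carrier [simp]: "x \<in> max_ideal R \<Longrightarrow> x \<in> carrier R"
  using R.max_ideal_nonunit[OF local_ring] by blast

lemma span_eq_self: "submodule K R M \<Longrightarrow> module_span R M K = K"
  by (rule span_eqI) auto

lemma span_insert_submodule:
  assumes "submodule K R M" "u \<in> carrier M"
  shows "module_span R M (insert u K) = {h \<oplus>\<^bsub>M\<^esub> r \<odot>\<^bsub>M\<^esub> u | h r. h \<in> K \<and> r \<in> carrier R}"
  using span_insert[OF submodule_subset[OF assms(1)] assms(2)] span_eq_self[OF assms(1)] by simp

text \<open>A submodule \<open>H\<close> that is maximal among the proper ones containing
  \<open>K\<close> absorbs all multiples by the maximal ideal: if some x u is missing from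
  \<open>H\<close>, then H + R x u is everything, so u = h + r x u, and the unit 1 - r x brings
  \<open>u\<close> into \<open>H\<close>.\<close>

lemma nakayama:
  assumes K: "submodule K R M" "K \<noteq> carrier M"
  shows "\<exists>H. submodule H R M \<and> K \<subseteq> H \<and> H \<noteq> carrier M \<and>
    (\<forall>x\<in>max_ideal R. \<forall>u\<in>carrier M. x \<odot>\<^bsub>M\<^esub> u \<in> H)"
proof -
  interpret m: maximalideal "max_ideal R" R by (rule noetherian_local_maximalideal[OF local_ring])
  define Q where "Q H \<longleftrightarrow> submodule H R M \<and> K \<subseteq> H \<and> H \<noteq> carrier M" for H
  have "Q K" using K by (simp add: Q_def)
  moreover have "submodule H R M" if "Q H" for H using that by (simp add: Q_def)
  ultimately obtain H where QH: "Q H" and max: "\<And>H'. Q H' \<Longrightarrow> H \<subseteq> H' \<Longrightarrow> H' = H"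
    using noetherian_maximal[OF noeth fg, of Q K] by blast
  from QH have H: "submodule H R M" "K \<subseteq> H" "H \<noteq> carrier M" by (simp_all add: Q_def)
  have "x \<odot>\<^bsub>M\<^esub> u \<in> H" if x: "x \<in> max_ideal R" and u: "u \<in> carrier M" for x u
  proof (rule ccontr)
    assume n: "x \<odot>\<^bsub>M\<^esub> u \<notin> H"
    have xR: "x \<in> carrier R" and xu: "x \<odot>\<^bsub>M\<^esub> u \<in> carrier M" using x u by auto
    let ?H = "module_span R M (insert (x \<odot>\<^bsub>M\<^esub> u) H)"
    have "submodule ?H R M" using xu submodule_subset[OF H(1)] by (intro span_submodule) auto
    moreover have "insert (x \<odot>\<^bsub>M\<^esub> u) H \<subseteq> ?H" by (rule span_superset)
    ultimately have "?H = carrier M" using max[of ?H] n H unfolding Q_def by blast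
    then obtain h r where h: "h \<in> H" "r \<in> carrier R" "u = h \<oplus>\<^bsub>M\<^esub> r \<odot>\<^bsub>M\<^esub> (x \<odot>\<^bsub>M\<^esub> u)"
      using u unfolding span_insert_submodule[OF H(1) xu] by blast
    have hM: "h \<in> carrier M" using h H submodule_mem by blast
    have unit: "\<one> \<ominus> r \<otimes> x \<in> Units R"
      using R.one_minus_unit[OF local_ring m.I_l_closed[OF x h(2)]] .
    have "(\<one> \<ominus> r \<otimes> x) \<odot>\<^bsub>M\<^esub> u = u \<ominus>\<^bsub>M\<^esub> r \<odot>\<^bsub>M\<^esub> (x \<odot>\<^bsub>M\<^esub> u)"
      using xR h(2) u by (simp add: R.minus_eq M.minus_eq smult_l_distr smult_l_minus smult_assoc1)
    also have "\<dots> = (h \<oplus>\<^bsub>M\<^esub> r \<odot>\<^bsub>M\<^esub> (x \<odot>\<^bsub>M\<^esub> u)) \<ominus>\<^bsub>M\<^esub> r \<odot>\<^bsub>M\<^esub> (x \<odot>\<^bsub>M\<^esub> u)"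
      using h(3) by simp
    also have "\<dots> = h" using hM xu h(2) by (simp add: M.minus_eq M.a_assoc M.r_neg)
    finally have "(\<one> \<ominus> r \<otimes> x) \<odot>\<^bsub>M\<^esub> u \<in> H" using h by simp
    then have "inv (\<one> \<ominus> r \<otimes> x) \<odot>\<^bsub>M\<^esub> ((\<one> \<ominus> r \<otimes> x) \<odot>\<^bsub>M\<^esub> u) \<in> H"
      by - (rule submodule_smult[OF H(1)]; use unit in auto)
    also have "inv (\<one> \<ominus> r \<otimes> x) \<odot>\<^bsub>M\<^esub> ((\<one> \<ominus> r \<otimes> x) \<odot>\<^bsub>M\<^esub> u) = u"
      using unit u xR h(2) by (subst smult_assoc1[symmetric]) (auto simp: R.Units_l_inv)
    finally have "u \<in> H" .
    then show False using n xR submodule_smult[OF H(1)] by blast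
  qed
  then show ?thesis using H by (intro exI[of _ H]) simp
qed

lemma adjoin_proper:
  assumes "submodule K R M" "K \<noteq> carrier M" "x \<in> max_ideal R"
  shows "adjoin K x \<noteq> carrier M"
proof -
  obtain H where H: "submodule H R M" "K \<subseteq> H" "H \<noteq> carrier M"
    "\<forall>x\<in>max_ideal R. \<forall>u\<in>carrier M. x \<odot>\<^bsub>M\<^esub> u \<in> H"
    using nakayama[OF assms(1,2)] by blast
  have "adjoin K x \<subseteq> H" by (rule adjoin_minimal[OF H(1,2)]) (use H(4) assms(3) in blast)
  then show ?thesis using submodule_subset[OF H(1)] H(3) by blast
qed

text \<open>This is a nonzero socle of M/K, the criterion by which depth zero is detected.\<close>

definition has_socle :: "'c set \<Rightarrow> bool"
  where "has_socle K \<longleftrightarrow> (\<exists>u\<in>carrier M - K. \<forall>x\<in>max_ideal R. x \<odot>\<^bsub>M\<^esub> u \<in> K)"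

lemma regular_imp_no_socle: "regular_mod K x \<Longrightarrow> x \<in> max_ideal R \<Longrightarrow> \<not> has_socle K"
  unfolding regular_mod_def has_socle_def by blast

lemma colon_ideal:
  assumes K: "submodule K R M" and u: "u \<in> carrier M"
  shows "ideal {r \<in> carrier R. r \<odot>\<^bsub>M\<^esub> u \<in> K} R"
  using u submodule_zero[OF K]
  by (intro R.cring_idealI)
    (auto simp: smult_l_distr smult_assoc1 intro: submodule_add[OF K] submodule_smult[OF K])

text \<open>The classical source of associated primes: an annihilator of an element of M/K that is
  maximal among such annihilators is prime. The competition is restricted to nonzero elements killed
  by \<open>z\<close>, so that the prime found contains \<open>z\<close>.\<close>

lemma maximal_colon_prime:
  assumes K: "submodule K R M" and z: "z \<in> carrier R"
    and v: "v \<in> carrier M" "v \<notin> K" "z \<odot>\<^bsub>M\<^esub> v \<in> K"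
  shows "\<exists>u\<in>carrier M. u \<notin> K \<and> z \<odot>\<^bsub>M\<^esub> u \<in> K \<and> primeideal {r \<in> carrier R. r \<odot>\<^bsub>M\<^esub> u \<in> K} R"
proof -
  interpret N: noetherian_ring R by (rule noeth)
  define A where "A u = {r \<in> carrier R. r \<odot>\<^bsub>M\<^esub> u \<in> K}" for u
  define U where "U u \<longleftrightarrow> u \<in> carrier M \<and> u \<notin> K \<and> z \<odot>\<^bsub>M\<^esub> u \<in> K" for u
  define Q where "Q I \<longleftrightarrow> (\<exists>u. U u \<and> I = A u)" for I
  have "Q (A v)" using v unfolding Q_def U_def by blast
  moreover have "ideal I R" if "Q I" for I
    using that colon_ideal[OF K] unfolding Q_def U_def A_def by blast
  ultimately obtain I where I: "Q I" "\<And>J. Q J \<Longrightarrow> I \<subseteq> J \<Longrightarrow> J = I"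
    using N.maximal_ideal_exists[of Q "A v"] by blast
  then obtain u where u: "U u" "I = A u" unfolding Q_def by blast
  have max: "A w = A u" if "U w" "A u \<subseteq> A w" for w
    using I(2)[of "A w"] that u unfolding Q_def by blast
  have "primeideal (A u) R"
  proof (rule primeidealI)
    show "ideal (A u) R" using u unfolding A_def U_def by (intro colon_ideal[OF K]) auto
    show "cring R" by (rule R.cring_axioms)
    have "\<one> \<notin> A u" using u unfolding A_def U_def by auto
    then show "carrier R \<noteq> A u" by auto
    fix a b assume a: "a \<in> carrier R" and b: "b \<in> carrier R" and ab: "a \<otimes> b \<in> A u"
    show "a \<in> A u \<or> b \<in> A u"
    proof (rule disjCI)
      assume "b \<notin> A u"
      \<comment> \<open>For \<open>b\<close> outside \<open>A u\<close> the multiple b u is again a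
        competitor, and its annihilator contains \<open>A u\<close>. Maximality makes the two equal,
        and \<open>a\<close> annihilates b u.\<close>
      then have "U (b \<odot>\<^bsub>M\<^esub> u)"
        using u b z submodule_smult[OF K] by (auto simp: U_def A_def smult_commute[of z b])
      moreover have "A u \<subseteq> A (b \<odot>\<^bsub>M\<^esub> u)"
        using u b submodule_smult[OF K] by (auto simp: U_def A_def smult_commute[of _ b])
      ultimately have "A (b \<odot>\<^bsub>M\<^esub> u) = A u" by (rule max)
      moreover have "a \<in> A (b \<odot>\<^bsub>M\<^esub> u)"
        using ab a b u by (auto simp: U_def A_def smult_assoc1)
      ultimately show "a \<in> A u" by blast
    qed
  qed
  then show ?thesis using u unfolding A_def U_def by blast
qed

text \<open>Take a maximal submodule \<open>H\<close> over \<open>K\<close> for which finitely many primes control the zero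
  divisors on \<open>H/K\<close>. A further zero divisor on \<open>M/K\<close> would yield a larger such submodule.\<close>

lemma no_socle_primes:
  assumes K: "submodule K R M" and soc: "\<not> has_socle K"
  shows "\<exists>P. finite P \<and> (\<forall>p\<in>P. primeideal p R \<and> p \<noteq> max_ideal R) \<and>
    (\<forall>z\<in>carrier R. (\<forall>p\<in>P. z \<notin> p) \<longrightarrow> regular_mod K z)"
proof -
  define good where "good P H \<longleftrightarrow> finite P \<and> (\<forall>p\<in>P. primeideal p R \<and> p \<noteq> max_ideal R) \<and>
    (\<forall>z\<in>carrier R. (\<forall>p\<in>P. z \<notin> p) \<longrightarrow> (\<forall>h\<in>H. z \<odot>\<^bsub>M\<^esub> h \<in> K \<longrightarrow> h \<in> K))" for P H
  define Q where "Q H \<longleftrightarrow> submodule H R M \<and> K \<subseteq> H \<and> (\<exists>P. good P H)" for H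
  have "good {} K" unfolding good_def by simp
  then have "Q K" using K unfolding Q_def by blast
  moreover have "submodule H R M" if "Q H" for H using that by (simp add: Q_def)
  ultimately obtain H where "Q H" and max: "\<And>H'. Q H' \<Longrightarrow> H \<subseteq> H' \<Longrightarrow> H' = H"
    using noetherian_maximal[OF noeth fg, of Q K] by blast
  then obtain P where H: "submodule H R M" "K \<subseteq> H" and P: "good P H" unfolding Q_def by blast
  have "v \<in> K" if z: "z \<in> carrier R" "\<forall>p\<in>P. z \<notin> p" and v: "v \<in> carrier M" "z \<odot>\<^bsub>M\<^esub> v \<in> K" for z v
  proof (rule ccontr)
    assume "v \<notin> K"
    define A where "A u = {r \<in> carrier R. r \<odot>\<^bsub>M\<^esub> u \<in> K}" for u
    obtain u where u: "u \<in> carrier M" "u \<notin> K" "z \<odot>\<^bsub>M\<^esub> u \<in> K" and p: "primeideal (A u) R"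
      using maximal_colon_prime[OF K z(1) v(1) \<open>v \<notin> K\<close> v(2)] unfolding A_def by blast
    interpret p: primeideal "A u" R by (rule p)
    have "A u \<noteq> max_ideal R" using soc u unfolding A_def has_socle_def by blast
    \<comment> \<open>As \<open>z\<close> avoids the primes in \<open>P\<close> and kills
      \<open>u\<close> modulo \<open>K\<close>, an element \<open>u\<close> of \<open>H\<close>
      would already lie in \<open>K\<close>.\<close>
    have "u \<notin> H" using P z u unfolding good_def by blast
    let ?H = "module_span R M (insert u H)"
    have sub: "submodule ?H R M" using u submodule_subset[OF H(1)] by (intro span_submodule) auto
    have sup: "insert u H \<subseteq> ?H" by (rule span_superset)
    have "good (insert (A u) P) ?H"
      unfolding good_def
    proof (intro conjI ballI impI)
      show "finite (insert (A u) P)" using P unfolding good_def by simp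
      show "primeideal q R" "q \<noteq> max_ideal R" if "q \<in> insert (A u) P" for q
        using that P p \<open>A u \<noteq> max_ideal R\<close> unfolding good_def by auto
      fix y w assume y: "y \<in> carrier R" "\<forall>q\<in>insert (A u) P. y \<notin> q"
        and w: "w \<in> ?H" "y \<odot>\<^bsub>M\<^esub> w \<in> K"
      obtain h r where h: "h \<in> H" "r \<in> carrier R" and weq: "w = h \<oplus>\<^bsub>M\<^esub> r \<odot>\<^bsub>M\<^esub> u"
        using w(1) unfolding span_insert_submodule[OF H(1) u(1)] by blast
      have hM: "h \<in> carrier M" using h H submodule_mem by blast
      have yw: "y \<odot>\<^bsub>M\<^esub> w = y \<odot>\<^bsub>M\<^esub> h \<oplus>\<^bsub>M\<^esub> (y \<otimes> r) \<odot>\<^bsub>M\<^esub> u"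
        using y h hM u unfolding weq by (simp add: smult_r_distr smult_assoc1)
      \<comment> \<open>Multiplication by \<open>z\<close> removes the part in \<open>u\<close>
        modulo \<open>K\<close>. What remains, z (y h), lies in \<open>K\<close> with y h in
        \<open>H\<close>. As \<open>z\<close> and \<open>y\<close> both avoid \<open>P\<close>, it
        follows that y h and then h lie in \<open>K\<close>. The multiple of \<open>u\<close> that
        is left is settled by primeness of \<open>A u\<close>.\<close>
      have "z \<odot>\<^bsub>M\<^esub> (y \<odot>\<^bsub>M\<^esub> w) \<in> K" by (rule submodule_smult[OF K z(1) w(2)])
      also have "z \<odot>\<^bsub>M\<^esub> (y \<odot>\<^bsub>M\<^esub> w) = z \<odot>\<^bsub>M\<^esub> ((y \<otimes> r) \<odot>\<^bsub>M\<^esub> u) \<oplus>\<^bsub>M\<^esub> z \<odot>\<^bsub>M\<^esub> (y \<odot>\<^bsub>M\<^esub> h)"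
        using h z y hM u unfolding yw by (simp add: smult_r_distr M.a_comm)
      also have "z \<odot>\<^bsub>M\<^esub> ((y \<otimes> r) \<odot>\<^bsub>M\<^esub> u) = (y \<otimes> r) \<odot>\<^bsub>M\<^esub> (z \<odot>\<^bsub>M\<^esub> u)"
        using h z y u by (intro smult_commute) auto
      finally have "z \<odot>\<^bsub>M\<^esub> (y \<odot>\<^bsub>M\<^esub> h) \<in> K"
        by - (rule submodule_cancel[OF K submodule_smult[OF K, of "y \<otimes> r" "z \<odot>\<^bsub>M\<^esub> u"]];
          use y h u z hM in auto)
      moreover have "y \<odot>\<^bsub>M\<^esub> h \<in> H" by (rule submodule_smult[OF H(1)]) (use y h in auto)
      ultimately have "y \<odot>\<^bsub>M\<^esub> h \<in> K" using P z unfolding good_def by blast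
      then have hK: "h \<in> K" using P y h unfolding good_def by blast
      have "(y \<otimes> r) \<odot>\<^bsub>M\<^esub> u \<in> K"
        by (rule submodule_cancel[OF K submodule_smult[OF K _ hK, of y]])
          (use w(2)[unfolded yw] y h u in auto)
      then have "y \<otimes> r \<in> A u" using y h unfolding A_def by simp
      then have "r \<in> A u" using p.I_prime[OF y(1) h(2)] y by blast
      then show "w \<in> K" unfolding weq A_def using hK by (auto intro: submodule_add[OF K])
    qed
    then have "?H = H" using max[of ?H] sub sup H unfolding Q_def by blast
    then show False using sup \<open>u \<notin> H\<close> by blast
  qed
  then have "\<forall>z\<in>carrier R. (\<forall>p\<in>P. z \<notin> p) \<longrightarrow> regular_mod K z"
    unfolding regular_mod_def by simp
  then show ?thesis using P unfolding good_def by (intro exI[of _ P]) simp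
qed

text \<open>Each quotient without a socle contributes finitely many primes different from the
  maximal ideal, and one application of prime avoidance to their union serves all quotients at once.
  The exchange of regular sequences depends on such a common element.\<close>

lemma exists_common_regular:
  assumes "finite F" "\<And>K. K \<in> F \<Longrightarrow> submodule K R M \<and> \<not> has_socle K"
  shows "\<exists>z\<in>max_ideal R. \<forall>K\<in>F. regular_mod K z"
proof -
  have "\<forall>K\<in>F. \<exists>P. finite P \<and> (\<forall>p\<in>P. primeideal p R \<and> p \<noteq> max_ideal R) \<and>
    (\<forall>z\<in>carrier R. (\<forall>p\<in>P. z \<notin> p) \<longrightarrow> regular_mod K z)"
    using no_socle_primes assms by blast
  then obtain P where P: "\<And>K. K \<in> F \<Longrightarrow> finite (P K)"
    "\<And>K p. K \<in> F \<Longrightarrow> p \<in> P K \<Longrightarrow> primeideal p R \<and> p \<noteq> max_ideal R"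
    "\<And>K z. K \<in> F \<Longrightarrow> z \<in> carrier R \<Longrightarrow> (\<forall>p\<in>P K. z \<notin> p) \<Longrightarrow> regular_mod K z"
    by metis
  have "\<exists>z\<in>max_ideal R. \<forall>p\<in>\<Union>(P ` F). z \<notin> p"
    using P(1,2) assms(1) by (intro R.prime_avoidance[OF local_ring]) auto
  then obtain z where z: "z \<in> max_ideal R" "\<forall>p\<in>\<Union>(P ` F). z \<notin> p" by blast
  have "regular_mod K z" if "K \<in> F" for K
    using z that by (intro P(3)) auto
  then show ?thesis using z(1) by blast
qed

section \<open>Exchange of regular elements\<close>

lemma adjoinE:
  assumes "v \<in> adjoin K x"
  obtains k w where "k \<in> K" "w \<in> carrier M" "v = k \<oplus>\<^bsub>M\<^esub> x \<odot>\<^bsub>M\<^esub> w"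
  using assms unfolding adjoin_def by blast

lemma regular_mod_diff:
  assumes K: "submodule K R M" and x: "x \<in> carrier R" "regular_mod K x"
    and uv: "u \<in> carrier M" "v \<in> carrier M" and k: "k \<in> K"
    and eq: "x \<odot>\<^bsub>M\<^esub> u = k \<oplus>\<^bsub>M\<^esub> x \<odot>\<^bsub>M\<^esub> v"
  shows "u \<ominus>\<^bsub>M\<^esub> v \<in> K"
proof -
  have kM: "k \<in> carrier M" using submodule_mem[OF K k] .
  have "x \<odot>\<^bsub>M\<^esub> (u \<ominus>\<^bsub>M\<^esub> v) = (k \<oplus>\<^bsub>M\<^esub> x \<odot>\<^bsub>M\<^esub> v) \<ominus>\<^bsub>M\<^esub> x \<odot>\<^bsub>M\<^esub> v"
    using x uv by (simp add: M.minus_eq smult_r_distr smult_r_minus eq)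
  also have "\<dots> = k" using kM x uv by (simp add: M.minus_eq M.a_assoc M.r_neg)
  finally have "x \<odot>\<^bsub>M\<^esub> (u \<ominus>\<^bsub>M\<^esub> v) \<in> K" using k by simp
  then show ?thesis using regular_modD[OF x(2)] uv by simp
qed

lemma diff_in_imp_adjoin:
  assumes "u \<in> carrier M" "v \<in> carrier M" "x \<in> carrier R" "u \<ominus>\<^bsub>M\<^esub> x \<odot>\<^bsub>M\<^esub> v \<in> K"
  shows "u \<in> adjoin K x"
proof -
  have "u = (u \<ominus>\<^bsub>M\<^esub> x \<odot>\<^bsub>M\<^esub> v) \<oplus>\<^bsub>M\<^esub> x \<odot>\<^bsub>M\<^esub> v"
    using assms by (simp add: M.minus_eq M.a_assoc M.l_neg)
  then show ?thesis unfolding adjoin_def using assms by blast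
qed

text \<open>This is the half of the interchange of \<open>x\<close> and \<open>z\<close> that is
  plain cancellation modulo \<open>K\<close>. The other half, regularity of \<open>z\<close> modulo
  \<open>K\<close>, is arranged in the exchange argument by the choice of \<open>z\<close>.\<close>

lemma regular_swap:
  assumes K: "submodule K R M" and x: "x \<in> carrier R" and z: "z \<in> carrier R"
    and reg: "regular_mod K x" "regular_mod (adjoin K x) z"
  shows "regular_mod (adjoin K z) x"
  unfolding regular_mod_def
proof (intro ballI impI)
  fix u assume u: "u \<in> carrier M" "x \<odot>\<^bsub>M\<^esub> u \<in> adjoin K z"
  then obtain k v where k: "k \<in> K" "v \<in> carrier M" "x \<odot>\<^bsub>M\<^esub> u = k \<oplus>\<^bsub>M\<^esub> z \<odot>\<^bsub>M\<^esub> v"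
    by (rule_tac adjoinE)
  have "k \<oplus>\<^bsub>M\<^esub> z \<odot>\<^bsub>M\<^esub> v \<in> adjoin K x"
    using smult_in_adjoin[OF K x u(1)] k by simp
  then have "z \<odot>\<^bsub>M\<^esub> v \<in> adjoin K x"
    by - (rule submodule_cancel[OF adjoin_submodule[OF K x]
      subsetD[OF adjoin_superset[OF K x] k(1)]]; use k z in auto)
  then have "v \<in> adjoin K x" using regular_modD[OF reg(2)] k by blast
  then obtain k' w where k': "k' \<in> K" "w \<in> carrier M" "v = k' \<oplus>\<^bsub>M\<^esub> x \<odot>\<^bsub>M\<^esub> w"
    by (rule adjoinE)
  note mem = submodule_mem[OF K k(1)] submodule_mem[OF K k'(1)]
  have "x \<odot>\<^bsub>M\<^esub> u = (k \<oplus>\<^bsub>M\<^esub> z \<odot>\<^bsub>M\<^esub> k') \<oplus>\<^bsub>M\<^esub> x \<odot>\<^bsub>M\<^esub> (z \<odot>\<^bsub>M\<^esub> w)"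
    unfolding k(3) k'(3) using mem x z k'(2)
    by (simp add: smult_r_distr M.a_assoc smult_commute[of z x])
  then have "u \<ominus>\<^bsub>M\<^esub> z \<odot>\<^bsub>M\<^esub> w \<in> K"
    by - (rule regular_mod_diff[OF K, of x];
      use u k k' z x reg in
      \<open>auto intro!: submodule_add[OF K] submodule_smult[OF K]\<close>)
  then show "u \<in> adjoin K z" by - (rule diff_in_imp_adjoin; use u k' z in auto)
qed

text \<open>Both socles are copies of Ext^1(k, M/K), where k is the residue field. In terms of
  elements: if \<open>u\<close> represents a socle element modulo \<open>x\<close>, then y u = x w
  modulo \<open>K\<close> for some \<open>w\<close>, and \<open>w\<close> represents the
  corresponding element modulo \<open>y\<close>.\<close>

lemma socle_exchange:
  assumes K: "submodule K R M" and x: "x \<in> max_ideal R" "regular_mod K x"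
    and y: "y \<in> max_ideal R" "regular_mod K y" and soc: "has_socle (adjoin K x)"
  shows "has_socle (adjoin K y)"
proof -
  have xR: "x \<in> carrier R" and yR: "y \<in> carrier R" using x y by auto
  obtain u where u: "u \<in> carrier M" "u \<notin> adjoin K x"
    and su: "\<And>r. r \<in> max_ideal R \<Longrightarrow> r \<odot>\<^bsub>M\<^esub> u \<in> adjoin K x"
    using soc unfolding has_socle_def by blast
  obtain k w where k: "k \<in> K" "w \<in> carrier M" "y \<odot>\<^bsub>M\<^esub> u = k \<oplus>\<^bsub>M\<^esub> x \<odot>\<^bsub>M\<^esub> w"
    using su[OF y(1)] by (rule adjoinE)
  note kM = submodule_mem[OF K k(1)]
  have "w \<notin> adjoin K y"
  proof
    assume "w \<in> adjoin K y"
    then obtain k' w' where k': "k' \<in> K" "w' \<in> carrier M" "w = k' \<oplus>\<^bsub>M\<^esub> y \<odot>\<^bsub>M\<^esub> w'"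
      by (rule adjoinE)
    have "y \<odot>\<^bsub>M\<^esub> u = (k \<oplus>\<^bsub>M\<^esub> x \<odot>\<^bsub>M\<^esub> k') \<oplus>\<^bsub>M\<^esub> y \<odot>\<^bsub>M\<^esub> (x \<odot>\<^bsub>M\<^esub> w')"
      unfolding k(3) k'(3) using kM submodule_mem[OF K k'(1)] xR yR k'(2)
      by (simp add: smult_r_distr M.a_assoc smult_commute[of x y])
    then have "u \<ominus>\<^bsub>M\<^esub> x \<odot>\<^bsub>M\<^esub> w' \<in> K"
      by - (rule regular_mod_diff[OF K, of y];
        use u k k' xR yR y in
        \<open>auto intro!: submodule_add[OF K] submodule_smult[OF K]\<close>)
    then show False using u diff_in_imp_adjoin[OF u(1) k'(2) xR] by blast
  qed
  moreover have "r \<odot>\<^bsub>M\<^esub> w \<in> adjoin K y" if r: "r \<in> max_ideal R" for r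
  proof -
    have rR: "r \<in> carrier R" using r by simp
    obtain k' v where k': "k' \<in> K" "v \<in> carrier M" "r \<odot>\<^bsub>M\<^esub> u = k' \<oplus>\<^bsub>M\<^esub> x \<odot>\<^bsub>M\<^esub> v"
      using su[OF r] by (rule adjoinE)
    note k'M = submodule_mem[OF K k'(1)]
    have "r \<odot>\<^bsub>M\<^esub> (y \<odot>\<^bsub>M\<^esub> u) = y \<odot>\<^bsub>M\<^esub> (r \<odot>\<^bsub>M\<^esub> u)" using rR yR u by (intro smult_commute)
    then have "r \<odot>\<^bsub>M\<^esub> k \<oplus>\<^bsub>M\<^esub> x \<odot>\<^bsub>M\<^esub> (r \<odot>\<^bsub>M\<^esub> w) = y \<odot>\<^bsub>M\<^esub> k' \<oplus>\<^bsub>M\<^esub> x \<odot>\<^bsub>M\<^esub> (y \<odot>\<^bsub>M\<^esub> v)"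
      unfolding k(3) k'(3) using kM k'M k k' rR xR yR
      by (simp add: smult_r_distr smult_commute[of r x] smult_commute[of y x])
    then have "x \<odot>\<^bsub>M\<^esub> (r \<odot>\<^bsub>M\<^esub> w)
      = \<ominus>\<^bsub>M\<^esub> (r \<odot>\<^bsub>M\<^esub> k) \<oplus>\<^bsub>M\<^esub> (y \<odot>\<^bsub>M\<^esub> k' \<oplus>\<^bsub>M\<^esub> x \<odot>\<^bsub>M\<^esub> (y \<odot>\<^bsub>M\<^esub> v))"
      using kM k rR xR by (metis M.r_neg1 smult_closed)
    also have "\<dots> = (\<ominus>\<^bsub>M\<^esub> (r \<odot>\<^bsub>M\<^esub> k) \<oplus>\<^bsub>M\<^esub> y \<odot>\<^bsub>M\<^esub> k') \<oplus>\<^bsub>M\<^esub> x \<odot>\<^bsub>M\<^esub> (y \<odot>\<^bsub>M\<^esub> v)"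
      using kM k'M k' rR xR yR by (simp add: M.a_assoc)
    finally have "r \<odot>\<^bsub>M\<^esub> w \<ominus>\<^bsub>M\<^esub> y \<odot>\<^bsub>M\<^esub> v \<in> K"
      by - (rule regular_mod_diff[OF K, of x _ _ "\<ominus>\<^bsub>M\<^esub> (r \<odot>\<^bsub>M\<^esub> k) \<oplus>\<^bsub>M\<^esub> y \<odot>\<^bsub>M\<^esub> k'"];
        use k k' xR yR rR x in
        \<open>auto intro!: submodule_add[OF K] submodule_smult[OF K] submodule_neg[OF K]\<close>)
    then show ?thesis by - (rule diff_in_imp_adjoin; use k k' rR yR in auto)
  qed
  ultimately show ?thesis using k unfolding has_socle_def by blast
qed

text \<open>Maximality is expressed by a socle in the last quotient, which excludes a further
  regular element there.\<close>

definition maximal_regular :: "'c set \<Rightarrow> nat \<Rightarrow> bool"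
  where "maximal_regular K n \<longleftrightarrow> (\<exists>xs. length xs = n \<and> set xs \<subseteq> max_ideal R \<and>
    regular_seq K xs \<and> has_socle (adjoins K xs))"

lemma maximal_regular_0: "maximal_regular K 0 \<longleftrightarrow> has_socle K"
  unfolding maximal_regular_def by auto

lemma maximal_regular_Suc: "maximal_regular K (Suc n) \<longleftrightarrow>
   (\<exists>x\<in>max_ideal R. regular_mod K x \<and> maximal_regular (adjoin K x) n)"
proof
  assume "maximal_regular K (Suc n)"
  then show "\<exists>x\<in>max_ideal R. regular_mod K x \<and> maximal_regular (adjoin K x) n"
    unfolding maximal_regular_def by (fastforce simp: length_Suc_conv)
next
  assume "\<exists>x\<in>max_ideal R. regular_mod K x \<and> maximal_regular (adjoin K x) n"
  then obtain x xs where "x \<in> max_ideal R" "regular_mod K x" "length xs = n"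
    "set xs \<subseteq> max_ideal R" "regular_seq (adjoin K x) xs" "has_socle (adjoins (adjoin K x) xs)"
    unfolding maximal_regular_def by blast
  then show "maximal_regular K (Suc n)"
    unfolding maximal_regular_def by (intro exI[of _ "x # xs"]) auto
qed

text \<open>Exchange by way of an element that is regular modulo \<open>K\<close>, \<open>K + xM\<close> and \<open>K + yM\<close>.\<close>

lemma maximal_regular_adjoin:
  assumes "maximal_regular K n" "submodule K R M" "y \<in> max_ideal R" "regular_mod K y"
  shows "\<exists>k. n = Suc k \<and> maximal_regular (adjoin K y) k"
  using assms
proof (induction n arbitrary: K y)
  case 0
  then show ?case using regular_imp_no_socle maximal_regular_0 by blast
next
  case (Suc n)
  note K = \<open>submodule K R M\<close> and y = \<open>y \<in> max_ideal R\<close> \<open>regular_mod K y\<close>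
  obtain x where x: "x \<in> max_ideal R" "regular_mod K x" "maximal_regular (adjoin K x) n"
    using Suc.prems unfolding maximal_regular_Suc by blast
  have xR: "x \<in> carrier R" and yR: "y \<in> carrier R" using x y by auto
  show ?case
  proof (cases n)
    case 0
    then have "has_socle (adjoin K y)"
      using socle_exchange[OF K x(1,2) y] x(3) by (simp add: maximal_regular_0)
    then show ?thesis using 0 maximal_regular_0 by blast
  next
    case (Suc k)
    \<comment> \<open>Since \<open>n\<close> is positive here, some element is regular modulo K +
      xM, which excludes a socle. By exchange there is none modulo K + yM either.\<close>
    have "\<not> has_socle (adjoin K x)"
      using x(3) regular_imp_no_socle unfolding Suc maximal_regular_Suc by blast
    moreover then have "\<not> has_socle (adjoin K y)"
      using socle_exchange[OF K y x(1,2)] by blast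
    moreover have "\<not> has_socle K" using regular_imp_no_socle x by blast
    ultimately have "\<exists>z\<in>max_ideal R. \<forall>H\<in>{K, adjoin K x, adjoin K y}. regular_mod H z"
      using K xR yR by (intro exists_common_regular) (auto intro: adjoin_submodule)
    then obtain z where z: "z \<in> max_ideal R" "regular_mod K z"
      "regular_mod (adjoin K x) z" "regular_mod (adjoin K y) z" by blast
    have zR: "z \<in> carrier R" using z by auto
    \<comment> \<open>The pair of leading members changes from x, z to z, x, next to z, y and
      finally to y, z. The induction hypothesis is applied modulo K + xM and modulo K + zM, and
      \<open>regular_swap\<close> makes \<open>x\<close> and \<open>y\<close> regular modulo K +
      zM.\<close>
    have "maximal_regular (adjoin (adjoin K x) z) k"
      using Suc.IH[OF x(3) adjoin_submodule[OF K xR] z(1,3)] Suc by auto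
    then have "maximal_regular (adjoin K z) n"
      unfolding Suc maximal_regular_Suc
      using regular_swap[OF K xR zR x(2) z(3)] x(1) adjoin_commute[OF K xR zR] by auto
    from Suc.IH[OF this adjoin_submodule[OF K zR] y(1) regular_swap[OF K yR zR y(2) z(4)]]
    have "maximal_regular (adjoin (adjoin K y) z) k"
      using Suc adjoin_commute[OF K yR zR] by auto
    then have "maximal_regular (adjoin K y) n"
      unfolding Suc maximal_regular_Suc using z by blast
    then show ?thesis by blast
  qed
qed

text \<open>Each member of \<open>ys\<close> lowers the length \<open>n\<close> of the maximal
  sequence by exactly one. This is the one-sided form of Rees's theorem that the comparison of
  depths calls for.\<close>

lemma regular_seq_length_le:
  assumes "maximal_regular K n" "submodule K R M" "set ys \<subseteq> max_ideal R" "regular_seq K ys"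
  shows "length ys \<le> n"
  using assms
proof (induction ys arbitrary: K n)
  case (Cons y ys)
  then have y: "y \<in> max_ideal R" "regular_mod K y" by auto
  obtain k where k: "n = Suc k" "maximal_regular (adjoin K y) k"
    using maximal_regular_adjoin[OF Cons.prems(1,2) y] by blast
  have "length ys \<le> k"
    by (rule Cons.IH[OF k(2) adjoin_submodule[OF Cons.prems(2)]]) (use Cons.prems y in auto)
  then show ?case using k by simp
qed simp

end

section \<open>Quotients and linear maps\<close>

context module
begin

lemma minus_zero_module [simp]: "\<ominus>\<^bsub>M\<^esub> \<zero>\<^bsub>M\<^esub> = \<zero>\<^bsub>M\<^esub>"
  by (rule M.minus_equality) auto

lemma coset_mem_iff:
  assumes K: "submodule K R M" and x: "x \<in> carrier M"
  shows "y \<in> K +>\<^bsub>M\<^esub> x \<longleftrightarrow> y \<in> carrier M \<and> y \<ominus>\<^bsub>M\<^esub> x \<in> K"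
proof
  assume "y \<in> K +>\<^bsub>M\<^esub> x"
  then obtain k where k: "k \<in> K" "y = k \<oplus>\<^bsub>M\<^esub> x" unfolding a_r_coset_def' by blast
  then have "y \<ominus>\<^bsub>M\<^esub> x = k" using x submodule_mem[OF K k(1)] by (simp add: M.minus_eq M.a_assoc M.r_neg)
  then show "y \<in> carrier M \<and> y \<ominus>\<^bsub>M\<^esub> x \<in> K" using k x submodule_mem[OF K k(1)] by simp
next
  assume y: "y \<in> carrier M \<and> y \<ominus>\<^bsub>M\<^esub> x \<in> K"
  then have "y = (y \<ominus>\<^bsub>M\<^esub> x) \<oplus>\<^bsub>M\<^esub> x" using x by (simp add: M.minus_eq M.a_assoc M.l_neg)
  then show "y \<in> K +>\<^bsub>M\<^esub> x" using y unfolding a_r_coset_def' by blast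
qed

lemma coset_self: "submodule K R M \<Longrightarrow> x \<in> carrier M \<Longrightarrow> x \<in> K +>\<^bsub>M\<^esub> x"
  by (simp add: coset_mem_iff M.minus_eq M.r_neg submodule_zero)

lemma coset_eq_iff:
  assumes K: "submodule K R M" and x: "x \<in> carrier M" and y: "y \<in> carrier M"
  shows "K +>\<^bsub>M\<^esub> x = K +>\<^bsub>M\<^esub> y \<longleftrightarrow> x \<ominus>\<^bsub>M\<^esub> y \<in> K"
proof
  assume "K +>\<^bsub>M\<^esub> x = K +>\<^bsub>M\<^esub> y"
  then have "x \<in> K +>\<^bsub>M\<^esub> y" using coset_self[OF K x] by simp
  then show "x \<ominus>\<^bsub>M\<^esub> y \<in> K" using coset_mem_iff[OF K y] by simp
next
  assume *: "x \<ominus>\<^bsub>M\<^esub> y \<in> K"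
  have "z \<ominus>\<^bsub>M\<^esub> x \<in> K \<longleftrightarrow> z \<ominus>\<^bsub>M\<^esub> y \<in> K" if z: "z \<in> carrier M" for z
  proof -
    have eq: "z \<ominus>\<^bsub>M\<^esub> y = (x \<ominus>\<^bsub>M\<^esub> y) \<oplus>\<^bsub>M\<^esub> (z \<ominus>\<^bsub>M\<^esub> x)"
      using x y z by (simp add: M.minus_eq M.a_ac M.r_neg1 M.r_neg2 M.r_neg)
    show ?thesis
      using submodule_add[OF K *] submodule_cancel[OF K *, of "z \<ominus>\<^bsub>M\<^esub> x"] x z
      unfolding eq by blast
  qed
  then show "K +>\<^bsub>M\<^esub> x = K +>\<^bsub>M\<^esub> y"
    using coset_mem_iff[OF K x] coset_mem_iff[OF K y] by blast
qed

lemma coset_zero: "submodule K R M \<Longrightarrow> K +>\<^bsub>M\<^esub> \<zero>\<^bsub>M\<^esub> = K"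
  by (rule M.a_coset_add_zero[OF submodule_subset])

lemma coset_eq_self_iff:
  assumes K: "submodule K R M" and x: "x \<in> carrier M"
  shows "K +>\<^bsub>M\<^esub> x = K \<longleftrightarrow> x \<in> K"
  using coset_eq_iff[OF K x, of "\<zero>\<^bsub>M\<^esub>"] x by (simp add: coset_zero[OF K] M.minus_eq minus_zero_module)

lemma quot_carrier: "carrier (quot_module M K) = (\<lambda>x. K +>\<^bsub>M\<^esub> x) ` carrier M"
  unfolding quot_module_def A_RCOSETS_def' by auto

lemma quot_zero: "\<zero>\<^bsub>quot_module M K\<^esub> = K"
  by (simp add: quot_module_def)

lemma quot_add:
  assumes K: "submodule K R M" and x: "x \<in> carrier M" and y: "y \<in> carrier M"
  shows "(K +>\<^bsub>M\<^esub> x) \<oplus>\<^bsub>quot_module M K\<^esub> (K +>\<^bsub>M\<^esub> y) = K +>\<^bsub>M\<^esub> (x \<oplus>\<^bsub>M\<^esub> y)"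
proof (rule equalityI; rule subsetI)
  fix z assume "z \<in> (K +>\<^bsub>M\<^esub> x) \<oplus>\<^bsub>quot_module M K\<^esub> (K +>\<^bsub>M\<^esub> y)"
  then obtain k k' where k: "k \<in> K" "k' \<in> K" "z = (k \<oplus>\<^bsub>M\<^esub> x) \<oplus>\<^bsub>M\<^esub> (k' \<oplus>\<^bsub>M\<^esub> y)"
    unfolding quot_module_def set_add_def' a_r_coset_def' by auto
  then have "z = (k \<oplus>\<^bsub>M\<^esub> k') \<oplus>\<^bsub>M\<^esub> (x \<oplus>\<^bsub>M\<^esub> y)"
    using x y submodule_mem[OF K] by (simp add: add_add_swap)
  then show "z \<in> K +>\<^bsub>M\<^esub> (x \<oplus>\<^bsub>M\<^esub> y)"
    using submodule_add[OF K k(1,2)] unfolding a_r_coset_def' by blast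
next
  fix z assume "z \<in> K +>\<^bsub>M\<^esub> (x \<oplus>\<^bsub>M\<^esub> y)"
  then obtain k where k: "k \<in> K" "z = k \<oplus>\<^bsub>M\<^esub> (x \<oplus>\<^bsub>M\<^esub> y)" unfolding a_r_coset_def' by blast
  then have "z = (k \<oplus>\<^bsub>M\<^esub> x) \<oplus>\<^bsub>M\<^esub> (\<zero>\<^bsub>M\<^esub> \<oplus>\<^bsub>M\<^esub> y)"
    using x y submodule_mem[OF K] by (simp add: M.a_assoc)
  then show "z \<in> (K +>\<^bsub>M\<^esub> x) \<oplus>\<^bsub>quot_module M K\<^esub> (K +>\<^bsub>M\<^esub> y)"
    using k submodule_zero[OF K] unfolding quot_module_def set_add_def' a_r_coset_def' by auto
qed

lemma quot_smult:
  assumes K: "submodule K R M" and a: "a \<in> carrier R" and x: "x \<in> carrier M"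
  shows "a \<odot>\<^bsub>quot_module M K\<^esub> (K +>\<^bsub>M\<^esub> x) = K +>\<^bsub>M\<^esub> (a \<odot>\<^bsub>M\<^esub> x)"
proof (rule equalityI; rule subsetI)
  fix z assume "z \<in> a \<odot>\<^bsub>quot_module M K\<^esub> (K +>\<^bsub>M\<^esub> x)"
  then obtain k k' where k: "k \<in> K" "k' \<in> K" "z = k \<oplus>\<^bsub>M\<^esub> a \<odot>\<^bsub>M\<^esub> (k' \<oplus>\<^bsub>M\<^esub> x)"
    unfolding quot_module_def set_add_def' a_r_coset_def' by auto
  then have "z = (k \<oplus>\<^bsub>M\<^esub> a \<odot>\<^bsub>M\<^esub> k') \<oplus>\<^bsub>M\<^esub> a \<odot>\<^bsub>M\<^esub> x"
    using a x submodule_mem[OF K] by (simp add: smult_r_distr M.a_assoc)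
  then show "z \<in> K +>\<^bsub>M\<^esub> (a \<odot>\<^bsub>M\<^esub> x)"
    using submodule_add[OF K k(1) submodule_smult[OF K a k(2)]] unfolding a_r_coset_def' by blast
next
  fix z assume "z \<in> K +>\<^bsub>M\<^esub> (a \<odot>\<^bsub>M\<^esub> x)"
  then obtain k where k: "k \<in> K" "z = k \<oplus>\<^bsub>M\<^esub> a \<odot>\<^bsub>M\<^esub> x" unfolding a_r_coset_def' by blast
  then show "z \<in> a \<odot>\<^bsub>quot_module M K\<^esub> (K +>\<^bsub>M\<^esub> x)"
    using k coset_self[OF K x] unfolding quot_module_def set_add_def' by auto
qed

lemma quot_is_module:
  assumes K: "submodule K R M"
  shows "module R (quot_module M K)"
proof (rule moduleI)
  show "cring R" by (rule R.cring_axioms)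
  show "abelian_group (quot_module M K)"
  proof (rule abelian_groupI)
    show "\<zero>\<^bsub>quot_module M K\<^esub> \<in> carrier (quot_module M K)"
      unfolding quot_carrier quot_zero using coset_zero[OF K] by (intro image_eqI[of _ _ "\<zero>\<^bsub>M\<^esub>"]) auto
    fix X Y Z assume "X \<in> carrier (quot_module M K)"
    then obtain x where x: "X = K +>\<^bsub>M\<^esub> x" "x \<in> carrier M" unfolding quot_carrier by blast
    show "\<zero>\<^bsub>quot_module M K\<^esub> \<oplus>\<^bsub>quot_module M K\<^esub> X = X"
      using quot_add[OF K M.zero_closed x(2)] x by (simp add: quot_zero coset_zero[OF K])
    have "(K +>\<^bsub>M\<^esub> (\<ominus>\<^bsub>M\<^esub> x)) \<oplus>\<^bsub>quot_module M K\<^esub> X = \<zero>\<^bsub>quot_module M K\<^esub>"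
      using x by (simp add: quot_add[OF K] M.l_neg coset_zero[OF K] quot_zero)
    then show "\<exists>Y\<in>carrier (quot_module M K). Y \<oplus>\<^bsub>quot_module M K\<^esub> X = \<zero>\<^bsub>quot_module M K\<^esub>"
      unfolding quot_carrier using x by blast
    assume "Y \<in> carrier (quot_module M K)"
    then obtain y where y: "Y = K +>\<^bsub>M\<^esub> y" "y \<in> carrier M" unfolding quot_carrier by blast
    show "X \<oplus>\<^bsub>quot_module M K\<^esub> Y \<in> carrier (quot_module M K)"
      using x y by (simp add: quot_add[OF K] quot_carrier)
    show "X \<oplus>\<^bsub>quot_module M K\<^esub> Y = Y \<oplus>\<^bsub>quot_module M K\<^esub> X"
      using x y by (simp add: quot_add[OF K] M.a_comm)
    assume "Z \<in> carrier (quot_module M K)"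
    then obtain z where z: "Z = K +>\<^bsub>M\<^esub> z" "z \<in> carrier M" unfolding quot_carrier by blast
    show "(X \<oplus>\<^bsub>quot_module M K\<^esub> Y) \<oplus>\<^bsub>quot_module M K\<^esub> Z
      = X \<oplus>\<^bsub>quot_module M K\<^esub> (Y \<oplus>\<^bsub>quot_module M K\<^esub> Z)"
      using x y z by (simp add: quot_add[OF K] M.a_assoc)
  qed
  fix X assume "X \<in> carrier (quot_module M K)"
  then obtain x where x: "X = K +>\<^bsub>M\<^esub> x" "x \<in> carrier M" unfolding quot_carrier by blast
  show "\<one> \<odot>\<^bsub>quot_module M K\<^esub> X = X" using x by (simp add: quot_smult[OF K])
  {
    fix a assume a: "a \<in> carrier R"
    show "a \<odot>\<^bsub>quot_module M K\<^esub> X \<in> carrier (quot_module M K)"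
      using x a by (simp add: quot_smult[OF K] quot_carrier)
    {
      fix b assume b: "b \<in> carrier R"
      show "(a \<oplus> b) \<odot>\<^bsub>quot_module M K\<^esub> X =
        (a \<odot>\<^bsub>quot_module M K\<^esub> X) \<oplus>\<^bsub>quot_module M K\<^esub> (b \<odot>\<^bsub>quot_module M K\<^esub> X)"
        using x a b by (simp add: quot_smult[OF K] quot_add[OF K] smult_l_distr)
      show "(a \<otimes> b) \<odot>\<^bsub>quot_module M K\<^esub> X = a \<odot>\<^bsub>quot_module M K\<^esub> (b \<odot>\<^bsub>quot_module M K\<^esub> X)"
        using x a b by (simp add: quot_smult[OF K] smult_assoc1)
    }
    fix Y assume "Y \<in> carrier (quot_module M K)"
    then obtain y where y: "Y = K +>\<^bsub>M\<^esub> y" "y \<in> carrier M" unfolding quot_carrier by blast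
    show "a \<odot>\<^bsub>quot_module M K\<^esub> (X \<oplus>\<^bsub>quot_module M K\<^esub> Y) =
      (a \<odot>\<^bsub>quot_module M K\<^esub> X) \<oplus>\<^bsub>quot_module M K\<^esub> (a \<odot>\<^bsub>quot_module M K\<^esub> Y)"
      using x y a by (simp add: quot_smult[OF K] quot_add[OF K] smult_r_distr)
  }
qed

lemma zero_quot_iff:
  assumes K: "submodule K R M"
  shows "zero_module (quot_module M K) \<longleftrightarrow> K = carrier M"
proof -
  have "zero_module (quot_module M K) \<longleftrightarrow> (\<forall>x\<in>carrier M. K +>\<^bsub>M\<^esub> x = K)"
    unfolding zero_module_def quot_carrier quot_zero using M.zero_closed by blast
  also have "\<dots> \<longleftrightarrow> K = carrier M" using coset_eq_self_iff[OF K] submodule_subset[OF K] by blast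
  finally show ?thesis .
qed

lemma nonzerodivisor_quot_iff:
  assumes K: "submodule K R M" and a: "a \<in> carrier R"
  shows "nonzerodivisor_on (quot_module M K) a \<longleftrightarrow> regular_mod K a"
  unfolding nonzerodivisor_on_def quot_carrier quot_zero regular_mod_def ball_simps
  by (intro ball_cong refl) (simp add: quot_smult[OF K a] coset_eq_self_iff[OF K] a)

lemma ideal_smult_eq_adjoins:
  assumes "set xs \<subseteq> carrier R"
  shows "ideal_smult R (set xs) M = adjoins {\<zero>\<^bsub>M\<^esub>} xs"
  using assms
proof (induction xs rule: rev_induct)
  case Nil
  then show ?case by (simp add: ideal_smult_def span_empty)
next
  case (snoc x xs)
  define G where "G A = {a \<odot>\<^bsub>M\<^esub> u | a u. a \<in> A \<and> u \<in> carrier M}" for A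
  have IH: "module_span R M (G (set xs)) = adjoins {\<zero>\<^bsub>M\<^esub>} xs"
    using snoc unfolding ideal_smult_def G_def by simp
  have x: "x \<in> carrier R" and xs: "set xs \<subseteq> carrier R" using snoc.prems by auto
  have sub: "submodule (adjoins {\<zero>\<^bsub>M\<^esub>} xs) R M" by (rule adjoins_submodule[OF zero_submodule xs])
  have "module_span R M (G (set (xs @ [x]))) = adjoin (adjoins {\<zero>\<^bsub>M\<^esub>} xs) x"
  proof (rule span_eqI)
    show "submodule (adjoin (adjoins {\<zero>\<^bsub>M\<^esub>} xs) x) R M" by (rule adjoin_submodule[OF sub x])
    show "G (set (xs @ [x])) \<subseteq> adjoin (adjoins {\<zero>\<^bsub>M\<^esub>} xs) x"
    proof
      fix z assume "z \<in> G (set (xs @ [x]))"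
      then obtain a u where z: "z = a \<odot>\<^bsub>M\<^esub> u" "u \<in> carrier M" "a = x \<or> a \<in> set xs"
        unfolding G_def by auto
      show "z \<in> adjoin (adjoins {\<zero>\<^bsub>M\<^esub>} xs) x"
      proof (cases "a = x")
        case True
        then show ?thesis using smult_in_adjoin[OF sub x] z by simp
      next
        case False
        then have "z \<in> G (set xs)" using z unfolding G_def by blast
        then have "z \<in> adjoins {\<zero>\<^bsub>M\<^esub>} xs" using IH span_superset[of "G (set xs)"] by auto
        then show ?thesis using adjoin_superset[OF sub x] by blast
      qed
    qed
    fix H assume H: "submodule H R M" "G (set (xs @ [x])) \<subseteq> H"
    then have "module_span R M (G (set xs)) \<subseteq> H" by (intro span_minimal) (auto simp: G_def)
    then have "adjoins {\<zero>\<^bsub>M\<^esub>} xs \<subseteq> H" unfolding IH .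
    then show "adjoin (adjoins {\<zero>\<^bsub>M\<^esub>} xs) x \<subseteq> H"
      by (rule adjoin_minimal[OF H(1)]) (use H(2) in \<open>auto simp: G_def\<close>)
  qed
  then show ?case unfolding ideal_smult_def G_def by simp
qed

text \<open>The bridge from quotient modules, in which depth is defined, to their encoding by
  submodules.\<close>

lemma regular_sequence_iff:
  "regular_sequence R M xs \<longleftrightarrow>
    set xs \<subseteq> carrier R \<and> regular_seq {\<zero>\<^bsub>M\<^esub>} xs \<and> adjoins {\<zero>\<^bsub>M\<^esub>} xs \<noteq> carrier M"
proof (cases "set xs \<subseteq> carrier R")
  case True
  have "nonzerodivisor_on (quot_module M (ideal_smult R (set (take i xs)) M)) (xs ! i) \<longleftrightarrow>
      regular_mod (adjoins {\<zero>\<^bsub>M\<^esub>} (take i xs)) (xs ! i)" if "i < length xs" for i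
  proof -
    have i: "set (take i xs) \<subseteq> carrier R" using True set_take_subset by fast
    show ?thesis
      unfolding ideal_smult_eq_adjoins[OF i]
      by (rule nonzerodivisor_quot_iff[OF adjoins_submodule[OF zero_submodule i]]) (use True that in auto)
  qed
  then show ?thesis
    unfolding regular_sequence_def regular_seq_iff ideal_smult_eq_adjoins[OF True]
    using True zero_quot_iff[OF adjoins_submodule[OF zero_submodule True]] by simp
qed (simp add: regular_sequence_def)

end

text \<open>Unlike the members of \<open>mod_hom\<close>, these maps are not constrained outside the
  carrier, so that they compose as plain functions.\<close>

locale linear_map = M: module R M + P: module R P
  for R (structure) and M (structure) and P (structure) +
  fixes f
  assumes map_closed [simp, intro]: "x \<in> carrier M \<Longrightarrow> f x \<in> carrier P"
    and map_add: "x \<in> carrier M \<Longrightarrow> y \<in> carrier M \<Longrightarrow> f (x \<oplus>\<^bsub>M\<^esub> y) = f x \<oplus>\<^bsub>P\<^esub> f y"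
    and map_smult: "a \<in> carrier R \<Longrightarrow> x \<in> carrier M \<Longrightarrow> f (a \<odot>\<^bsub>M\<^esub> x) = a \<odot>\<^bsub>P\<^esub> f x"
begin

lemma map_zero [simp]: "f \<zero>\<^bsub>M\<^esub> = \<zero>\<^bsub>P\<^esub>"
  using map_smult[of \<zero> "\<zero>\<^bsub>M\<^esub>"] by simp

lemma map_neg: "x \<in> carrier M \<Longrightarrow> f (\<ominus>\<^bsub>M\<^esub> x) = \<ominus>\<^bsub>P\<^esub> f x"
  using map_smult[of "\<ominus> \<one>" x] by (simp add: M.smult_l_minus P.smult_l_minus)

lemma map_diff: "x \<in> carrier M \<Longrightarrow> y \<in> carrier M \<Longrightarrow> f (x \<ominus>\<^bsub>M\<^esub> y) = f x \<ominus>\<^bsub>P\<^esub> f y"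
  by (simp add: M.M.minus_eq P.M.minus_eq map_add map_neg)

lemma preimage_submodule:
  assumes K: "submodule K R P"
  shows "submodule {x \<in> carrier M. f x \<in> K} R M"
  by (rule M.submoduleI)
    (auto simp: map_add map_smult map_neg P.submodule_zero[OF K]
      intro: P.submodule_add[OF K] P.submodule_smult[OF K] P.submodule_neg[OF K])

lemma image_submodule:
  assumes K: "submodule K R M"
  shows "submodule (f ` K) R P"
proof (rule P.submoduleI)
  note [simp] = M.submodule_mem[OF K]
  show "f ` K \<subseteq> carrier P" by auto
  show "\<zero>\<^bsub>P\<^esub> \<in> f ` K" using M.submodule_zero[OF K] map_zero by (metis imageI)
  fix a assume "a \<in> f ` K"
  then obtain x where x: "x \<in> K" "a = f x" by blast
  show "\<ominus>\<^bsub>P\<^esub> a \<in> f ` K"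
    using x M.submodule_neg[OF K x(1)] map_neg[of x] by (auto intro!: image_eqI[of _ _ "\<ominus>\<^bsub>M\<^esub> x"])
  { fix b assume "b \<in> f ` K"
    then obtain y where y: "y \<in> K" "b = f y" by blast
    show "a \<oplus>\<^bsub>P\<^esub> b \<in> f ` K"
      using x y M.submodule_add[OF K x(1) y(1)] map_add[of x y]
      by (auto intro!: image_eqI[of _ _ "x \<oplus>\<^bsub>M\<^esub> y"]) }
  fix r assume r: "r \<in> carrier R"
  then show "r \<odot>\<^bsub>P\<^esub> a \<in> f ` K"
    using x M.submodule_smult[OF K r x(1)] map_smult[of r x]
    by (auto intro!: image_eqI[of _ _ "r \<odot>\<^bsub>M\<^esub> x"])
qed

definition preimage
  where "preimage J = {x \<in> carrier M. f x \<in> J}"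

context
  assumes surj: "f ` carrier M = carrier P"
begin

text \<open>Surjectivity provides a preimage \<open>v\<close> of \<open>w\<close>, and subtracting x
  v from \<open>u\<close> leaves an element of the preimage of \<open>J\<close>.\<close>

lemma preimage_adjoin:
  assumes J: "submodule J R P" and x: "x \<in> carrier R"
  shows "preimage (P.adjoin J x) = M.adjoin (preimage J) x"
proof (rule equalityI; rule subsetI)
  fix u assume "u \<in> preimage (P.adjoin J x)"
  then obtain j w where u: "u \<in> carrier M" "j \<in> J" "w \<in> carrier P" "f u = j \<oplus>\<^bsub>P\<^esub> x \<odot>\<^bsub>P\<^esub> w"
    unfolding preimage_def P.adjoin_def by blast
  then obtain v where v: "v \<in> carrier M" "w = f v" using surj by blast
  have jP: "j \<in> carrier P" by (rule P.submodule_mem[OF J u(2)])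
  have "f (u \<ominus>\<^bsub>M\<^esub> x \<odot>\<^bsub>M\<^esub> v) = j"
    using u v x jP by (simp add: map_diff map_smult P.M.minus_eq P.M.a_assoc P.M.r_neg)
  then have "u \<ominus>\<^bsub>M\<^esub> x \<odot>\<^bsub>M\<^esub> v \<in> preimage J" using u v x unfolding preimage_def by simp
  moreover have "u = (u \<ominus>\<^bsub>M\<^esub> x \<odot>\<^bsub>M\<^esub> v) \<oplus>\<^bsub>M\<^esub> x \<odot>\<^bsub>M\<^esub> v"
    using u v x by (simp add: M.M.minus_eq M.M.a_assoc M.M.l_neg)
  ultimately show "u \<in> M.adjoin (preimage J) x" unfolding M.adjoin_def using v by blast
next
  fix u assume "u \<in> M.adjoin (preimage J) x"
  then obtain k v where "f k \<in> J" "k \<in> carrier M" "v \<in> carrier M" "u = k \<oplus>\<^bsub>M\<^esub> x \<odot>\<^bsub>M\<^esub> v"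
    unfolding M.adjoin_def preimage_def by blast
  then show "u \<in> preimage (P.adjoin J x)"
    unfolding preimage_def P.adjoin_def using x by (auto simp: map_add map_smult)
qed

lemma preimage_adjoins:
  "submodule J R P \<Longrightarrow> set xs \<subseteq> carrier R \<Longrightarrow>
    preimage (P.adjoins J xs) = M.adjoins (preimage J) xs"
  by (induction xs arbitrary: J) (auto simp: preimage_adjoin P.adjoin_submodule)

lemma regular_mod_preimage: "x \<in> carrier R \<Longrightarrow> M.regular_mod (preimage J) x \<longleftrightarrow> P.regular_mod J x"
  unfolding M.regular_mod_def P.regular_mod_def surj[symmetric] preimage_def
  by (auto simp: map_smult)

lemma regular_seq_preimage:
  "submodule J R P \<Longrightarrow> set xs \<subseteq> carrier R \<Longrightarrow>
    M.regular_seq (preimage J) xs \<longleftrightarrow> P.regular_seq J xs"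
  by (induction xs arbitrary: J)
    (auto simp: regular_mod_preimage preimage_adjoin[symmetric] P.adjoin_submodule)

lemma preimage_eq_carrier_iff: "J \<subseteq> carrier P \<Longrightarrow> preimage J = carrier M \<longleftrightarrow> J = carrier P"
proof
  assume J: "J \<subseteq> carrier P" and eq: "preimage J = carrier M"
  have "f x \<in> J" if "x \<in> carrier M" for x using that unfolding eq[symmetric] by (simp add: preimage_def)
  then have "f ` carrier M \<subseteq> J" by auto
  then show "J = carrier P" using J surj by simp
qed (auto simp: preimage_def)

text \<open>Regular sequences on an image of M are computed inside M, beginning with the kernel
  instead of zero. This moves the depth of a cokernel into the direct power that covers it.\<close>

lemma regular_sequence_preimage_iff:
  "regular_sequence R P xs \<longleftrightarrow> set xs \<subseteq> carrier R \<and>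
    M.regular_seq (preimage {\<zero>\<^bsub>P\<^esub>}) xs \<and> M.adjoins (preimage {\<zero>\<^bsub>P\<^esub>}) xs \<noteq> carrier M"
proof (cases "set xs \<subseteq> carrier R")
  case True
  show ?thesis
    unfolding P.regular_sequence_iff preimage_adjoins[OF P.zero_submodule True, symmetric]
      regular_seq_preimage[OF P.zero_submodule True]
      preimage_eq_carrier_iff[OF P.submodule_subset[OF P.adjoins_submodule[OF P.zero_submodule True]]]
    by simp
qed (simp add: P.regular_sequence_iff)

end

end

section \<open>Direct powers and free modules\<close>

lemma (in cring) self_module_is_module: "module R (self_module R)"
proof (rule moduleI)
  show "cring R" by (rule cring_axioms)
  show "abelian_group (self_module R)"
    by (rule abelian_groupI)
      (auto simp: self_module_def a_ac intro: bexI[of _ "\<ominus> x" for x] l_neg)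
qed (auto simp: self_module_def l_distr r_distr m_assoc)

lemma self_module_simps [simp]:
  "carrier (self_module R) = carrier R" "\<zero>\<^bsub>self_module R\<^esub> = \<zero>\<^bsub>R\<^esub>"
  "x \<oplus>\<^bsub>self_module R\<^esub> y = x \<oplus>\<^bsub>R\<^esub> y" "a \<odot>\<^bsub>self_module R\<^esub> x = a \<otimes>\<^bsub>R\<^esub> x"
  by (simp_all add: self_module_def)

text \<open>The body mirrors that of \<open>free_module\<close>, so that a free module is literally
  a direct power of \<open>self_module\<close>. The direct power also serves as a concrete model of
  the tensor product of R^S with M.\<close>

definition direct_power :: "('r, 'm, 'c) module_scheme \<Rightarrow> 'b set \<Rightarrow> ('r, 'b \<Rightarrow> 'm) module"
  where "direct_power M S = \<lparr>carrier = {f. range f \<subseteq> carrier M \<and> finite {s. f s \<noteq> \<zero>\<^bsub>M\<^esub>} \<and>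
      (\<forall>s. s \<notin> S \<longrightarrow> f s = \<zero>\<^bsub>M\<^esub>)},
    monoid.mult = undefined, one = undefined, ring.zero = (\<lambda>s. \<zero>\<^bsub>M\<^esub>),
    add = (\<lambda>f g s. f s \<oplus>\<^bsub>M\<^esub> g s), smult = (\<lambda>a f s. a \<odot>\<^bsub>M\<^esub> f s)\<rparr>"

lemma free_module_eq: "free_module R S = direct_power (self_module R) S"
  by (simp add: free_module_def direct_power_def)

definition single :: "('r, 'm, 'c) module_scheme \<Rightarrow> 'b \<Rightarrow> 'm \<Rightarrow> 'b \<Rightarrow> 'm"
  where "single M s n = (\<lambda>t. if t = s then n else \<zero>\<^bsub>M\<^esub>)"

lemma free_gen_eq: "free_gen R s = single (self_module R) s \<one>\<^bsub>R\<^esub>"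
  by (rule ext) (simp add: free_gen_def single_def)

lemma direct_power_simps [simp]:
  "\<zero>\<^bsub>direct_power M S\<^esub> = (\<lambda>s. \<zero>\<^bsub>M\<^esub>)"
  "f \<oplus>\<^bsub>direct_power M S\<^esub> g = (\<lambda>s. f s \<oplus>\<^bsub>M\<^esub> g s)"
  "a \<odot>\<^bsub>direct_power M S\<^esub> f = (\<lambda>s. a \<odot>\<^bsub>M\<^esub> f s)"
  by (simp_all add: direct_power_def)

lemma direct_power_carrier: "f \<in> carrier (direct_power M S) \<longleftrightarrow>
    (\<forall>s. f s \<in> carrier M) \<and> finite {s. f s \<noteq> \<zero>\<^bsub>M\<^esub>} \<and> (\<forall>s. s \<notin> S \<longrightarrow> f s = \<zero>\<^bsub>M\<^esub>)"
  by (auto simp: direct_power_def)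

lemma direct_power_apply [simp, intro]: "f \<in> carrier (direct_power M S) \<Longrightarrow> f s \<in> carrier M"
  by (simp add: direct_power_carrier)

lemma linear_map_comp:
  assumes "linear_map R M P f" "linear_map R P Q g"
  shows "linear_map R M Q (\<lambda>x. g (f x))"
proof -
  interpret f: linear_map R M P f by fact
  interpret g: linear_map R P Q g by fact
  show ?thesis
    by unfold_locales (simp_all add: f.map_add g.map_add f.map_smult g.map_smult)
qed

lemma mod_hom_linear:
  assumes "module R M" "module R P" "f \<in> mod_hom R M P"
  shows "linear_map R M P f"
  using assms unfolding mod_hom_def
  by (auto intro!: linear_map.intro linear_map_axioms.intro)

lemma linear_map_restrict_mod_hom:
  assumes "linear_map R M P f"
  shows "restrict f (carrier M) \<in> mod_hom R M P"
proof -
  interpret linear_map R M P f by fact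
  show ?thesis
    unfolding mod_hom_def using map_add map_smult M.M.add.m_closed M.smult_closed by auto
qed

text \<open>Two maps are shown to be equal by checking that this submodule contains
  generators.\<close>

lemma equalizer_submodule:
  assumes "linear_map R M P f" "linear_map R M P g"
  shows "submodule {x \<in> carrier M. f x = g x} R M"
proof -
  interpret f: linear_map R M P f by fact
  interpret g: linear_map R M P g by fact
  show ?thesis
    by (rule f.M.submoduleI)
      (auto simp: f.map_add g.map_add f.map_smult g.map_smult f.map_neg g.map_neg)
qed

context module
begin

lemma linear_map_id: "linear_map R M M (\<lambda>x. x)"
  by unfold_locales auto

lemma linear_map_smult: "x \<in> carrier M \<Longrightarrow> linear_map R (self_module R) M (\<lambda>r. r \<odot>\<^bsub>M\<^esub> x)"
  by (rule linear_map.intro[OF R.self_module_is_module module_axioms], unfold_locales)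
    (simp_all add: smult_l_distr smult_assoc1)

lemma direct_power_finite_supp:
  assumes "f \<in> carrier (direct_power M S)" "g \<in> carrier (direct_power M S)"
  shows "finite {s. f s \<oplus>\<^bsub>M\<^esub> g s \<noteq> \<zero>\<^bsub>M\<^esub>}"
proof (rule finite_subset)
  show "{s. f s \<oplus>\<^bsub>M\<^esub> g s \<noteq> \<zero>\<^bsub>M\<^esub>} \<subseteq> {s. f s \<noteq> \<zero>\<^bsub>M\<^esub>} \<union> {s. g s \<noteq> \<zero>\<^bsub>M\<^esub>}" by auto
qed (use assms in \<open>auto simp: direct_power_carrier\<close>)

lemma direct_power_is_module: "module R (direct_power M S)"
proof (rule moduleI)
  show "cring R" by (rule R.cring_axioms)
  show "abelian_group (direct_power M S)"
  proof (rule abelian_groupI)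
    fix f g h assume f: "f \<in> carrier (direct_power M S)"
    show "\<exists>g\<in>carrier (direct_power M S). g \<oplus>\<^bsub>direct_power M S\<^esub> f = \<zero>\<^bsub>direct_power M S\<^esub>"
    proof (rule bexI)
      show "(\<lambda>s. \<ominus>\<^bsub>M\<^esub> f s) \<in> carrier (direct_power M S)"
        using f by (auto simp: direct_power_carrier elim!: rev_finite_subset)
    qed (use f in \<open>simp add: M.l_neg\<close>)
    assume g: "g \<in> carrier (direct_power M S)"
    show "f \<oplus>\<^bsub>direct_power M S\<^esub> g \<in> carrier (direct_power M S)"
      using f g direct_power_finite_supp[OF f g] by (auto simp: direct_power_carrier)
  qed (auto simp: direct_power_carrier M.a_ac)
  fix a f assume a: "a \<in> carrier R" and f: "f \<in> carrier (direct_power M S)"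
  show "a \<odot>\<^bsub>direct_power M S\<^esub> f \<in> carrier (direct_power M S)"
    using a f by (auto simp: direct_power_carrier elim!: rev_finite_subset)
qed (auto simp: smult_l_distr smult_r_distr smult_assoc1)

lemma single_closed: "s \<in> S \<Longrightarrow> n \<in> carrier M \<Longrightarrow> single M s n \<in> carrier (direct_power M S)"
  by (auto simp: direct_power_carrier single_def)

lemma single_linear:
  assumes "s \<in> S"
  shows "linear_map R M (direct_power M S) (single M s)"
  by (rule linear_map.intro[OF module_axioms direct_power_is_module], unfold_locales)
    (use assms single_closed in \<open>auto simp: single_def\<close>)

lemma direct_power_mem_submodule:
  assumes u: "u \<in> carrier (direct_power M S)" and H: "submodule H R (direct_power M S)"
    and single: "\<And>s. s \<in> S \<Longrightarrow> single M s (u s) \<in> H"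
  shows "u \<in> H"
proof -
  interpret D: module R "direct_power M S" by (rule direct_power_is_module)
  \<comment> \<open>Erasing a coordinate does not preserve \<open>u\<close>, so the induction runs
    over its truncations: functions that agree with \<open>u\<close> wherever they are
    nonzero.\<close>
  have "v \<in> H" if "finite A" "\<And>s. v s \<noteq> \<zero>\<^bsub>M\<^esub> \<Longrightarrow> s \<in> A \<and> v s = u s" for A v
    using that
  proof (induction A arbitrary: v)
    case empty
    then have "v = \<zero>\<^bsub>direct_power M S\<^esub>" by auto
    then show ?case using D.submodule_zero[OF H] by simp
  next
    case (insert t A)
    define w where "w = v(t := \<zero>\<^bsub>M\<^esub>)"
    have w: "w \<in> H" by (rule insert.IH) (use insert.prems in \<open>auto simp: w_def split: if_splits\<close>)
    have wM: "w s \<in> carrier M" for s using D.submodule_mem[OF H w] by simp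
    show ?case
    proof (cases "v t = \<zero>\<^bsub>M\<^esub>")
      case True
      then have "v = w" unfolding w_def by auto
      then show ?thesis using w by simp
    next
      case False
      then have t: "v t = u t" "t \<in> S" using insert.prems u by (auto simp: direct_power_carrier)
      have "single M t (u t) s \<oplus>\<^bsub>M\<^esub> w s = v s" for s
        using t wM[of s] u by (auto simp: single_def w_def)
      then have "v = single M t (u t) \<oplus>\<^bsub>direct_power M S\<^esub> w" by auto
      then show ?thesis using D.submodule_add[OF H single[OF t(2)] w] by simp
    qed
  qed
  from this[of "{s. u s \<noteq> \<zero>\<^bsub>M\<^esub>}" u] show ?thesis using u by (simp add: direct_power_carrier)
qed

lemma direct_power_map_eqI:
  assumes "linear_map R (direct_power M S) P f" "linear_map R (direct_power M S) P g"
    and "\<And>s n. s \<in> S \<Longrightarrow> n \<in> carrier M \<Longrightarrow> f (single M s n) = g (single M s n)"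
    and u: "u \<in> carrier (direct_power M S)"
  shows "f u = g u"
proof -
  have "u \<in> {x \<in> carrier (direct_power M S). f x = g x}"
    by (rule direct_power_mem_submodule[OF u equalizer_submodule[OF assms(1,2)]])
      (use assms(3) u in \<open>auto simp: single_closed\<close>)
  then show ?thesis by simp
qed

lemma direct_power_map_exists:
  assumes P: "module R P" and \<beta>: "\<And>s. s \<in> S \<Longrightarrow> linear_map R M P (\<beta> s)"
  obtains g where "linear_map R (direct_power M S) P g"
    "\<And>s n. s \<in> S \<Longrightarrow> n \<in> carrier M \<Longrightarrow> g (single M s n) = \<beta> s n"
proof -
  interpret P: module R P by (rule P)
  define g where "g u = (\<Oplus>\<^bsub>P\<^esub>s\<in>{s. u s \<noteq> \<zero>\<^bsub>M\<^esub>}. \<beta> s (u s))" for u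
  have \<beta>_closed: "\<beta> s n \<in> carrier P" if "s \<in> S" "n \<in> carrier M" for s n
    using linear_map.map_closed[OF \<beta>] that by blast
  have \<beta>_zero: "\<beta> s \<zero>\<^bsub>M\<^esub> = \<zero>\<^bsub>P\<^esub>" if "s \<in> S" for s
    using linear_map.map_zero[OF \<beta>] that by blast
  \<comment> \<open>The sum in \<open>g\<close> runs over the support, which varies with
    \<open>u\<close>. Larger index sets make the sums for different arguments comparable, as
    \<open>\<beta> s\<close> vanishes at zero.\<close>
  have eq: "g u = (\<Oplus>\<^bsub>P\<^esub>s\<in>A. \<beta> s (u s))"
    if "finite A" "A \<subseteq> S" "{s. u s \<noteq> \<zero>\<^bsub>M\<^esub>} \<subseteq> A" "\<And>s. u s \<in> carrier M" for A u
    unfolding g_def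
    by (rule P.add.finprod_mono_neutral_cong_left) (use that \<beta>_closed \<beta>_zero in auto)
  have supp: "{s. u s \<noteq> \<zero>\<^bsub>M\<^esub>} \<subseteq> S" "finite {s. u s \<noteq> \<zero>\<^bsub>M\<^esub>}" if "u \<in> carrier (direct_power M S)" for u
    using that by (auto simp: direct_power_carrier)
  have lin: "linear_map R (direct_power M S) P g"
  proof (rule linear_map.intro[OF direct_power_is_module P], unfold_locales)
    fix u assume u: "u \<in> carrier (direct_power M S)"
    let ?U = "{s. u s \<noteq> \<zero>\<^bsub>M\<^esub>}"
    show "g u \<in> carrier P"
      unfolding g_def by (rule P.finsum_closed) (use supp[OF u] u \<beta>_closed in auto)
    {
      fix v assume v: "v \<in> carrier (direct_power M S)"
      let ?A = "?U \<union> {s. v s \<noteq> \<zero>\<^bsub>M\<^esub>}"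
      have A: "finite ?A" "?A \<subseteq> S" using supp[OF u] supp[OF v] by auto
      have "g (u \<oplus>\<^bsub>direct_power M S\<^esub> v) = (\<Oplus>\<^bsub>P\<^esub>s\<in>?A. \<beta> s (u s \<oplus>\<^bsub>M\<^esub> v s))"
        by (subst eq[OF A]) (use u v in auto)
      also have "\<dots> = (\<Oplus>\<^bsub>P\<^esub>s\<in>?A. \<beta> s (u s) \<oplus>\<^bsub>P\<^esub> \<beta> s (v s))"
        by (rule P.add.finprod_cong')
          (use A u v \<beta>_closed linear_map.map_add[OF \<beta>] in auto)
      also have "\<dots> = (\<Oplus>\<^bsub>P\<^esub>s\<in>?A. \<beta> s (u s)) \<oplus>\<^bsub>P\<^esub> (\<Oplus>\<^bsub>P\<^esub>s\<in>?A. \<beta> s (v s))"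
        by (rule P.finsum_addf) (use A u v \<beta>_closed in auto)
      also have "\<dots> = g u \<oplus>\<^bsub>P\<^esub> g v"
        using eq[OF A, of u] eq[OF A, of v] u v by simp
      finally show "g (u \<oplus>\<^bsub>direct_power M S\<^esub> v) = g u \<oplus>\<^bsub>P\<^esub> g v" .
    }
    fix a assume a: "a \<in> carrier R"
    have "g (a \<odot>\<^bsub>direct_power M S\<^esub> u) = (\<Oplus>\<^bsub>P\<^esub>s\<in>?U. \<beta> s (a \<odot>\<^bsub>M\<^esub> u s))"
      by (subst eq[OF supp(2,1)[OF u]]) (use u a in auto)
    also have "\<dots> = (\<Oplus>\<^bsub>P\<^esub>s\<in>?U. a \<odot>\<^bsub>P\<^esub> \<beta> s (u s))"
      by (rule P.add.finprod_cong')
        (use supp[OF u] u a \<beta>_closed linear_map.map_smult[OF \<beta>] in auto)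
    also have "\<dots> = a \<odot>\<^bsub>P\<^esub> g u"
      unfolding g_def by (rule P.finsum_smult_ldistr[symmetric]) (use supp[OF u] u a \<beta>_closed in auto)
    finally show "g (a \<odot>\<^bsub>direct_power M S\<^esub> u) = a \<odot>\<^bsub>P\<^esub> g u" .
  qed
  have "g (single M s n) = \<beta> s n" if "s \<in> S" "n \<in> carrier M" for s n
  proof -
    have "g (single M s n) = (\<Oplus>\<^bsub>P\<^esub>t\<in>{s}. \<beta> t (single M s n t))"
      by (rule eq) (use that in \<open>auto simp: single_def\<close>)
    also have "\<dots> = \<beta> s n" using that \<beta>_closed by (simp add: single_def)
    finally show ?thesis .
  qed
  with lin show thesis using that by blast
qed

end

context cring
begin

lemma free_module_is_module: "module R (free_module R S)"
  unfolding free_module_eq by (rule module.direct_power_is_module[OF self_module_is_module])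

lemma free_gen_closed: "s \<in> S \<Longrightarrow> free_gen R s \<in> carrier (free_module R S)"
  unfolding free_module_eq free_gen_eq
  by (rule module.single_closed[OF self_module_is_module]) auto

lemma free_module_apply: "f \<in> carrier (free_module R S) \<Longrightarrow> f s \<in> carrier R"
  unfolding free_module_eq using direct_power_apply by fastforce

lemma free_module_simps [simp]:
  "\<zero>\<^bsub>free_module R S\<^esub> = (\<lambda>s. \<zero>)"
  "f \<oplus>\<^bsub>free_module R S\<^esub> g = (\<lambda>s. f s \<oplus> g s)"
  "a \<odot>\<^bsub>free_module R S\<^esub> f = (\<lambda>s. a \<otimes> f s)"
  by (simp_all add: free_module_def)

lemma single_self: "r \<in> carrier R \<Longrightarrow> single (self_module R) s r = r \<odot>\<^bsub>free_module R S\<^esub> free_gen R s"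
  by (auto simp: single_def free_gen_def)

lemma free_module_map_eqI:
  assumes f: "linear_map R (free_module R S) P f" and g: "linear_map R (free_module R S) P g"
    and eq: "\<And>s. s \<in> S \<Longrightarrow> f (free_gen R s) = g (free_gen R s)"
    and u: "u \<in> carrier (free_module R S)"
  shows "f u = g u"
proof (rule module.direct_power_map_eqI[OF self_module_is_module, where S = S and P = P])
  show "linear_map R (direct_power (self_module R) S) P f" "linear_map R (direct_power (self_module R) S) P g"
    "u \<in> carrier (direct_power (self_module R) S)"
    using f g u unfolding free_module_eq by auto
  fix s n assume "s \<in> S" "n \<in> carrier (self_module R)"
  then show "f (single (self_module R) s n) = g (single (self_module R) s n)"
    using linear_map.map_smult[OF f] linear_map.map_smult[OF g] eq
    by (simp add: single_self[of _ _ S] free_gen_closed del: free_module_simps)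
qed

lemma free_module_map_exists:
  assumes P: "module R P" and p: "\<And>s. s \<in> S \<Longrightarrow> p s \<in> carrier P"
  obtains g where "linear_map R (free_module R S) P g" "\<And>s. s \<in> S \<Longrightarrow> g (free_gen R s) = p s"
proof -
  interpret P: module R P by (rule P)
  have "linear_map R (self_module R) P (\<lambda>r. r \<odot>\<^bsub>P\<^esub> p s)" if "s \<in> S" for s
    by (rule P.linear_map_smult[OF p[OF that]])
  then obtain g where g: "linear_map R (direct_power (self_module R) S) P g"
    "\<And>s n. s \<in> S \<Longrightarrow> n \<in> carrier (self_module R) \<Longrightarrow> g (single (self_module R) s n) = n \<odot>\<^bsub>P\<^esub> p s"
    using module.direct_power_map_exists[OF self_module_is_module P, of S "\<lambda>s r. r \<odot>\<^bsub>P\<^esub> p s"] by blast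
  show thesis
  proof (rule that)
    show "linear_map R (free_module R S) P g" using g(1) by (simp add: free_module_eq)
    show "g (free_gen R s) = p s" if "s \<in> S" for s
      using g(2)[OF that, of \<one>] p[OF that] by (simp add: free_gen_eq)
  qed
qed

lemma free_module_mem_submodule:
  assumes u: "u \<in> carrier (free_module R S)" and H: "submodule H R (free_module R S)"
    and gen: "\<And>s. s \<in> S \<Longrightarrow> u s \<odot>\<^bsub>free_module R S\<^esub> free_gen R s \<in> H"
  shows "u \<in> H"
proof (rule module.direct_power_mem_submodule[OF self_module_is_module])
  show "u \<in> carrier (direct_power (self_module R) S)" "submodule H R (direct_power (self_module R) S)"
    using u H by (simp_all add: free_module_eq)
  fix s assume "s \<in> S"
  then show "single (self_module R) s (u s) \<in> H"
    using gen[of s] free_module_apply[OF u] by (simp add: single_self[of _ _ S] del: free_module_simps)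
qed

end

section \<open>Extension of scalars for maps of free modules\<close>

definition outer :: "('r, 'm, 'c) module_scheme \<Rightarrow> ('b \<Rightarrow> 'r) \<Rightarrow> 'm \<Rightarrow> 'b \<Rightarrow> 'm"
  where "outer M f n = (\<lambda>s. f s \<odot>\<^bsub>M\<^esub> n)"

text \<open>\<open>D\<close> is the map \<open>d \<otimes> M\<close>, where \<open>M\<^sup>S\<close> serves as \<open>R\<^sup>S \<otimes> M\<close> and \<open>outer M f n\<close> as \<open>f \<otimes> n\<close>.\<close>

definition scalar_ext :: "('r, 's) ring_scheme \<Rightarrow> ('r, 'm, 'c) module_scheme \<Rightarrow> 'b set \<Rightarrow> 'e set \<Rightarrow>
    (('b \<Rightarrow> 'r) \<Rightarrow> 'e \<Rightarrow> 'r) \<Rightarrow> (('b \<Rightarrow> 'm) \<Rightarrow> 'e \<Rightarrow> 'm) \<Rightarrow> bool"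
  where "scalar_ext R M S T d D \<longleftrightarrow>
    linear_map R (free_module R S) (free_module R T) d \<and>
    linear_map R (direct_power M S) (direct_power M T) D \<and>
    (\<forall>f\<in>carrier (free_module R S). \<forall>n\<in>carrier M. D (outer M f n) = outer M (d f) n)"

text \<open>This is J^S inside M^S, with quotient (M/J)^S; congruence modulo \<open>J\<close> is
  tested coordinate by coordinate.\<close>

definition powers_in :: "('r, 'm, 'c) module_scheme \<Rightarrow> 'm set \<Rightarrow> 'b set \<Rightarrow> ('b \<Rightarrow> 'm) set"
  where "powers_in M J S = {u \<in> carrier (direct_power M S). \<forall>s. u s \<in> J}"

lemma linear_map_diff:
  assumes "linear_map R M P f" "linear_map R M P g"
  shows "linear_map R M P (\<lambda>x. f x \<ominus>\<^bsub>P\<^esub> g x)"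
proof -
  interpret f: linear_map R M P f by fact
  interpret g: linear_map R M P g by fact
  show ?thesis
    by unfold_locales
      (simp_all add: f.map_add g.map_add f.map_smult g.map_smult f.P.M.minus_eq f.P.M.minus_add
        f.P.smult_r_distr f.P.smult_r_minus f.P.M.a_ac)
qed

context module
begin

lemma direct_power_diff:
  assumes "u \<in> carrier (direct_power M S)" "v \<in> carrier (direct_power M S)"
  shows "u \<ominus>\<^bsub>direct_power M S\<^esub> v = (\<lambda>s. u s \<ominus>\<^bsub>M\<^esub> v s)"
proof -
  interpret D: module R "direct_power M S" by (rule direct_power_is_module)
  have "(\<lambda>s. \<ominus>\<^bsub>M\<^esub> v s) \<in> carrier (direct_power M S)"
    using assms(2) by (auto simp: direct_power_carrier elim!: rev_finite_subset)
  then have "\<ominus>\<^bsub>direct_power M S\<^esub> v = (\<lambda>s. \<ominus>\<^bsub>M\<^esub> v s)"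
    by (intro D.M.minus_equality) (use assms(2) in \<open>auto simp: M.l_neg\<close>)
  then show ?thesis by (simp add: D.M.minus_eq M.minus_eq)
qed

lemma direct_power_carrier_finite:
  "finite S \<Longrightarrow> f \<in> carrier (direct_power M S) \<longleftrightarrow>
    (\<forall>s. f s \<in> carrier M) \<and> (\<forall>s. s \<notin> S \<longrightarrow> f s = \<zero>\<^bsub>M\<^esub>)"
  unfolding direct_power_carrier by (auto intro: finite_subset[of _ S])

lemma outer_closed:
  assumes f: "f \<in> carrier (free_module R S)" and n: "n \<in> carrier M"
  shows "outer M f n \<in> carrier (direct_power M S)"
proof -
  have "finite {s. f s \<odot>\<^bsub>M\<^esub> n \<noteq> \<zero>\<^bsub>M\<^esub>}"
    by (rule finite_subset[of _ "{s. f s \<noteq> \<zero>}"])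
      (use f n in \<open>auto simp: free_module_eq direct_power_carrier\<close>)
  then show ?thesis
    using f n R.free_module_apply[OF f]
    by (auto simp: outer_def free_module_eq direct_power_carrier)
qed

lemma outer_linear_left:
  assumes n: "n \<in> carrier M"
  shows "linear_map R (free_module R S) (direct_power M S) (\<lambda>f. outer M f n)"
  by (rule linear_map.intro[OF R.free_module_is_module direct_power_is_module], unfold_locales)
    (use n outer_closed[of _ S] R.free_module_apply[of _ S] in \<open>auto simp: outer_def smult_l_distr smult_assoc1\<close>)

lemma outer_linear_right:
  assumes f: "f \<in> carrier (free_module R S)"
  shows "linear_map R M (direct_power M S) (outer M f)"
  by (rule linear_map.intro[OF module_axioms direct_power_is_module], unfold_locales)
    (use outer_closed[OF f] R.free_module_apply[OF f] in
      \<open>auto simp: outer_def smult_r_distr smult_commute\<close>)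

lemma outer_gen: "n \<in> carrier M \<Longrightarrow> outer M (free_gen R s) n = single M s n"
  by (rule ext) (auto simp: outer_def free_gen_def single_def)

text \<open>\<open>D\<close> is prescribed by columns: \<open>n\<close> in coordinate
  \<open>s\<close> goes to \<open>n\<close> times the image of the \<open>s\<close>-th basis vector.
  For fixed \<open>n\<close> both sides of the identity with \<open>outer\<close> are linear in
  \<open>f\<close>, so that basis vectors suffice.\<close>

lemma scalar_ext_exists:
  assumes d: "linear_map R (free_module R S) (free_module R T) d"
  obtains D where "scalar_ext R M S T d D"
proof -
  interpret d: linear_map R "free_module R S" "free_module R T" d by (rule d)
  have "linear_map R M (direct_power M T) (outer M (d (free_gen R s)))" if "s \<in> S" for s
    by (rule outer_linear_right[OF d.map_closed[OF R.free_gen_closed[OF that]]])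
  then obtain D where D: "linear_map R (direct_power M S) (direct_power M T) D"
    "\<And>s n. s \<in> S \<Longrightarrow> n \<in> carrier M \<Longrightarrow> D (single M s n) = outer M (d (free_gen R s)) n"
    using direct_power_map_exists[OF direct_power_is_module, of S T "\<lambda>s. outer M (d (free_gen R s))"]
    by blast
  have "D (outer M f n) = outer M (d f) n"
    if f: "f \<in> carrier (free_module R S)" and n: "n \<in> carrier M" for f n
  proof (rule R.free_module_map_eqI[OF _ _ _ f, where P = "direct_power M T"])
    show "linear_map R (free_module R S) (direct_power M T) (\<lambda>f. D (outer M f n))"
      by (rule linear_map_comp[OF outer_linear_left[OF n] D(1)])
    show "linear_map R (free_module R S) (direct_power M T) (\<lambda>f. outer M (d f) n)"
      by (rule linear_map_comp[OF d outer_linear_left[OF n]])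
    show "D (outer M (free_gen R s) n) = outer M (d (free_gen R s)) n" if "s \<in> S" for s
      using D(2)[OF that n] by (simp add: outer_gen[OF n])
  qed
  then show thesis using that d D(1) unfolding scalar_ext_def by blast
qed

lemma powers_in_submodule:
  assumes J: "submodule J R M"
  shows "submodule (powers_in M J S) R (direct_power M S)"
proof -
  interpret D: module R "direct_power M S" by (rule direct_power_is_module)
  have zero: "(\<lambda>s. \<zero>\<^bsub>M\<^esub>) \<in> carrier (direct_power M S)" using D.M.zero_closed by simp
  show ?thesis
  proof (rule D.submoduleI)
    show "powers_in M J S \<subseteq> carrier (direct_power M S)" by (auto simp: powers_in_def)
    show "\<zero>\<^bsub>direct_power M S\<^esub> \<in> powers_in M J S"
      using zero submodule_zero[OF J] by (simp add: powers_in_def)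
    fix u assume u: "u \<in> powers_in M J S"
    then have uS: "u \<in> carrier (direct_power M S)" "\<And>s. u s \<in> J" by (auto simp: powers_in_def)
    have "\<ominus>\<^bsub>direct_power M S\<^esub> u = (\<lambda>s. \<zero>\<^bsub>M\<^esub> \<ominus>\<^bsub>M\<^esub> u s)"
      using direct_power_diff[OF zero uS(1)] uS(1) D.M.minus_eq[of "(\<lambda>s. \<zero>\<^bsub>M\<^esub>)" u]
        D.M.l_zero[OF D.M.a_inv_closed[OF uS(1)]] by simp
    then show "\<ominus>\<^bsub>direct_power M S\<^esub> u \<in> powers_in M J S"
      using uS D.M.a_inv_closed[OF uS(1)] submodule_diff[OF J submodule_zero[OF J]]
      by (simp add: powers_in_def)
    { fix v assume "v \<in> powers_in M J S"
      then have v: "v \<in> carrier (direct_power M S)" "\<And>s. v s \<in> J" by (auto simp: powers_in_def)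
      show "u \<oplus>\<^bsub>direct_power M S\<^esub> v \<in> powers_in M J S"
        using D.M.add.m_closed[OF uS(1) v(1)] submodule_add[OF J uS(2) v(2)]
        by (simp add: powers_in_def) }
    fix a assume "a \<in> carrier R"
    then show "a \<odot>\<^bsub>direct_power M S\<^esub> u \<in> powers_in M J S"
      using D.smult_closed[OF _ uS(1), of a] submodule_smult[OF J _ uS(2), of a]
      by (simp add: powers_in_def)
  qed
qed

lemma powers_in_zero: "powers_in M {\<zero>\<^bsub>M\<^esub>} S = {\<zero>\<^bsub>direct_power M S\<^esub>}"
  by (auto simp: powers_in_def direct_power_carrier)

lemma fg_direct_power:
  assumes "fg_module R M" "finite S"
  shows "fg_module R (direct_power M S)"
proof -
  obtain G where G: "finite G" "G \<subseteq> carrier M" "module_span R M G = carrier M"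
    using assms(1) unfolding fg_module_def by blast
  interpret D: module R "direct_power M S" by (rule direct_power_is_module)
  define E where "E = (\<lambda>(s, g). single M s g) ` (S \<times> G)"
  have E: "finite E" "E \<subseteq> carrier (direct_power M S)"
    using assms(2) G(1,2) unfolding E_def by (auto intro!: single_closed)
  have sub: "submodule (module_span R (direct_power M S) E) R (direct_power M S)"
    by (rule D.span_submodule[OF E(2)])
  have "single M s n \<in> module_span R (direct_power M S) E" if s: "s \<in> S" and n: "n \<in> carrier M" for s n
  proof -
    interpret s: linear_map R M "direct_power M S" "single M s" by (rule single_linear[OF s])
    have "module_span R M G \<subseteq> {n \<in> carrier M. single M s n \<in> module_span R (direct_power M S) E}"
      by (rule span_minimal[OF s.preimage_submodule[OF sub]])
        (use G(2) s D.span_superset[of E] in \<open>auto simp: E_def\<close>)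
    then show ?thesis using n G(3) by blast
  qed
  then have "carrier (direct_power M S) \<subseteq> module_span R (direct_power M S) E"
    using direct_power_mem_submodule[OF _ sub] by (auto simp: subset_iff)
  then have "module_span R (direct_power M S) E = carrier (direct_power M S)"
    using D.submodule_subset[OF sub] by blast
  then show ?thesis unfolding fg_module_def using E D.module_axioms by blast
qed

end

locale scalar_extension = module R M for R (structure) and M (structure) +
  fixes S T d D
  assumes ext: "scalar_ext R M S T d D"
begin

sublocale d: linear_map R "free_module R S" "free_module R T" d
  using ext unfolding scalar_ext_def by blast

sublocale D: linear_map R "direct_power M S" "direct_power M T" D
  using ext unfolding scalar_ext_def by blast

lemma ext_outer:
  "f \<in> carrier (free_module R S) \<Longrightarrow> n \<in> carrier M \<Longrightarrow> D (outer M f n) = outer M (d f) n"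
  using ext unfolding scalar_ext_def by blast

lemma ext_single:
  "s \<in> S \<Longrightarrow> n \<in> carrier M \<Longrightarrow> D (single M s n) = outer M (d (free_gen R s)) n"
  using ext_outer[OF R.free_gen_closed, of s n] by (simp add: outer_gen)

text \<open>The values on single coordinates generate the image, and they are \<open>outer\<close>
  products with the columns of \<open>d\<close>. Containments for \<open>D\<close> thus reduce to
  the columns.\<close>

lemma ext_mem:
  assumes u: "u \<in> carrier (direct_power M S)" and H: "submodule H R (direct_power M T)"
    and "\<And>s. s \<in> S \<Longrightarrow> outer M (d (free_gen R s)) (u s) \<in> H"
  shows "D u \<in> H"
proof -
  have "u \<in> {u \<in> carrier (direct_power M S). D u \<in> H}"
    by (rule direct_power_mem_submodule[OF u D.preimage_submodule[OF H]])
      (use assms(3) direct_power_apply[OF u] ext_single in \<open>auto intro!: single_closed\<close>)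
  then show ?thesis by blast
qed

lemma ext_powers_in:
  assumes J: "submodule J R M" and u: "u \<in> powers_in M J S"
  shows "D u \<in> powers_in M J T"
proof (rule ext_mem[OF _ powers_in_submodule[OF J]])
  show uS: "u \<in> carrier (direct_power M S)" using u by (simp add: powers_in_def)
  fix s assume s: "s \<in> S"
  have dF: "d (free_gen R s) \<in> carrier (free_module R T)" by (rule d.map_closed[OF R.free_gen_closed[OF s]])
  show "outer M (d (free_gen R s)) (u s) \<in> powers_in M J T"
    using outer_closed[OF dF direct_power_apply[OF uS]] submodule_smult[OF J R.free_module_apply[OF dF]] u
    by (auto simp: powers_in_def outer_def)
qed

text \<open>Right exactness in its simplest form: a column of \<open>d\<close> that equals d' f
  contributes the value of \<open>D'\<close> at f tensor n. Hence the image of an extended map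
  depends only on the image of the given one.\<close>

lemma ext_image_subset:
  assumes "scalar_ext R M S' T d' D'"
    and sub: "d ` carrier (free_module R S) \<subseteq> d' ` carrier (free_module R S')"
  shows "D ` carrier (direct_power M S) \<subseteq> D' ` carrier (direct_power M S')"
proof (rule image_subsetI)
  interpret e: scalar_extension R M S' T d' D' by unfold_locales fact
  fix u assume u: "u \<in> carrier (direct_power M S)"
  show "D u \<in> D' ` carrier (direct_power M S')"
  proof (rule ext_mem[OF u e.D.image_submodule[OF e.D.M.carrier_is_submodule]])
    fix s assume "s \<in> S"
    then have "d (free_gen R s) \<in> d' ` carrier (free_module R S')"
      using sub imageI[OF R.free_gen_closed, of s S d] by blast
    then obtain f where f: "f \<in> carrier (free_module R S')" "d (free_gen R s) = d' f" by blast
    then have "outer M (d (free_gen R s)) (u s) = D' (outer M f (u s))"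
      using e.ext_outer[OF f(1) direct_power_apply[OF u]] by simp
    then show "outer M (d (free_gen R s)) (u s) \<in> D' ` carrier (direct_power M S')"
      using outer_closed[OF f(1) direct_power_apply[OF u]] by blast
  qed
qed

end

text \<open>Exactness at (M/J)^S of the complex that \<open>D\<close> and \<open>E\<close> induce
  over M/J. Only that cycles are boundaries is recorded; the converse comes from the vanishing of
  the composites.\<close>

definition exact_mod :: "('r, 'm, 'c) module_scheme \<Rightarrow> 'b set \<Rightarrow> 'e set \<Rightarrow>
    (('b \<Rightarrow> 'm) \<Rightarrow> 'e \<Rightarrow> 'm) \<Rightarrow> (('e \<Rightarrow> 'm) \<Rightarrow> 'b \<Rightarrow> 'm) \<Rightarrow> 'm set \<Rightarrow> bool"
  where "exact_mod M S T D E J \<longleftrightarrow> (\<forall>u\<in>carrier (direct_power M S). D u \<in> powers_in M J T \<longrightarrow>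
    (\<exists>v\<in>carrier (direct_power M T). u \<ominus>\<^bsub>direct_power M S\<^esub> E v \<in> powers_in M J S))"

text \<open>The data are symmetric in the two maps, so every consequence for \<open>D\<close> also
  holds for \<open>E\<close> after exchanging \<open>S\<close> with \<open>T\<close>.\<close>

locale periodic_pair = module R M for R (structure) and M (structure) +
  fixes S T d D e E
  assumes extD: "scalar_ext R M S T d D" and extE: "scalar_ext R M T S e E"
    and finS: "finite S" and finT: "finite T"
    and DE: "\<And>v. v \<in> carrier (direct_power M T) \<Longrightarrow> D (E v) = \<zero>\<^bsub>direct_power M T\<^esub>"
    and ED: "\<And>u. u \<in> carrier (direct_power M S) \<Longrightarrow> E (D u) = \<zero>\<^bsub>direct_power M S\<^esub>"
begin

sublocale D: scalar_extension R M S T d D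
  by unfold_locales (rule extD)

sublocale E: scalar_extension R M T S e E
  by unfold_locales (rule extE)

abbreviation "MS \<equiv> direct_power M S"
abbreviation "MT \<equiv> direct_power M T"

lemma powers_in_adjoin:
  assumes J: "submodule J R M" and x: "x \<in> carrier R" and u: "u \<in> powers_in M (adjoin J x) T"
  obtains j w where "j \<in> powers_in M J T" "w \<in> carrier MT" "u = j \<oplus>\<^bsub>MT\<^esub> x \<odot>\<^bsub>MT\<^esub> w"
proof -
  have u': "u \<in> carrier MT" "\<And>t. u t \<in> adjoin J x" using u by (auto simp: powers_in_def)
  have "\<forall>t. \<exists>k w. k \<in> J \<and> w \<in> carrier M \<and> u t = k \<oplus>\<^bsub>M\<^esub> x \<odot>\<^bsub>M\<^esub> w"
    using u'(2) unfolding adjoin_def by blast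
  then obtain k w where kw: "\<And>t. k t \<in> J" "\<And>t. w t \<in> carrier M" "\<And>t. u t = k t \<oplus>\<^bsub>M\<^esub> x \<odot>\<^bsub>M\<^esub> w t"
    by metis
  \<comment> \<open>Elements of the direct power vanish outside \<open>T\<close>, and the
    decompositions chosen there need not be trivial.\<close>
  define j' where "j' t = (if t \<in> T then k t else \<zero>\<^bsub>M\<^esub>)" for t
  define w' where "w' t = (if t \<in> T then w t else \<zero>\<^bsub>M\<^esub>)" for t
  have "j' \<in> powers_in M J T"
    using kw submodule_mem[OF J] submodule_zero[OF J]
    by (auto simp: powers_in_def direct_power_carrier_finite[OF finT] j'_def)
  moreover have "w' \<in> carrier MT"
    using kw by (auto simp: direct_power_carrier_finite[OF finT] w'_def)
  moreover have "u = j' \<oplus>\<^bsub>MT\<^esub> x \<odot>\<^bsub>MT\<^esub> w'"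
  proof
    fix t
    show "u t = (j' \<oplus>\<^bsub>MT\<^esub> x \<odot>\<^bsub>MT\<^esub> w') t"
      using kw(3)[of t] x u'(1) by (auto simp: j'_def w'_def direct_power_carrier)
  qed
  ultimately show thesis by (rule that)
qed

lemma adjoin_powers_in:
  assumes J: "submodule J R M" and x: "x \<in> carrier R"
    and j: "j \<in> powers_in M J T" and w: "w \<in> carrier MT"
  shows "j \<oplus>\<^bsub>MT\<^esub> x \<odot>\<^bsub>MT\<^esub> w \<in> powers_in M (adjoin J x) T"
proof -
  have "j \<oplus>\<^bsub>MT\<^esub> x \<odot>\<^bsub>MT\<^esub> w \<in> carrier MT"
    by (rule D.D.P.M.add.m_closed) (use j w x in \<open>auto simp: powers_in_def simp del: direct_power_simps\<close>)
  moreover have "j t \<oplus>\<^bsub>M\<^esub> x \<odot>\<^bsub>M\<^esub> w t \<in> adjoin J x" for t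
    using j w direct_power_apply[OF w] unfolding adjoin_def powers_in_def by blast
  ultimately show ?thesis by (simp add: powers_in_def)
qed

text \<open>\<open>E\<close> kills D u, so x times E w lies in J^S, and regularity of
  \<open>x\<close> cancels the factor. This is the connecting map of the homology sequence for
  multiplication by \<open>x\<close>.\<close>

lemma E_vanish_mod:
  assumes J: "submodule J R M" and x: "x \<in> carrier R" "regular_mod J x"
    and j: "j \<in> powers_in M J T" and w: "w \<in> carrier MT" and u: "u \<in> carrier MS"
    and eq: "D u = j \<oplus>\<^bsub>MT\<^esub> x \<odot>\<^bsub>MT\<^esub> w"
  shows "E w \<in> powers_in M J S"
proof -
  have jT: "j \<in> carrier MT" using j by (simp add: powers_in_def)
  have Ew: "E w \<in> carrier MS" using w by blast
  have EjJ: "E j \<in> powers_in M J S" by (rule E.ext_powers_in[OF J j])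
  have "\<zero>\<^bsub>MS\<^esub> = E j \<oplus>\<^bsub>MS\<^esub> x \<odot>\<^bsub>MS\<^esub> E w"
    using ED[OF u] eq jT w x by (simp add: E.D.map_add E.D.map_smult del: direct_power_simps)
  then have *: "E j s \<oplus>\<^bsub>M\<^esub> x \<odot>\<^bsub>M\<^esub> E w s = \<zero>\<^bsub>M\<^esub>" for s
    using fun_cong[of "\<lambda>s. \<zero>\<^bsub>M\<^esub>" "\<lambda>s. E j s \<oplus>\<^bsub>M\<^esub> x \<odot>\<^bsub>M\<^esub> E w s" s] by simp
  have "E w s \<in> J" for s
  proof -
    have "E j s \<in> J" using EjJ by (simp add: powers_in_def)
    moreover have "E j s \<oplus>\<^bsub>M\<^esub> x \<odot>\<^bsub>M\<^esub> E w s \<in> J" using * submodule_zero[OF J] by simp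
    moreover have "x \<odot>\<^bsub>M\<^esub> E w s \<in> carrier M" using x direct_power_apply[OF Ew] by blast
    ultimately have "x \<odot>\<^bsub>M\<^esub> E w s \<in> J" by (metis submodule_cancel[OF J])
    then show ?thesis by (rule regular_modD[OF x(2) direct_power_apply[OF Ew]])
  qed
  then show ?thesis using Ew by (simp add: powers_in_def)
qed

end

section \<open>The depth of the cokernel in a periodic complex\<close>

lemma (in module) diff_diff_add:
  assumes "u \<in> carrier M" "a \<in> carrier M" "b \<in> carrier M"
  shows "((u \<ominus>\<^bsub>M\<^esub> a) \<ominus>\<^bsub>M\<^esub> b) \<oplus>\<^bsub>M\<^esub> a = u \<ominus>\<^bsub>M\<^esub> b"
proof -
  have "((u \<ominus>\<^bsub>M\<^esub> a) \<ominus>\<^bsub>M\<^esub> b) \<oplus>\<^bsub>M\<^esub> a = (u \<ominus>\<^bsub>M\<^esub> b) \<oplus>\<^bsub>M\<^esub> (\<ominus>\<^bsub>M\<^esub> a \<oplus>\<^bsub>M\<^esub> a)"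
    using assms by (simp only: M.minus_eq M.a_ac M.a_inv_closed M.add.m_closed)
  then show ?thesis using assms by (simp add: M.l_neg)
qed

context periodic_pair
begin

lemma swapped: "periodic_pair R M T S e E d D"
  by unfold_locales (use extD extE finS finT DE ED in auto)

text \<open>Multiplication by \<open>x\<close> gives a short exact sequence of periodic complexes
  whose first two terms are exact, and so the third is. The connecting map leads from one spot of
  the complex to the other, which is why exactness at both enters.\<close>

lemma exact_mod_adjoin:
  assumes J: "submodule J R M" and x: "x \<in> carrier R" "regular_mod J x"
    and ex: "exact_mod M S T D E J" "exact_mod M T S E D J"
  shows "exact_mod M S T D E (adjoin J x)"
  unfolding exact_mod_def
proof (intro ballI impI)
  fix u assume u: "u \<in> carrier MS" and Du: "D u \<in> powers_in M (adjoin J x) T"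
  obtain j w where j: "j \<in> powers_in M J T" and w: "w \<in> carrier MT" and eq: "D u = j \<oplus>\<^bsub>MT\<^esub> x \<odot>\<^bsub>MT\<^esub> w"
    using powers_in_adjoin[OF J x(1) Du] .
  have jT: "j \<in> carrier MT" using j by (simp add: powers_in_def)
  have "E w \<in> powers_in M J S" by (rule E_vanish_mod[OF J x j w u eq])
  then obtain v where v: "v \<in> carrier MS" "w \<ominus>\<^bsub>MT\<^esub> D v \<in> powers_in M J T"
    using ex(2) w unfolding exact_mod_def by blast
  \<comment> \<open>Modulo \<open>J\<close>, D u is x w and \<open>w\<close> is D v, so the
    corrected element is a cycle modulo \<open>J\<close> itself and not only modulo J + xM.\<close>
  define u' where "u' = u \<ominus>\<^bsub>MS\<^esub> x \<odot>\<^bsub>MS\<^esub> v"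
  have xv: "x \<odot>\<^bsub>MS\<^esub> v \<in> carrier MS" by (rule D.D.M.smult_closed[OF x(1) v(1)])
  have u': "u' \<in> carrier MS" unfolding u'_def using u xv by (rule D.D.M.M.minus_closed)
  have Dv: "D v \<in> carrier MT" using v by blast
  have "D u' = D u \<ominus>\<^bsub>MT\<^esub> x \<odot>\<^bsub>MT\<^esub> D v"
    unfolding u'_def D.D.map_diff[OF u xv] D.D.map_smult[OF x(1) v(1)] ..
  also have "\<dots> = j \<oplus>\<^bsub>MT\<^esub> x \<odot>\<^bsub>MT\<^esub> (w \<ominus>\<^bsub>MT\<^esub> D v)"
    unfolding eq using x(1) jT w Dv
    by (simp add: D.D.P.M.minus_eq D.D.P.smult_r_distr D.D.P.smult_r_minus D.D.P.M.a_assoc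
        del: direct_power_simps)
  also have "\<dots> \<in> powers_in M J T"
    by (rule D.D.P.submodule_add[OF powers_in_submodule[OF J] j
        D.D.P.submodule_smult[OF powers_in_submodule[OF J] x(1) v(2)]])
  finally obtain y where y: "y \<in> carrier MT" "u' \<ominus>\<^bsub>MS\<^esub> E y \<in> powers_in M J S"
    using ex(1) u' unfolding exact_mod_def by blast
  interpret sw: periodic_pair R M T S e E d D by (rule swapped)
  have "u \<ominus>\<^bsub>MS\<^esub> E y = (u' \<ominus>\<^bsub>MS\<^esub> E y) \<oplus>\<^bsub>MS\<^esub> x \<odot>\<^bsub>MS\<^esub> v"
    unfolding u'_def by (rule D.D.M.diff_diff_add[OF u xv, symmetric]) (use y in blast)
  also have "\<dots> \<in> powers_in M (adjoin J x) S"
    by (rule sw.adjoin_powers_in[OF J x(1) y(2) v(1)])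
  finally show "\<exists>y\<in>carrier MT. u \<ominus>\<^bsub>MS\<^esub> E y \<in> powers_in M (adjoin J x) S"
    using y(1) by blast
qed

text \<open>M^T modulo this submodule is the cokernel of \<open>D\<close> over M/J.\<close>

definition image_mod :: "_ set \<Rightarrow> _ set"
  where "image_mod J = {D u \<oplus>\<^bsub>MT\<^esub> j | u j. u \<in> carrier MS \<and> j \<in> powers_in M J T}"

lemma image_mod_eq:
  "image_mod J = {k \<oplus>\<^bsub>MT\<^esub> l | k l. k \<in> D ` carrier MS \<and> l \<in> powers_in M J T}"
  unfolding image_mod_def by blast

lemma image_mod_submodule: "submodule J R M \<Longrightarrow> submodule (image_mod J) R MT"
  unfolding image_mod_eq
  by (rule D.D.P.submodule_sum[OF D.D.image_submodule[OF D.D.M.carrier_is_submodule] powers_in_submodule])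

lemma image_mod_zero: "image_mod {\<zero>\<^bsub>M\<^esub>} = D ` carrier MS"
proof -
  have "D u \<oplus>\<^bsub>MT\<^esub> \<zero>\<^bsub>MT\<^esub> = D u" if "u \<in> carrier MS" for u
    using that by (intro D.D.P.M.r_zero) auto
  then have "(\<lambda>u. D u \<oplus>\<^bsub>MT\<^esub> \<zero>\<^bsub>MT\<^esub>) ` carrier MS = D ` carrier MS" by (rule image_cong[OF refl])
  then show ?thesis unfolding image_mod_def powers_in_zero by blast
qed

lemma image_modI:
  assumes "v \<in> carrier MT" "u \<in> carrier MS" "v \<ominus>\<^bsub>MT\<^esub> D u \<in> powers_in M J T"
  shows "v \<in> image_mod J"
proof -
  have "D u \<in> carrier MT" using assms by blast
  then have "v = D u \<oplus>\<^bsub>MT\<^esub> (v \<ominus>\<^bsub>MT\<^esub> D u)"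
    using assms(1) by (simp add: D.D.P.M.minus_eq D.D.P.M.a_ac D.D.P.M.r_neg2 D.D.P.M.r_neg
        D.D.P.M.l_neg del: direct_power_simps)
  then show ?thesis unfolding image_mod_def using assms by blast
qed

text \<open>Exactness at \<open>T\<close> means that \<open>E\<close> embeds the cokernel over M/J
  into (M/J)^S. Questions about the cokernel are thereby answered coordinatewise in M/J.\<close>

lemma image_mod_iff:
  assumes J: "submodule J R M" and ex: "exact_mod M T S E D J" and v: "v \<in> carrier MT"
  shows "v \<in> image_mod J \<longleftrightarrow> E v \<in> powers_in M J S"
proof
  assume "v \<in> image_mod J"
  then obtain u j where u: "u \<in> carrier MS" "j \<in> powers_in M J T" "v = D u \<oplus>\<^bsub>MT\<^esub> j"
    unfolding image_mod_def by blast
  have "j \<in> carrier MT" using u by (simp add: powers_in_def)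
  then have "E v = \<zero>\<^bsub>MS\<^esub> \<oplus>\<^bsub>MS\<^esub> E j"
    unfolding u(3) using u(1) by (simp add: E.D.map_add ED del: direct_power_simps)
  also have "\<dots> = E j" using \<open>j \<in> carrier MT\<close> by (intro D.D.M.M.l_zero) auto
  finally show "E v \<in> powers_in M J S" using E.ext_powers_in[OF J u(2)] by simp
next
  assume "E v \<in> powers_in M J S"
  then obtain u where "u \<in> carrier MS" "v \<ominus>\<^bsub>MT\<^esub> D u \<in> powers_in M J T"
    using ex v unfolding exact_mod_def by blast
  then show "v \<in> image_mod J" using image_modI[OF v] by blast
qed

lemma image_mod_regular:
  assumes J: "submodule J R M" and ex: "exact_mod M T S E D J"
    and x: "x \<in> carrier R" "regular_mod J x"
  shows "D.D.P.regular_mod (image_mod J) x"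
  unfolding D.D.P.regular_mod_def
proof (intro ballI impI)
  fix v assume v: "v \<in> carrier MT" and "x \<odot>\<^bsub>MT\<^esub> v \<in> image_mod J"
  then have "E (x \<odot>\<^bsub>MT\<^esub> v) \<in> powers_in M J S"
    using image_mod_iff[OF J ex D.D.P.smult_closed[OF x(1) v]] by blast
  then have "x \<odot>\<^bsub>MS\<^esub> E v \<in> powers_in M J S" using E.D.map_smult[OF x(1) v] by simp
  moreover have Ev: "E v \<in> carrier MS" using v by blast
  ultimately have "E v \<in> powers_in M J S"
    using regular_modD[OF x(2) direct_power_apply[OF Ev]] by (simp add: powers_in_def)
  then show "v \<in> image_mod J" using image_mod_iff[OF J ex v] by blast
qed

lemma image_mod_adjoin:
  assumes J: "submodule J R M" and x: "x \<in> carrier R"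
  shows "D.D.P.adjoin (image_mod J) x = image_mod (adjoin J x)"
proof (rule equalityI; rule subsetI)
  fix v assume "v \<in> D.D.P.adjoin (image_mod J) x"
  then obtain u j w where u: "u \<in> carrier MS" "j \<in> powers_in M J T" "w \<in> carrier MT"
    "v = (D u \<oplus>\<^bsub>MT\<^esub> j) \<oplus>\<^bsub>MT\<^esub> x \<odot>\<^bsub>MT\<^esub> w"
    unfolding D.D.P.adjoin_def image_mod_def by blast
  then have "v = D u \<oplus>\<^bsub>MT\<^esub> (j \<oplus>\<^bsub>MT\<^esub> x \<odot>\<^bsub>MT\<^esub> w)"
    using x by (simp add: powers_in_def D.D.P.M.a_assoc del: direct_power_simps)
  then show "v \<in> image_mod (adjoin J x)"
    using adjoin_powers_in[OF J x u(2,3)] u(1) unfolding image_mod_def by blast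
next
  fix v assume "v \<in> image_mod (adjoin J x)"
  then obtain u l where u: "u \<in> carrier MS" "l \<in> powers_in M (adjoin J x) T" "v = D u \<oplus>\<^bsub>MT\<^esub> l"
    unfolding image_mod_def by blast
  obtain j w where j: "j \<in> powers_in M J T" "w \<in> carrier MT" "l = j \<oplus>\<^bsub>MT\<^esub> x \<odot>\<^bsub>MT\<^esub> w"
    using powers_in_adjoin[OF J x u(2)] .
  then have "v = (D u \<oplus>\<^bsub>MT\<^esub> j) \<oplus>\<^bsub>MT\<^esub> x \<odot>\<^bsub>MT\<^esub> w"
    unfolding u(3) j(3) using u(1) x by (simp add: powers_in_def D.D.P.M.a_assoc del: direct_power_simps)
  then show "v \<in> D.D.P.adjoin (image_mod J) x"
    using u(1) j unfolding D.D.P.adjoin_def image_mod_def by blast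
qed

text \<open>The conclusions are proved together: passing over a member of the sequence requires
  exactness modulo the members before it, and exactness is in turn carried along by
  \<open>exact_mod_adjoin\<close>.\<close>

lemma image_mod_regular_seq:
  assumes "submodule J R M" "exact_mod M S T D E J" "exact_mod M T S E D J"
    and "set xs \<subseteq> carrier R" "regular_seq J xs"
  shows "D.D.P.regular_seq (image_mod J) xs \<and>
    D.D.P.adjoins (image_mod J) xs = image_mod (adjoins J xs) \<and>
    exact_mod M S T D E (adjoins J xs) \<and> exact_mod M T S E D (adjoins J xs)"
  using assms
proof (induction xs arbitrary: J)
  case (Cons x xs)
  interpret sw: periodic_pair R M T S e E d D by (rule swapped)
  have x: "x \<in> carrier R" "regular_mod J x" and xs: "set xs \<subseteq> carrier R" "regular_seq (adjoin J x) xs"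
    using Cons.prems by auto
  note J = Cons.prems(1)
  have IH: "D.D.P.regular_seq (image_mod (adjoin J x)) xs \<and>
    D.D.P.adjoins (image_mod (adjoin J x)) xs = image_mod (adjoins (adjoin J x) xs) \<and>
    exact_mod M S T D E (adjoins (adjoin J x) xs) \<and> exact_mod M T S E D (adjoins (adjoin J x) xs)"
    by (rule Cons.IH[OF adjoin_submodule[OF J x(1)] exact_mod_adjoin[OF J x Cons.prems(2,3)]
          sw.exact_mod_adjoin[OF J x Cons.prems(3,2)] xs])
  then show ?case
    using image_mod_regular[OF J Cons.prems(3) x] by (simp add: image_mod_adjoin[OF J x(1)])
qed auto

end

text \<open>An index in \<open>S\<close> provides the coordinate in which a socle element is placed,
  and an index in \<open>T\<close> keeps the cokernel from vanishing when \<open>M\<close> is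
  nonzero.\<close>

locale minimal_periodic_pair = periodic_pair R M S T d D e E + fg_local_module R M
  for R (structure) and M (structure) and S T d D e E +
  assumes minimal: "\<And>f t. f \<in> carrier (free_module R S) \<Longrightarrow> d f t \<in> max_ideal R"
    and exact: "exact_mod M S T D E {\<zero>\<^bsub>M\<^esub>}" "exact_mod M T S E D {\<zero>\<^bsub>M\<^esub>}"
    and nonempty: "S \<noteq> {}" "T \<noteq> {}"
begin

sublocale MT: fg_local_module R MT
  by unfold_locales (use local_ring fg_direct_power[OF fg finT] in auto)

lemma image_mod_socle:
  assumes J: "submodule J R M" and ex: "exact_mod M S T D E J" "exact_mod M T S E D J"
    and soc: "has_socle J"
  shows "MT.has_socle (image_mod J)"
proof -
  obtain n where n: "n \<in> carrier M" "n \<notin> J" and ann: "\<And>r. r \<in> max_ideal R \<Longrightarrow> r \<odot>\<^bsub>M\<^esub> n \<in> J"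
    using soc unfolding has_socle_def by blast
  obtain s where s: "s \<in> S" using nonempty by blast
  have sn: "single M s n \<in> carrier MS" by (rule single_closed[OF s n(1)])
  have gen: "free_gen R s \<in> carrier (free_module R S)" by (rule R.free_gen_closed[OF s])
  \<comment> \<open>Every entry of the \<open>s\<close>-th column of \<open>d\<close> lies in the
    maximal ideal and so sends \<open>n\<close> into \<open>J\<close>.\<close>
  have "D (single M s n) \<in> powers_in M J T"
    using D.D.map_closed[OF sn] ann minimal[OF gen]
    unfolding D.ext_single[OF s n(1)] by (simp add: powers_in_def outer_def)
  then obtain v where v: "v \<in> carrier MT" "single M s n \<ominus>\<^bsub>MS\<^esub> E v \<in> powers_in M J S"
    using ex(1) sn unfolding exact_mod_def by blast
  have Ev: "E v \<in> carrier MS" using v by blast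
  have diff: "single M s n t \<ominus>\<^bsub>M\<^esub> E v t \<in> J" for t
    using v(2) unfolding direct_power_diff[OF sn Ev] by (simp add: powers_in_def)
  have "v \<notin> image_mod J"
  proof
    assume "v \<in> image_mod J"
    then have "E v \<in> powers_in M J S" using image_mod_iff[OF J ex(2) v(1)] by blast
    then have "E v s \<in> J" by (simp add: powers_in_def)
    then have "single M s n s \<in> J"
      by (rule submodule_diff_cancel[OF J _ direct_power_apply[OF sn] diff])
    then show False using n by (simp add: single_def)
  qed
  \<comment> \<open>As \<open>E\<close> is injective on the cokernel, it suffices that r E v lies in
    J^S, and E v agrees modulo \<open>J\<close> with the unit vector times \<open>n\<close>.\<close>
  moreover have "r \<odot>\<^bsub>MT\<^esub> v \<in> image_mod J" if r: "r \<in> max_ideal R" for r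
  proof -
    have rR: "r \<in> carrier R" using r by simp
    have "r \<odot>\<^bsub>M\<^esub> E v t \<in> J" for t
    proof -
      have "r \<odot>\<^bsub>M\<^esub> single M s n t \<in> J"
        using ann[OF r] rR submodule_zero[OF J] by (simp add: single_def)
      moreover have "r \<odot>\<^bsub>M\<^esub> single M s n t \<ominus>\<^bsub>M\<^esub> r \<odot>\<^bsub>M\<^esub> E v t \<in> J"
        using submodule_smult[OF J rR diff[of t]] rR direct_power_apply[OF sn, of t] direct_power_apply[OF Ev, of t]
        by (simp add: M.minus_eq smult_r_distr smult_r_minus)
      ultimately have "\<ominus>\<^bsub>M\<^esub> (r \<odot>\<^bsub>M\<^esub> E v t) \<in> J"
        using rR direct_power_apply[OF Ev, of t] unfolding M.minus_eq
        by (metis submodule_cancel[OF J] M.a_inv_closed smult_closed)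
      then have "\<ominus>\<^bsub>M\<^esub> (\<ominus>\<^bsub>M\<^esub> (r \<odot>\<^bsub>M\<^esub> E v t)) \<in> J" by (rule submodule_neg[OF J])
      then show ?thesis using rR direct_power_apply[OF Ev, of t] by (simp add: M.minus_minus)
    qed
    then have "E (r \<odot>\<^bsub>MT\<^esub> v) \<in> powers_in M J S"
      using E.D.map_closed[OF D.D.P.smult_closed[OF rR v(1)]] E.D.map_smult[OF rR v(1)]
      by (simp add: powers_in_def)
    then show ?thesis using image_mod_iff[OF J ex(2) D.D.P.smult_closed[OF rR v(1)]] by blast
  qed
  ultimately show ?thesis unfolding MT.has_socle_def using v(1) by blast
qed

text \<open>Nakayama's lemma gives a proper \<open>H\<close> that contains \<open>J\<close> and all
  multiples by the maximal ideal. The image of \<open>D\<close> lies in H^T by minimality, and so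
  does J^T, whereas a coordinate vector with its entry outside \<open>H\<close> does not.\<close>

lemma image_mod_proper:
  assumes J: "submodule J R M" "J \<noteq> carrier M"
  shows "image_mod J \<noteq> carrier MT"
proof -
  obtain H where H: "submodule H R M" "J \<subseteq> H" "H \<noteq> carrier M"
    "\<forall>x\<in>max_ideal R. \<forall>u\<in>carrier M. x \<odot>\<^bsub>M\<^esub> u \<in> H"
    using nakayama[OF J] by blast
  obtain n where n: "n \<in> carrier M" "n \<notin> H" using H submodule_subset[OF H(1)] by blast
  obtain t where t: "t \<in> T" using nonempty by blast
  note HT = powers_in_submodule[OF H(1), of T]
  have "D u \<in> powers_in M H T" if u: "u \<in> carrier MS" for u
  proof (rule D.ext_mem[OF u HT])
    fix s assume s: "s \<in> S"
    have gen: "free_gen R s \<in> carrier (free_module R S)" by (rule R.free_gen_closed[OF s])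
    show "outer M (d (free_gen R s)) (u s) \<in> powers_in M H T"
      using outer_closed[OF D.d.map_closed[OF gen] direct_power_apply[OF u]] H(4) minimal[OF gen]
        direct_power_apply[OF u]
      by (simp add: powers_in_def outer_def)
  qed
  moreover have "powers_in M J T \<subseteq> powers_in M H T" using H(2) by (auto simp: powers_in_def)
  ultimately have "image_mod J \<subseteq> powers_in M H T"
    using D.D.P.submodule_add[OF HT] unfolding image_mod_def by blast
  moreover have "single M t n \<notin> powers_in M H T"
  proof
    assume "single M t n \<in> powers_in M H T"
    then have "single M t n t \<in> H" unfolding powers_in_def by blast
    then show False using n by (simp add: single_def)
  qed
  ultimately show ?thesis using single_closed[OF t n(1)] by blast
qed

lemma regular_sequence_transfer:
  assumes \<theta>: "linear_map R MT P \<theta>" and surj: "\<theta> ` carrier MT = carrier P"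
    and ker: "{v \<in> carrier MT. \<theta> v = \<zero>\<^bsub>P\<^esub>} = D ` carrier MS"
  shows "regular_sequence R P xs \<longleftrightarrow> set xs \<subseteq> carrier R \<and>
    D.D.P.regular_seq (image_mod {\<zero>\<^bsub>M\<^esub>}) xs \<and> D.D.P.adjoins (image_mod {\<zero>\<^bsub>M\<^esub>}) xs \<noteq> carrier MT"
proof -
  interpret \<theta>: linear_map R MT P \<theta> by (rule \<theta>)
  have "\<theta>.preimage {\<zero>\<^bsub>P\<^esub>} = image_mod {\<zero>\<^bsub>M\<^esub>}"
    unfolding \<theta>.preimage_def image_mod_zero ker[symmetric] by blast
  then show ?thesis using \<theta>.regular_sequence_preimage_iff[OF surj, of xs] by simp
qed

lemma max_ideal_subset: "max_ideal R \<subseteq> carrier R"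
  using max_ideal_carrier by blast

text \<open>Depth is a supremum that is not yet known to be finite, so a bound on the lengths has to
  be supplied. If the last quotient of a longest sequence had no socle, a regular element would
  prolong the sequence, and \<open>adjoin_proper\<close> would keep the quotient nonzero.\<close>

lemma exists_longest_regular:
  assumes nz: "{\<zero>\<^bsub>M\<^esub>} \<noteq> carrier M"
    and bound: "\<And>xs. set xs \<subseteq> max_ideal R \<Longrightarrow> regular_seq {\<zero>\<^bsub>M\<^esub>} xs \<Longrightarrow>
      adjoins {\<zero>\<^bsub>M\<^esub>} xs \<noteq> carrier M \<Longrightarrow> length xs < b"
  obtains xs where "set xs \<subseteq> max_ideal R" "regular_seq {\<zero>\<^bsub>M\<^esub>} xs"
    "adjoins {\<zero>\<^bsub>M\<^esub>} xs \<noteq> carrier M" "has_socle (adjoins {\<zero>\<^bsub>M\<^esub>} xs)"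
proof -
  define P where "P n \<longleftrightarrow> (\<exists>xs. length xs = n \<and> set xs \<subseteq> max_ideal R \<and> regular_seq {\<zero>\<^bsub>M\<^esub>} xs \<and>
    adjoins {\<zero>\<^bsub>M\<^esub>} xs \<noteq> carrier M)" for n
  have "P 0" unfolding P_def using nz by simp
  moreover have "\<forall>n. P n \<longrightarrow> n \<le> b"
  proof (intro allI impI)
    fix n assume "P n"
    then obtain xs where xs: "length xs = n" "set xs \<subseteq> max_ideal R" "regular_seq {\<zero>\<^bsub>M\<^esub>} xs"
      "adjoins {\<zero>\<^bsub>M\<^esub>} xs \<noteq> carrier M" unfolding P_def by blast
    then show "n \<le> b" using bound[OF xs(2-4)] by simp
  qed
  ultimately have "\<exists>n. P n \<and> (\<forall>m. P m \<longrightarrow> m \<le> n)"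
    by (rule Nat.ex_has_greatest_nat)
  then obtain n where n: "P n" "\<forall>m. P m \<longrightarrow> m \<le> n" by blast
  then obtain xs where xs: "length xs = n" "set xs \<subseteq> max_ideal R" "regular_seq {\<zero>\<^bsub>M\<^esub>} xs"
    "adjoins {\<zero>\<^bsub>M\<^esub>} xs \<noteq> carrier M" unfolding P_def by blast
  have sub: "submodule (adjoins {\<zero>\<^bsub>M\<^esub>} xs) R M"
    using adjoins_submodule[OF zero_submodule] xs(2) max_ideal_subset by blast
  have "has_socle (adjoins {\<zero>\<^bsub>M\<^esub>} xs)"
  proof (rule ccontr)
    assume "\<not> has_socle (adjoins {\<zero>\<^bsub>M\<^esub>} xs)"
    then obtain z where z: "z \<in> max_ideal R" "regular_mod (adjoins {\<zero>\<^bsub>M\<^esub>} xs) z"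
      using exists_common_regular[of "{adjoins {\<zero>\<^bsub>M\<^esub>} xs}"] sub by auto
    have "P (Suc n)"
      unfolding P_def using xs z adjoin_proper[OF sub xs(4) z(1)]
      by (intro exI[of _ "xs @ [z]"]) (simp add: regular_seq_append)
    then show False using n(2) by fastforce
  qed
  then show thesis using that xs by blast
qed

text \<open>Sequences regular on \<open>M\<close> are regular on \<open>P\<close>, which is one
  inequality. For the other, a sequence \<open>ys\<close> on \<open>P\<close> longer than the depth
  of \<open>M\<close> bounds the lengths on \<open>M\<close>. A longest sequence on \<open>M\<close>
  is maximal on \<open>P\<close> too, so \<open>ys\<close> cannot exceed it, a
  contradiction.\<close>

lemma depth_cokernel:
  assumes \<theta>: "linear_map R MT P \<theta>" and surj: "\<theta> ` carrier MT = carrier P"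
    and ker: "{v \<in> carrier MT. \<theta> v = \<zero>\<^bsub>P\<^esub>} = D ` carrier MS"
  shows "depth R P = depth R M"
proof (cases "zero_module M")
  case True
  interpret \<theta>: linear_map R MT P \<theta> by (rule \<theta>)
  have "u = \<zero>\<^bsub>MT\<^esub>" if "u \<in> carrier MT" for u
    using that True unfolding zero_module_def direct_power_carrier by auto
  then have "carrier MT = {\<zero>\<^bsub>MT\<^esub>}" using D.D.P.M.zero_closed by blast
  then have "carrier P = {\<zero>\<^bsub>P\<^esub>}" using surj \<theta>.map_zero by (simp del: direct_power_simps)
  then have "zero_module P" unfolding zero_module_def .
  then show ?thesis using True by (simp add: depth_def)
next
  case False
  then have nz: "{\<zero>\<^bsub>M\<^esub>} \<noteq> carrier M" unfolding zero_module_def by blast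
  interpret \<theta>: linear_map R MT P \<theta> by (rule \<theta>)
  note transfer = regular_sequence_transfer[OF \<theta> surj ker]
  have nzP: "\<not> zero_module P"
  proof
    assume "zero_module P"
    then have "{v \<in> carrier MT. \<theta> v = \<zero>\<^bsub>P\<^esub>} = carrier MT"
      using \<theta>.map_closed unfolding zero_module_def by blast
    then show False using image_mod_proper[OF zero_submodule nz] unfolding image_mod_zero ker by simp
  qed
  note seq = image_mod_regular_seq[OF zero_submodule exact]
  have regP: "regular_sequence R P xs" if xs: "regular_sequence R M xs" for xs
  proof -
    have *: "set xs \<subseteq> carrier R" "regular_seq {\<zero>\<^bsub>M\<^esub>} xs" "adjoins {\<zero>\<^bsub>M\<^esub>} xs \<noteq> carrier M"
      using xs unfolding regular_sequence_iff by auto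
    show ?thesis
      unfolding transfer
      using seq[OF *(1,2)] image_mod_proper[OF adjoins_submodule[OF zero_submodule *(1)] *(3)] *(1)
      by auto
  qed
  have "depth R P \<le> depth R M"
  proof -
    have "enat (length ys) \<le> depth R M"
      if ys: "regular_sequence R P ys" "set ys \<subseteq> max_ideal R" for ys
    proof (rule ccontr)
      assume neg: "\<not> enat (length ys) \<le> depth R M"
      have small: "length xs < length ys"
        if xs: "set xs \<subseteq> max_ideal R" "regular_seq {\<zero>\<^bsub>M\<^esub>} xs" "adjoins {\<zero>\<^bsub>M\<^esub>} xs \<noteq> carrier M" for xs
      proof -
        have "regular_sequence R M xs"
          unfolding regular_sequence_iff using xs max_ideal_subset by blast
        then have "enat (length xs) \<le> depth R M"
          unfolding depth_def using False xs(1) by (auto intro!: SUP_upper)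
        then have "enat (length xs) < enat (length ys)" using neg by (meson le_less_trans not_le)
        then show ?thesis by simp
      qed
      obtain xs where xs: "set xs \<subseteq> max_ideal R" "regular_seq {\<zero>\<^bsub>M\<^esub>} xs"
        "adjoins {\<zero>\<^bsub>M\<^esub>} xs \<noteq> carrier M" "has_socle (adjoins {\<zero>\<^bsub>M\<^esub>} xs)"
        using exists_longest_regular[OF nz small] by blast
      have xsR: "set xs \<subseteq> carrier R" using xs(1) max_ideal_subset by blast
      note s = seq[OF xsR xs(2)]
      have "MT.has_socle (D.D.P.adjoins (image_mod {\<zero>\<^bsub>M\<^esub>}) xs)"
        using s image_mod_socle[OF adjoins_submodule[OF zero_submodule xsR] _ _ xs(4)] by auto
      then have "MT.maximal_regular (image_mod {\<zero>\<^bsub>M\<^esub>}) (length xs)"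
        unfolding MT.maximal_regular_def using s xs(1) by blast
      then have "length ys \<le> length xs"
        by (rule MT.regular_seq_length_le[OF _ image_mod_submodule[OF zero_submodule] ys(2)])
          (use ys(1) in \<open>simp add: transfer\<close>)
      then show False using small[OF xs(1-3)] by simp
    qed
    then show ?thesis
      unfolding depth_def[of R P] using nzP by (auto intro!: SUP_least)
  qed
  moreover have "depth R M \<le> depth R P"
    unfolding depth_def using nzP False regP by (auto intro!: SUP_subset_mono)
  ultimately show ?thesis by (rule antisym)
qed

end

section \<open>Tensor products\<close>

context module
begin

lemma diff_zero_imp_eq:
  assumes "x \<in> carrier M" "y \<in> carrier M" "x \<ominus>\<^bsub>M\<^esub> y = \<zero>\<^bsub>M\<^esub>"
  shows "x = y"
proof -
  have "x = (x \<ominus>\<^bsub>M\<^esub> y) \<oplus>\<^bsub>M\<^esub> y" using assms(1,2) by (simp add: M.minus_eq M.a_assoc M.l_neg)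
  then show ?thesis using assms by simp
qed

lemma quot_projection_linear:
  assumes K: "submodule K R M"
  shows "linear_map R M (quot_module M K) (\<lambda>x. K +>\<^bsub>M\<^esub> x)"
  by (rule linear_map.intro[OF module_axioms quot_is_module[OF K]], unfold_locales)
    (auto simp: quot_carrier quot_add[OF K] quot_smult[OF K])

lemma quot_map_exists:
  assumes K: "submodule K R M" and f: "linear_map R M P f" and ker: "\<And>x. x \<in> K \<Longrightarrow> f x = \<zero>\<^bsub>P\<^esub>"
  obtains h where "linear_map R (quot_module M K) P h"
    "\<And>x. x \<in> carrier M \<Longrightarrow> h (K +>\<^bsub>M\<^esub> x) = f x"
proof -
  interpret f: linear_map R M P f by (rule f)
  define h where "h X = f (SOME x. x \<in> X)" for X
  have h: "h (K +>\<^bsub>M\<^esub> x) = f x" if x: "x \<in> carrier M" for x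
  proof -
    define y where "y = (SOME y. y \<in> K +>\<^bsub>M\<^esub> x)"
    have "y \<in> K +>\<^bsub>M\<^esub> x" unfolding y_def by (rule someI_ex) (use coset_self[OF K x] in blast)
    then have y: "y \<in> carrier M" "y \<ominus>\<^bsub>M\<^esub> x \<in> K" using coset_mem_iff[OF K x] by auto
    have "f y \<ominus>\<^bsub>P\<^esub> f x = \<zero>\<^bsub>P\<^esub>" using ker[OF y(2)] f.map_diff[OF y(1) x] by simp
    then have "f y = f x" by (rule f.P.diff_zero_imp_eq[OF f.map_closed[OF y(1)] f.map_closed[OF x]])
    then show ?thesis unfolding h_def y_def .
  qed
  have "linear_map R (quot_module M K) P h"
    by (rule linear_map.intro[OF quot_is_module[OF K] f.P.module_axioms], unfold_locales)
      (auto simp: quot_carrier quot_add[OF K] quot_smult[OF K] h f.map_add f.map_smult)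
  with h show thesis using that by blast
qed

end

text \<open>The coset of a cycle \<open>x\<close> in the vanishing quotient equals \<open>B\<close>,
  and it contains \<open>x\<close> because zero is in \<open>B\<close>. Only cosets are unfolded, so
  the cycles never have to be made a module of their own.\<close>

lemma zero_homology_subset:
  assumes "module R C" "Z \<subseteq> carrier C" "\<zero>\<^bsub>C\<^esub> \<in> B" "zero_module (homology C Z B)"
  shows "Z \<subseteq> B"
proof
  interpret C: module R C by fact
  fix x assume x: "x \<in> Z"
  have "B +>\<^bsub>C\<lparr>carrier := Z\<rparr>\<^esub> x \<in> carrier (homology C Z B)"
    using x unfolding homology_def quot_module_def A_RCOSETS_def' by auto
  then have "B +>\<^bsub>C\<lparr>carrier := Z\<rparr>\<^esub> x = B"
    using assms(4) unfolding zero_module_def by (simp add: homology_def quot_module_def)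
  moreover have "\<zero>\<^bsub>C\<^esub> \<oplus>\<^bsub>C\<^esub> x \<in> B +>\<^bsub>C\<lparr>carrier := Z\<rparr>\<^esub> x"
    using assms(3) unfolding a_r_coset_def' by auto
  ultimately show "x \<in> B" using x assms(2) by auto
qed

locale tensor_modules = M: module R M + N: module R N
  for R (structure) and M (structure) and N (structure)
begin

abbreviation "FMN \<equiv> free_module R (carrier M \<times> carrier N)"
abbreviation "T \<equiv> tensor R M N"
abbreviation "pure \<equiv> pure_tensor R M N"
abbreviation "KMN \<equiv> tensor_kernel R M N"

sublocale F: module R FMN
  by (rule M.R.free_module_is_module)

lemma gen_closed [simp]:
  "x \<in> carrier M \<Longrightarrow> y \<in> carrier N \<Longrightarrow> free_gen R (x, y) \<in> carrier FMN"
  by (rule M.R.free_gen_closed) simp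

lemma relations_subset: "tensor_relations R M N \<subseteq> carrier FMN"
  unfolding tensor_relations_def Let_def
  by (auto simp del: M.R.free_module_simps)

lemma kernel_submodule: "submodule KMN R FMN"
  unfolding tensor_kernel_def by (rule F.span_submodule[OF relations_subset])

lemma relations_kernel: "tensor_relations R M N \<subseteq> KMN"
  unfolding tensor_kernel_def by (rule F.span_superset)

lemma tensor_eq: "T = quot_module FMN KMN"
  by (simp add: tensor_def)

sublocale T: module R T
  unfolding tensor_eq by (rule F.quot_is_module[OF kernel_submodule])

lemma pure_eq: "pure x y = KMN +>\<^bsub>FMN\<^esub> free_gen R (x, y)"
  by (simp add: pure_tensor_def)

sublocale proj: linear_map R FMN T "\<lambda>x. KMN +>\<^bsub>FMN\<^esub> x"
  unfolding tensor_eq by (rule F.quot_projection_linear[OF kernel_submodule])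

lemma proj_surj: "(\<lambda>x. KMN +>\<^bsub>FMN\<^esub> x) ` carrier FMN = carrier T"
  unfolding tensor_eq F.quot_carrier ..

lemma pure_closed [simp]: "x \<in> carrier M \<Longrightarrow> y \<in> carrier N \<Longrightarrow> pure x y \<in> carrier T"
  unfolding pure_eq by (rule proj.map_closed) simp

lemma relation_eq:
  assumes "u \<ominus>\<^bsub>FMN\<^esub> v \<in> tensor_relations R M N" "u \<in> carrier FMN" "v \<in> carrier FMN"
  shows "KMN +>\<^bsub>FMN\<^esub> u = KMN +>\<^bsub>FMN\<^esub> v"
  using assms relations_kernel F.coset_eq_iff[OF kernel_submodule] by blast

lemma pure_linear_left:
  assumes y: "y \<in> carrier N"
  shows "linear_map R M T (\<lambda>x. pure x y)"
proof (rule linear_map.intro[OF M.module_axioms T.module_axioms], unfold_locales)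
  fix x assume x: "x \<in> carrier M"
  show "pure x y \<in> carrier T" using x y by simp
  { fix x' assume x': "x' \<in> carrier M"
    have "KMN +>\<^bsub>FMN\<^esub> free_gen R (x \<oplus>\<^bsub>M\<^esub> x', y) = KMN +>\<^bsub>FMN\<^esub> (free_gen R (x, y) \<oplus>\<^bsub>FMN\<^esub> free_gen R (x', y))"
      by (rule relation_eq)
        (use x x' y in \<open>auto simp: tensor_relations_def Let_def simp del: M.R.free_module_simps\<close>)
    then show "pure (x \<oplus>\<^bsub>M\<^esub> x') y = pure x y \<oplus>\<^bsub>T\<^esub> pure x' y"
      unfolding pure_eq using proj.map_add[OF gen_closed[OF x y] gen_closed[OF x' y]] by simp }
  fix a assume a: "a \<in> carrier R"
  have "KMN +>\<^bsub>FMN\<^esub> free_gen R (a \<odot>\<^bsub>M\<^esub> x, y) = KMN +>\<^bsub>FMN\<^esub> (a \<odot>\<^bsub>FMN\<^esub> free_gen R (x, y))"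
    by (rule relation_eq)
      (use a x y in \<open>auto simp: tensor_relations_def Let_def simp del: M.R.free_module_simps\<close>)
  then show "pure (a \<odot>\<^bsub>M\<^esub> x) y = a \<odot>\<^bsub>T\<^esub> pure x y"
    unfolding pure_eq using proj.map_smult[OF a gen_closed[OF x y]] by simp
qed

lemma pure_linear_right:
  assumes x: "x \<in> carrier M"
  shows "linear_map R N T (pure x)"
proof (rule linear_map.intro[OF N.module_axioms T.module_axioms], unfold_locales)
  fix y assume y: "y \<in> carrier N"
  show "pure x y \<in> carrier T" using x y by simp
  { fix y' assume y': "y' \<in> carrier N"
    have "KMN +>\<^bsub>FMN\<^esub> free_gen R (x, y \<oplus>\<^bsub>N\<^esub> y') = KMN +>\<^bsub>FMN\<^esub> (free_gen R (x, y) \<oplus>\<^bsub>FMN\<^esub> free_gen R (x, y'))"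
      by (rule relation_eq)
        (use x y y' in \<open>auto simp: tensor_relations_def Let_def simp del: M.R.free_module_simps\<close>)
    then show "pure x (y \<oplus>\<^bsub>N\<^esub> y') = pure x y \<oplus>\<^bsub>T\<^esub> pure x y'"
      unfolding pure_eq using proj.map_add[OF gen_closed[OF x y] gen_closed[OF x y']] by simp }
  fix a assume a: "a \<in> carrier R"
  have "KMN +>\<^bsub>FMN\<^esub> free_gen R (x, a \<odot>\<^bsub>N\<^esub> y) = KMN +>\<^bsub>FMN\<^esub> (a \<odot>\<^bsub>FMN\<^esub> free_gen R (x, y))"
    by (rule relation_eq)
      (use a x y in \<open>auto simp: tensor_relations_def Let_def simp del: M.R.free_module_simps\<close>)
  then show "pure x (a \<odot>\<^bsub>N\<^esub> y) = a \<odot>\<^bsub>T\<^esub> pure x y"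
    unfolding pure_eq using proj.map_smult[OF a gen_closed[OF x y]] by simp
qed

lemma tensor_mem_submodule:
  assumes H: "submodule H R T" and pure: "\<And>x y. x \<in> carrier M \<Longrightarrow> y \<in> carrier N \<Longrightarrow> pure x y \<in> H"
    and z: "z \<in> carrier T"
  shows "z \<in> H"
proof -
  obtain w where w: "w \<in> carrier FMN" "z = KMN +>\<^bsub>FMN\<^esub> w" using z proj_surj by blast
  have "w \<in> {w \<in> carrier FMN. KMN +>\<^bsub>FMN\<^esub> w \<in> H}"
  proof (rule M.R.free_module_mem_submodule[OF w(1) proj.preimage_submodule[OF H]])
    fix p assume "p \<in> carrier M \<times> carrier N"
    then obtain x y where p: "p = (x, y)" "x \<in> carrier M" "y \<in> carrier N" by blast
    have wp: "w p \<in> carrier R" by (rule M.R.free_module_apply[OF w(1)])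
    have "w p \<odot>\<^bsub>FMN\<^esub> free_gen R p \<in> carrier FMN"
      using wp p by (intro F.smult_closed) auto
    moreover have "KMN +>\<^bsub>FMN\<^esub> (w p \<odot>\<^bsub>FMN\<^esub> free_gen R p) \<in> H"
      using proj.map_smult[OF wp gen_closed[OF p(2,3)]] T.submodule_smult[OF H wp pure[OF p(2,3)]]
      unfolding p(1) pure_eq by simp
    ultimately show "w p \<odot>\<^bsub>FMN\<^esub> free_gen R p \<in> {w \<in> carrier FMN. KMN +>\<^bsub>FMN\<^esub> w \<in> H}" by blast
  qed
  then show ?thesis using w(2) by blast
qed

lemma tensor_map_eqI:
  assumes "linear_map R T P f" "linear_map R T P g"
    and "\<And>x y. x \<in> carrier M \<Longrightarrow> y \<in> carrier N \<Longrightarrow> f (pure x y) = g (pure x y)"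
    and z: "z \<in> carrier T"
  shows "f z = g z"
  using tensor_mem_submodule[OF equalizer_submodule[OF assms(1,2)] _ z] assms(3) by simp

text \<open>The universal property: a bilinear map extends linearly to the free module on pairs,
  kills each of the four kinds of relations, and so factors through the quotient.\<close>

lemma tensor_map_exists:
  assumes left: "\<And>y. y \<in> carrier N \<Longrightarrow> linear_map R M P (\<lambda>x. \<beta> x y)"
    and right: "\<And>x. x \<in> carrier M \<Longrightarrow> linear_map R N P (\<beta> x)"
  obtains h where "linear_map R T P h"
    "\<And>x y. x \<in> carrier M \<Longrightarrow> y \<in> carrier N \<Longrightarrow> h (pure x y) = \<beta> x y"
proof -
  interpret P: module R P using linear_map.axioms(2)[OF left[OF N.M.zero_closed]] .
  have \<beta>: "\<beta> x y \<in> carrier P" if "x \<in> carrier M" "y \<in> carrier N" for x y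
    using linear_map.map_closed[OF right] that by blast
  have "case_prod \<beta> p \<in> carrier P" if "p \<in> carrier M \<times> carrier N" for p
    using that \<beta> by auto
  then obtain g where g: "linear_map R FMN P g"
    "\<And>p. p \<in> carrier M \<times> carrier N \<Longrightarrow> g (free_gen R p) = case_prod \<beta> p"
    using M.R.free_module_map_exists[OF P.module_axioms, of "carrier M \<times> carrier N" "case_prod \<beta>"] by blast
  interpret g: linear_map R FMN P g by (rule g(1))
  have gen: "g (free_gen R (x, y)) = \<beta> x y" if "x \<in> carrier M" "y \<in> carrier N" for x y
    using g(2)[of "(x, y)"] that by simp
  note del [simp del] = M.R.free_module_simps
  have diff: "g (u \<ominus>\<^bsub>FMN\<^esub> v) = \<zero>\<^bsub>P\<^esub>" if "u \<in> carrier FMN" "v \<in> carrier FMN" "g u = g v" for u v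
    using that by (simp add: g.map_diff P.M.minus_eq P.M.r_neg)
  have "tensor_relations R M N \<subseteq> {w \<in> carrier FMN. g w \<in> {\<zero>\<^bsub>P\<^esub>}}"
  proof (rule subsetI)
    fix w assume w: "w \<in> tensor_relations R M N"
    have "g w = \<zero>\<^bsub>P\<^esub>"
      using w unfolding tensor_relations_def Let_def
      by (elim UnE; clarsimp; intro diff)
        (auto simp: g.map_add g.map_smult gen linear_map.map_add[OF left] linear_map.map_add[OF right]
          linear_map.map_smult[OF left] linear_map.map_smult[OF right])
    then show "w \<in> {w \<in> carrier FMN. g w \<in> {\<zero>\<^bsub>P\<^esub>}}" using w relations_subset by blast
  qed
  then have "KMN \<subseteq> {w \<in> carrier FMN. g w \<in> {\<zero>\<^bsub>P\<^esub>}}"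
    unfolding tensor_kernel_def by (rule F.span_minimal[OF g.preimage_submodule[OF P.zero_submodule]])
  then obtain h where h: "linear_map R (quot_module FMN KMN) P h"
    "\<And>x. x \<in> carrier FMN \<Longrightarrow> h (KMN +>\<^bsub>FMN\<^esub> x) = g x"
    using F.quot_map_exists[OF kernel_submodule g(1)] by blast
  show thesis
  proof (rule that)
    show "linear_map R T P h" using h(1) by (simp add: tensor_eq)
    show "h (pure x y) = \<beta> x y" if "x \<in> carrier M" "y \<in> carrier N" for x y
      using h(2)[OF gen_closed[OF that]] gen[OF that] by (simp add: pure_eq)
  qed
qed

end

text \<open>The definite description in \<open>tensor_map\<close> denotes: the universal property
  gives existence, and uniqueness holds because members of \<open>mod_hom\<close> are extensional
  and pure tensors generate.\<close>

lemma tensor_map_spec: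
  assumes f: "linear_map R M M' f" and N: "module R N"
  shows "linear_map R (tensor R M N) (tensor R M' N) (tensor_map R M M' N f)"
    and "x \<in> carrier M \<Longrightarrow> y \<in> carrier N \<Longrightarrow>
      tensor_map R M M' N f (pure_tensor R M N x y) = pure_tensor R M' N (f x) y"
proof -
  interpret f: linear_map R M M' f by (rule f)
  interpret t: tensor_modules R M N by (intro tensor_modules.intro f.M.module_axioms N)
  interpret t': tensor_modules R M' N by (intro tensor_modules.intro f.P.module_axioms N)
  obtain h where h: "linear_map R t.T t'.T h"
    "\<And>x y. x \<in> carrier M \<Longrightarrow> y \<in> carrier N \<Longrightarrow> h (t.pure x y) = t'.pure (f x) y"
    using t.tensor_map_exists[of t'.T "\<lambda>x y. t'.pure (f x) y"]
      linear_map_comp[OF f t'.pure_linear_left] t'.pure_linear_right[OF f.map_closed] by blast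
  let ?P = "\<lambda>h. h \<in> mod_hom R t.T t'.T \<and>
    (\<forall>x\<in>carrier M. \<forall>y\<in>carrier N. h (t.pure x y) = t'.pure (f x) y)"
  have ex: "?P (restrict h (carrier t.T))"
    using linear_map_restrict_mod_hom[OF h(1)] h(2) by simp
  have uniq: "g = g'" if g: "?P g" "?P g'" for g g'
  proof (rule extensionalityI[of _ "carrier t.T"])
    show "g \<in> extensional (carrier t.T)" "g' \<in> extensional (carrier t.T)"
      using g unfolding mod_hom_def PiE_def by blast+
    show "g z = g' z" if "z \<in> carrier t.T" for z
      by (rule t.tensor_map_eqI[OF _ _ _ that, of t'.T])
        (use g in \<open>auto intro: mod_hom_linear t.T.module_axioms t'.T.module_axioms\<close>)
  qed
  have "?P (tensor_map R M M' N f)"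
    unfolding tensor_map_def by (rule theI[of ?P, OF ex]) (use uniq ex in blast)
  then show "linear_map R t.T t'.T (tensor_map R M M' N f)"
    "x \<in> carrier M \<Longrightarrow> y \<in> carrier N \<Longrightarrow> tensor_map R M M' N f (t.pure x y) = t'.pure (f x) y"
    using mod_hom_linear[OF t.T.module_axioms t'.T.module_axioms] by blast+
qed

text \<open>Right exactness of the tensor product, with \<open>N\<^sup>S\<close> in the role of \<open>R\<^sup>S \<otimes> N\<close>.\<close>

lemma tensor_presentation:
  assumes e: "linear_map R (free_module R S) M e" and surj: "e ` carrier (free_module R S) = carrier M"
    and N: "module R N" and D: "scalar_ext R N S' S d D"
    and ker: "{f \<in> carrier (free_module R S). e f = \<zero>\<^bsub>M\<^esub>} = d ` carrier (free_module R S')"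
  obtains \<theta> where "linear_map R (direct_power N S) (tensor R M N) \<theta>"
    "\<theta> ` carrier (direct_power N S) = carrier (tensor R M N)"
    "{u \<in> carrier (direct_power N S). \<theta> u = \<zero>\<^bsub>tensor R M N\<^esub>} = D ` carrier (direct_power N S')"
    "\<And>f n. f \<in> carrier (free_module R S) \<Longrightarrow> n \<in> carrier N \<Longrightarrow>
      \<theta> (outer N f n) = pure_tensor R M N (e f) n"
proof -
  interpret e: linear_map R "free_module R S" M e by (rule e)
  interpret N: module R N by (rule N)
  interpret DP: module R "direct_power N S" by (rule N.direct_power_is_module)
  interpret t: tensor_modules R M N by (intro tensor_modules.intro e.P.module_axioms N)
  interpret D: scalar_extension R N S' S d D by unfold_locales (rule D)
  have gen: "free_gen R s \<in> carrier (free_module R S)" if "s \<in> S" for s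
    by (rule e.M.R.free_gen_closed[OF that])
  obtain \<theta> where \<theta>: "linear_map R (direct_power N S) t.T \<theta>"
    "\<And>s n. s \<in> S \<Longrightarrow> n \<in> carrier N \<Longrightarrow> \<theta> (single N s n) = t.pure (e (free_gen R s)) n"
    using N.direct_power_map_exists[OF t.T.module_axioms, of S "\<lambda>s. t.pure (e (free_gen R s))"]
      t.pure_linear_right[OF e.map_closed[OF gen]] by blast
  interpret \<theta>: linear_map R "direct_power N S" t.T \<theta> by (rule \<theta>(1))
  have outer: "\<theta> (outer N f n) = t.pure (e f) n"
    if f: "f \<in> carrier (free_module R S)" and n: "n \<in> carrier N" for f n
    by (rule e.M.R.free_module_map_eqI[OF linear_map_comp[OF N.outer_linear_left[OF n] \<theta>(1)]
          linear_map_comp[OF e t.pure_linear_left[OF n]] _ f])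
      (simp add: N.outer_gen[OF n] \<theta>(2) n)
  have "carrier t.T \<subseteq> \<theta> ` carrier (direct_power N S)"
  proof
    fix z assume z: "z \<in> carrier t.T"
    show "z \<in> \<theta> ` carrier (direct_power N S)"
    proof (rule t.tensor_mem_submodule[OF \<theta>.image_submodule[OF DP.carrier_is_submodule] _ z])
      fix x y assume x: "x \<in> carrier M" and y: "y \<in> carrier N"
      obtain f where f: "f \<in> carrier (free_module R S)" "x = e f" using x surj by blast
      then show "t.pure x y \<in> \<theta> ` carrier (direct_power N S)"
        using outer[OF f(1) y] N.outer_closed[OF f(1) y] by (metis imageI)
    qed
  qed
  then have \<theta>_surj: "\<theta> ` carrier (direct_power N S) = carrier t.T" by auto
  \<comment> \<open>A map from the tensor product to the quotient of N^S by \<open>Q\<close> is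
    built in order to show that the kernel of \<open>\<theta>\<close> is no larger than
    \<open>Q\<close>.\<close>
  define Q where "Q = D ` carrier (direct_power N S')"
  have Q: "submodule Q R (direct_power N S)"
    unfolding Q_def by (rule D.D.image_submodule[OF D.D.M.carrier_is_submodule])
  let ?Q = "quot_module (direct_power N S) Q"
  interpret q: linear_map R "direct_power N S" ?Q "\<lambda>u. Q +>\<^bsub>direct_power N S\<^esub> u"
    by (rule DP.quot_projection_linear[OF Q])
  have q_zero: "Q +>\<^bsub>direct_power N S\<^esub> u = Q \<longleftrightarrow> u \<in> Q" if "u \<in> carrier (direct_power N S)" for u
    by (rule DP.coset_eq_self_iff[OF Q that])
  \<comment> \<open>The class of f tensor n modulo \<open>Q\<close> depends only on the image of
    \<open>f\<close> in M, because the kernel of \<open>e\<close> is the image of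
    \<open>d\<close>.\<close>
  have outerQ: "Q +>\<^bsub>direct_power N S\<^esub> outer N f n = Q +>\<^bsub>direct_power N S\<^esub> outer N g n"
    if fg: "f \<in> carrier (free_module R S)" "g \<in> carrier (free_module R S)" "e f = e g"
      and n: "n \<in> carrier N" for f g n
  proof -
    interpret o: linear_map R "free_module R S" "direct_power N S" "\<lambda>f. outer N f n"
      by (rule N.outer_linear_left[OF n])
    have "f \<ominus>\<^bsub>free_module R S\<^esub> g \<in> {f \<in> carrier (free_module R S). e f = \<zero>\<^bsub>M\<^esub>}"
      using fg by (simp add: e.map_diff e.P.M.minus_eq e.P.M.r_neg)
    then obtain k where k: "k \<in> carrier (free_module R S')" "f \<ominus>\<^bsub>free_module R S\<^esub> g = d k"
      unfolding ker by blast
    have "outer N f n \<ominus>\<^bsub>direct_power N S\<^esub> outer N g n = D (outer N k n)"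
      using o.map_diff[OF fg(1,2)] k D.ext_outer[OF k(1) n] by simp
    also have "\<dots> \<in> Q" unfolding Q_def using N.outer_closed[OF k(1) n] by blast
    finally show ?thesis
      using DP.coset_eq_iff[OF Q N.outer_closed[OF fg(1) n] N.outer_closed[OF fg(2) n]] by blast
  qed
  \<comment> \<open>The chosen preimages need not be linear in \<open>x\<close>; they become so
    after passing to classes modulo \<open>Q\<close>.\<close>
  define r where "r x = (SOME f. f \<in> carrier (free_module R S) \<and> e f = x)" for x
  have r: "r x \<in> carrier (free_module R S)" "e (r x) = x" if "x \<in> carrier M" for x
  proof -
    have "\<exists>f. f \<in> carrier (free_module R S) \<and> e f = x" using that unfolding surj[symmetric] by blast
    then have "r x \<in> carrier (free_module R S) \<and> e (r x) = x" unfolding r_def by (rule someI_ex)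
    then show "r x \<in> carrier (free_module R S)" "e (r x) = x" by auto
  qed
  have left: "linear_map R M ?Q (\<lambda>x. Q +>\<^bsub>direct_power N S\<^esub> outer N (r x) n)" if n: "n \<in> carrier N" for n
  proof (rule linear_map.intro[OF e.P.module_axioms q.P.module_axioms], unfold_locales)
    interpret o: linear_map R "free_module R S" ?Q "\<lambda>f. Q +>\<^bsub>direct_power N S\<^esub> outer N f n"
      by (rule linear_map_comp[OF N.outer_linear_left[OF n] q.linear_map_axioms])
    fix x assume x: "x \<in> carrier M"
    show "Q +>\<^bsub>direct_power N S\<^esub> outer N (r x) n \<in> carrier ?Q" by (rule o.map_closed[OF r(1)[OF x]])
    show "Q +>\<^bsub>direct_power N S\<^esub> outer N (r (x \<oplus>\<^bsub>M\<^esub> y)) n =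
      (Q +>\<^bsub>direct_power N S\<^esub> outer N (r x) n) \<oplus>\<^bsub>?Q\<^esub> (Q +>\<^bsub>direct_power N S\<^esub> outer N (r y) n)"
      if y: "y \<in> carrier M" for y
      unfolding o.map_add[OF r(1)[OF x] r(1)[OF y], symmetric]
      by (rule outerQ)
        (use r x y n e.M.M.add.m_closed in \<open>simp_all add: e.map_add del: e.M.R.free_module_simps\<close>)
    show "Q +>\<^bsub>direct_power N S\<^esub> outer N (r (a \<odot>\<^bsub>M\<^esub> x)) n =
      a \<odot>\<^bsub>?Q\<^esub> (Q +>\<^bsub>direct_power N S\<^esub> outer N (r x) n)" if a: "a \<in> carrier R" for a
      unfolding o.map_smult[OF a r(1)[OF x], symmetric]
      by (rule outerQ)
        (use r x a n e.M.smult_closed in \<open>simp_all add: e.map_smult del: e.M.R.free_module_simps\<close>)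
  qed
  obtain h where h: "linear_map R t.T ?Q h"
    "\<And>x n. x \<in> carrier M \<Longrightarrow> n \<in> carrier N \<Longrightarrow> h (t.pure x n) = Q +>\<^bsub>direct_power N S\<^esub> outer N (r x) n"
    using t.tensor_map_exists[OF left linear_map_comp[OF N.outer_linear_right[OF r(1)] q.linear_map_axioms]]
    by blast
  interpret h: linear_map R t.T ?Q h by (rule h(1))
  have h\<theta>: "h (\<theta> u) = Q +>\<^bsub>direct_power N S\<^esub> u" if u: "u \<in> carrier (direct_power N S)" for u
  proof (rule N.direct_power_map_eqI[OF linear_map_comp[OF \<theta>(1) h(1)] q.linear_map_axioms _ u])
    fix s n assume s: "s \<in> S" and n: "n \<in> carrier N"
    have x: "e (free_gen R s) \<in> carrier M" by (rule e.map_closed[OF gen[OF s]])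
    have "h (\<theta> (single N s n)) = Q +>\<^bsub>direct_power N S\<^esub> outer N (r (e (free_gen R s))) n"
      unfolding \<theta>(2)[OF s n] by (rule h(2)[OF x n])
    also have "\<dots> = Q +>\<^bsub>direct_power N S\<^esub> outer N (free_gen R s) n"
      by (rule outerQ[OF r(1)[OF x] gen[OF s] r(2)[OF x] n])
    finally show "h (\<theta> (single N s n)) = Q +>\<^bsub>direct_power N S\<^esub> single N s n"
      by (simp add: N.outer_gen[OF n])
  qed
  have "u \<in> Q" if u: "u \<in> carrier (direct_power N S)" "\<theta> u = \<zero>\<^bsub>t.T\<^esub>" for u
  proof -
    have "Q +>\<^bsub>direct_power N S\<^esub> u = \<zero>\<^bsub>?Q\<^esub>" using h\<theta>[OF u(1)] u(2) by simp
    then show ?thesis using q_zero[OF u(1)] by (simp add: DP.quot_zero)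
  qed
  moreover have "\<theta> (D u) = \<zero>\<^bsub>t.T\<^esub>" if u: "u \<in> carrier (direct_power N S')" for u
  proof -
    have "D u \<in> {v \<in> carrier (direct_power N S). \<theta> v \<in> {\<zero>\<^bsub>t.T\<^esub>}}"
    proof (rule D.ext_mem[OF u \<theta>.preimage_submodule[OF t.T.zero_submodule]])
      fix s assume s: "s \<in> S'"
      have dF: "d (free_gen R s) \<in> carrier (free_module R S)"
        by (rule D.d.map_closed[OF e.M.R.free_gen_closed[OF s]])
      have "d (free_gen R s) \<in> {f \<in> carrier (free_module R S). e f = \<zero>\<^bsub>M\<^esub>}"
        unfolding ker by (rule imageI[OF e.M.R.free_gen_closed[OF s]])
      then have ez: "e (d (free_gen R s)) = \<zero>\<^bsub>M\<^esub>" by simp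
      have us: "u s \<in> carrier N" by (rule direct_power_apply[OF u])
      have "\<theta> (outer N (d (free_gen R s)) (u s)) = \<zero>\<^bsub>t.T\<^esub>"
        unfolding outer[OF dF us] ez by (rule linear_map.map_zero[OF t.pure_linear_left[OF us]])
      then show "outer N (d (free_gen R s)) (u s) \<in> {v \<in> carrier (direct_power N S). \<theta> v \<in> {\<zero>\<^bsub>t.T\<^esub>}}"
        using N.outer_closed[OF dF us] by blast
    qed
    then show ?thesis by blast
  qed
  moreover have "D u \<in> carrier (direct_power N S)" if "u \<in> carrier (direct_power N S')" for u
    by (rule D.D.map_closed[OF that])
  ultimately have "{u \<in> carrier (direct_power N S). \<theta> u = \<zero>\<^bsub>t.T\<^esub>} = D ` carrier (direct_power N S')"
    unfolding Q_def by blast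
  then show thesis using that \<theta>(1) \<theta>_surj outer by blast
qed

section \<open>Minimal free resolutions\<close>

context cring
begin

lemma fg_self_module: "fg_module R (self_module R)"
proof -
  interpret S: module R "self_module R" by (rule self_module_is_module)
  have sub: "submodule (module_span R (self_module R) {\<one>}) R (self_module R)"
    by (rule S.span_submodule) simp
  have "r \<in> module_span R (self_module R) {\<one>}" if "r \<in> carrier R" for r
    using S.submodule_smult[OF sub that, of \<one>] S.span_superset[of "{\<one>}"] that by auto
  then have "module_span R (self_module R) {\<one>} = carrier (self_module R)"
    using S.submodule_subset[OF sub] by auto
  then show ?thesis unfolding fg_module_def using S.module_axioms by (intro conjI exI[of _ "{\<one>}"]) auto
qed

lemma fg_free_module: "finite S \<Longrightarrow> fg_module R (free_module R S)"
  unfolding free_module_eq by (rule module.fg_direct_power[OF self_module_is_module fg_self_module])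

text \<open>A vector with entries in \<open>I\<close> is the finite sum of its entries times basis
  vectors. This turns minimality of a resolution into a condition on matrix entries.\<close>

lemma ideal_smult_free_module:
  assumes I: "ideal I R"
  shows "ideal_smult R I (free_module R S) = {f \<in> carrier (free_module R S). \<forall>s. f s \<in> I}"
proof -
  interpret I: ideal I R by (rule I)
  interpret S: module R "self_module R" by (rule self_module_is_module)
  interpret F: module R "free_module R S" by (rule free_module_is_module)
  note [simp del] = free_module_simps
  have "submodule I R (self_module R)"
  proof (rule S.submoduleI)
    show "I \<subseteq> carrier (self_module R)" using I.a_subset by simp
    show "\<zero>\<^bsub>self_module R\<^esub> \<in> I" by simp
    show "a \<oplus>\<^bsub>self_module R\<^esub> b \<in> I" if "a \<in> I" "b \<in> I" for a b using that by simp
    show smult: "r \<odot>\<^bsub>self_module R\<^esub> a \<in> I" if "r \<in> carrier R" "a \<in> I" for r a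
      using I.I_l_closed[OF that(2,1)] by simp
    show "\<ominus>\<^bsub>self_module R\<^esub> a \<in> I" if a: "a \<in> I" for a
    proof -
      have "a \<in> carrier (self_module R)" using a I.a_subset by auto
      then have "\<ominus>\<^bsub>self_module R\<^esub> a = (\<ominus> \<one>) \<odot>\<^bsub>self_module R\<^esub> a"
        using S.smult_l_minus[OF one_closed] S.smult_one by metis
      then show ?thesis using smult[OF _ a, of "\<ominus> \<one>"] by simp
    qed
  qed
  then have sub: "submodule {f \<in> carrier (free_module R S). \<forall>s. f s \<in> I} R (free_module R S)"
    using S.powers_in_submodule[of I S] by (simp add: powers_in_def free_module_eq)
  show ?thesis
    unfolding ideal_smult_def
  proof (rule F.span_eqI[OF sub])
    show "{a \<odot>\<^bsub>free_module R S\<^esub> f | a f. a \<in> I \<and> f \<in> carrier (free_module R S)}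
      \<subseteq> {f \<in> carrier (free_module R S). \<forall>s. f s \<in> I}"
    proof (clarify)
      fix a f assume a: "a \<in> I" and f: "f \<in> carrier (free_module R S)"
      have aR: "a \<in> carrier R" using a I.a_subset by auto
      show "a \<odot>\<^bsub>free_module R S\<^esub> f \<in> carrier (free_module R S) \<and>
          (\<forall>s. (a \<odot>\<^bsub>free_module R S\<^esub> f) s \<in> I)"
        using F.smult_closed[OF aR f] I.I_r_closed[OF a free_module_apply[OF f]]
        by (simp add: free_module_simps)
    qed
    fix H assume H: "submodule H R (free_module R S)"
      "{a \<odot>\<^bsub>free_module R S\<^esub> f | a f. a \<in> I \<and> f \<in> carrier (free_module R S)} \<subseteq> H"
    show "{f \<in> carrier (free_module R S). \<forall>s. f s \<in> I} \<subseteq> H"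
    proof
      fix f assume f: "f \<in> {f \<in> carrier (free_module R S). \<forall>s. f s \<in> I}"
      show "f \<in> H"
      proof (rule free_module_mem_submodule[OF _ H(1)])
        show "f \<in> carrier (free_module R S)" using f by blast
        show "f s \<odot>\<^bsub>free_module R S\<^esub> free_gen R s \<in> H" if "s \<in> S" for s
          using H(2) f free_gen_closed[OF that] by blast
      qed
    qed
  qed
qed

text \<open>A generating set of least cardinality gives a cover with kernel in the maximal ideal: a
  relation with a unit coefficient would make one of the generators superfluous.\<close>

lemma minimal_cover_exists:
  assumes R: "noetherian_local_ring R" and L: "module R L" and K: "submodule K R L"
    and fgK: "\<exists>T. finite T \<and> T \<subseteq> K \<and> module_span R L T = K"
  obtains b :: nat and g where "linear_map R (free_module R {..<b}) L g"
    "g ` carrier (free_module R {..<b}) = K"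
    "\<And>f i. f \<in> carrier (free_module R {..<b}) \<Longrightarrow> g f = \<zero>\<^bsub>L\<^esub> \<Longrightarrow> f i \<in> max_ideal R"
proof -
  interpret L: module R L by (rule L)
  interpret m: maximalideal "max_ideal R" R by (rule noetherian_local_maximalideal[OF R])
  define P where "P n \<longleftrightarrow> (\<exists>T. finite T \<and> card T = n \<and> T \<subseteq> K \<and> module_span R L T = K)" for n
  have "\<exists>n. P n" using fgK unfolding P_def by blast
  then have Pb: "P (LEAST n. P n)" by (rule LeastI_ex)
  define b where "b = (LEAST n. P n)"
  obtain T where T: "finite T" "card T = b" "T \<subseteq> K" "module_span R L T = K"
    using Pb unfolding P_def b_def by blast
  have min: "b \<le> card T'" if "finite T'" "T' \<subseteq> K" "module_span R L T' = K" for T'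
    unfolding b_def by (rule Least_le) (use that in \<open>auto simp: P_def\<close>)
  obtain x where x: "bij_betw x {..<b} T"
    using ex_bij_betw_nat_finite[OF T(1)] T(2) by (metis atLeast0LessThan)
  have TL: "T \<subseteq> carrier L" using T(3) L.submodule_subset[OF K] by blast
  have xT: "x i \<in> T" if "i \<in> {..<b}" for i using x that by (auto simp: bij_betw_def)
  have xL: "x i \<in> carrier L" if "i \<in> {..<b}" for i using xT[OF that] TL by blast
  let ?F = "free_module R {..<b}"
  note [simp del] = free_module_simps
  interpret F: module R ?F by (rule free_module_is_module)
  obtain g where g: "linear_map R ?F L g" "\<And>i. i \<in> {..<b} \<Longrightarrow> g (free_gen R i) = x i"
    using free_module_map_exists[OF L, of "{..<b}" x] xL by blast
  interpret g: linear_map R ?F L g by (rule g(1))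
  have im1: "K \<subseteq> g ` carrier ?F"
  proof -
    have "t \<in> g ` carrier ?F" if t: "t \<in> T" for t
    proof -
      obtain i where i: "i \<in> {..<b}" "t = x i" using x t by (auto simp: bij_betw_def)
      then show ?thesis using g(2)[OF i(1)] free_gen_closed[OF i(1)] by (metis imageI)
    qed
    then show ?thesis
      using L.span_minimal[OF g.image_submodule[OF F.carrier_is_submodule], of T] T(4) by blast
  qed
  \<comment> \<open>Membership of a linear combination is checked term by term, once for
    \<open>K\<close> and once for the span of all generators but one.\<close>
  have gH: "g f \<in> H"
    if H: "submodule H R L" and f: "f \<in> carrier ?F" and i: "\<And>i. i \<in> {..<b} \<Longrightarrow> f i \<odot>\<^bsub>L\<^esub> x i \<in> H" for f H
  proof -
    have "f \<in> {f \<in> carrier ?F. g f \<in> H}"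
    proof (rule free_module_mem_submodule[OF f g.preimage_submodule[OF H]])
      fix i assume i: "i \<in> {..<b}"
      have "g (f i \<odot>\<^bsub>?F\<^esub> free_gen R i) = f i \<odot>\<^bsub>L\<^esub> x i"
        using g.map_smult[OF free_module_apply[OF f] free_gen_closed[OF i]] g(2)[OF i] by simp
      then show "f i \<odot>\<^bsub>?F\<^esub> free_gen R i \<in> {f \<in> carrier ?F. g f \<in> H}"
        using that(3)[OF i] F.smult_closed[OF free_module_apply[OF f] free_gen_closed[OF i]] by simp
    qed
    then show ?thesis by blast
  qed
  have "g f \<in> K" if f: "f \<in> carrier ?F" for f
    by (rule gH[OF K f])
      (use xT T(3) L.submodule_smult[OF K free_module_apply[OF f]] in blast)
  then have im: "g ` carrier ?F = K" using im1 by blast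
  have "f i \<in> max_ideal R" if f: "f \<in> carrier ?F" and gf: "g f = \<zero>\<^bsub>L\<^esub>" for f i
  proof (rule ccontr)
    assume ni: "f i \<notin> max_ideal R"
    have fR: "f j \<in> carrier R" for j by (rule free_module_apply[OF f])
    have unit: "f i \<in> Units R" using nonunit_in_max_ideal[OF R fR] ni by blast
    have i: "i \<in> {..<b}"
    proof (rule ccontr)
      assume "i \<notin> {..<b}"
      then have "f i = \<zero>" using f by (auto simp: free_module_def)
      then show False using ni m.zero_closed by simp
    qed
    define H where "H = module_span R L (T - {x i})"
    have H: "submodule H R L" unfolding H_def using TL by (intro L.span_submodule) auto
    \<comment> \<open>Erasing the coefficient of \<open>x i\<close> from the relation expresses the
      term in \<open>x i\<close> by the other generators.\<close>
    define f' where "f' = f(i := \<zero>)"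
    have f': "f' \<in> carrier ?F"
      using f unfolding f'_def free_module_def
      by (auto elim!: rev_finite_subset split: if_splits)
    have "g f' \<in> H"
    proof (rule gH[OF H f'])
      fix j assume j: "j \<in> {..<b}"
      show "f' j \<odot>\<^bsub>L\<^esub> x j \<in> H"
      proof (cases "j = i")
        case True
        then show ?thesis using xL[OF j] L.submodule_zero[OF H] by (simp add: f'_def)
      next
        case False
        then have "x j \<noteq> x i" using x i j by (auto simp: bij_betw_def inj_on_def)
        then have "x j \<in> H" using xT[OF j] L.span_superset[of "T - {x i}"] unfolding H_def by blast
        then show ?thesis using False fR[of j] by (simp add: f'_def L.submodule_smult[OF H])
      qed
    qed
    moreover have "f = f' \<oplus>\<^bsub>?F\<^esub> f i \<odot>\<^bsub>?F\<^esub> free_gen R i"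
      using fR by (auto simp: free_module_simps f'_def free_gen_def)
    then have "\<zero>\<^bsub>L\<^esub> = g f' \<oplus>\<^bsub>L\<^esub> f i \<odot>\<^bsub>L\<^esub> x i"
      using gf g.map_add[OF f' F.smult_closed[OF fR free_gen_closed[OF i]], of i]
        g.map_smult[OF fR free_gen_closed[OF i], of i] g(2)[OF i] by simp
    then have "g f' \<oplus>\<^bsub>L\<^esub> f i \<odot>\<^bsub>L\<^esub> x i \<in> H" using L.submodule_zero[OF H] by simp
    moreover have "f i \<odot>\<^bsub>L\<^esub> x i \<in> carrier L" by (rule L.smult_closed[OF fR xL[OF i]])
    ultimately have "f i \<odot>\<^bsub>L\<^esub> x i \<in> H" by (metis L.submodule_cancel[OF H])
    then have "inv (f i) \<odot>\<^bsub>L\<^esub> (f i \<odot>\<^bsub>L\<^esub> x i) \<in> H"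
      by (rule L.submodule_smult[OF H Units_inv_closed[OF unit]])
    also have "inv (f i) \<odot>\<^bsub>L\<^esub> (f i \<odot>\<^bsub>L\<^esub> x i) = x i"
      using L.smult_assoc1[OF Units_inv_closed[OF unit] fR xL[OF i], of i] Units_l_inv[OF unit] xL[OF i] by simp
    finally have "x i \<in> H" .
    then have "T \<subseteq> H" using L.span_superset[of "T - {x i}"] unfolding H_def by blast
    then have "K \<subseteq> H" using L.span_minimal[OF H] T(4) by blast
    moreover have "H \<subseteq> K" unfolding H_def using T(3) by (intro L.span_minimal[OF K]) auto
    ultimately have "module_span R L (T - {x i}) = K" unfolding H_def by blast
    then have "b \<le> card (T - {x i})" using T by (intro min) auto
    also have "\<dots> < card T" using xT[OF i] T(1) by (intro psubset_card_mono) auto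
    finally show False using T(2) by simp
  qed
  then show thesis using that g(1) im by blast
qed

text \<open>Syzygies and Tor are defined through a choice of resolution, so existence must come
  before anything else about them. Each kernel is covered by \<open>minimal_cover_exists\<close>;
  that a cover has its kernel in the maximal ideal makes the next differential minimal.\<close>

lemma minimal_free_resolution_exists:
  assumes R: "noetherian_local_ring R" and M: "fg_module R M"
  shows "\<exists>F. minimal_free_resolution R M F"
proof -
  have noeth: "noetherian_ring R" using R unfolding noetherian_local_ring_def by blast
  interpret m: maximalideal "max_ideal R" R by (rule noetherian_local_maximalideal[OF R])
  interpret M: module R M using M unfolding fg_module_def by blast
  let ?F = "\<lambda>b::nat. free_module R {..<b}"
  define mini where "mini b g z \<longleftrightarrow> (\<forall>f\<in>carrier (?F b). g f = z \<longrightarrow> (\<forall>i. f i \<in> max_ideal R))"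
    for b and g :: "(nat \<Rightarrow> 'a) \<Rightarrow> 'x" and z
  have Fmod: "module R (?F b)" for b by (rule free_module_is_module)
  obtain S where S: "finite S" "S \<subseteq> carrier M" "module_span R M S = carrier M"
    using M unfolding fg_module_def by blast
  obtain b0 e where e: "linear_map R (?F b0) M e" "e ` carrier (?F b0) = carrier M"
    "\<And>f i. f \<in> carrier (?F b0) \<Longrightarrow> e f = \<zero>\<^bsub>M\<^esub> \<Longrightarrow> f i \<in> max_ideal R"
    using minimal_cover_exists[OF R M.module_axioms M.carrier_is_submodule] S by blast
  have step: "\<exists>b' g'. linear_map R (?F b') (?F b) g' \<and> g' ` carrier (?F b') = K \<and>
      (\<forall>f\<in>carrier (?F b'). g' f = \<zero>\<^bsub>?F b\<^esub> \<longrightarrow> (\<forall>i. f i \<in> max_ideal R))"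
    if K: "submodule K R (?F b)" for K b
  proof -
    interpret F: module R "?F b" by (rule Fmod)
    have "fg_module R (?F b)" by (rule fg_free_module) simp
    then obtain G where G: "finite G" "G \<subseteq> carrier (?F b)" "module_span R (?F b) G = carrier (?F b)"
      unfolding fg_module_def by blast
    have "\<exists>T. finite T \<and> T \<subseteq> K \<and> module_span R (?F b) T = K"
      by (rule F.submodules_fg[OF noeth G(1,2) K]) (use G(3) F.submodule_subset[OF K] in simp)
    then obtain b' g' where "linear_map R (?F b') (?F b) g'" "g' ` carrier (?F b') = K"
      "\<And>f i. f \<in> carrier (?F b') \<Longrightarrow> g' f = \<zero>\<^bsub>?F b\<^esub> \<Longrightarrow> f i \<in> max_ideal R"
      using minimal_cover_exists[OF R Fmod K] by blast
    then show ?thesis by blast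
  qed
  define kere where "kere = {f \<in> carrier (?F b0). e f = \<zero>\<^bsub>M\<^esub>}"
  define ker where "ker c b g = {f \<in> carrier (?F b). g f = \<zero>\<^bsub>?F c\<^esub>}"
    for c b :: nat and g :: "(nat \<Rightarrow> 'a) \<Rightarrow> nat \<Rightarrow> 'a"
  have kere: "submodule kere R (?F b0)"
    using linear_map.preimage_submodule[OF e(1) M.zero_submodule] by (simp add: kere_def)
  have ker: "submodule (ker c b g) R (?F b)" if g: "linear_map R (?F b) (?F c) g" for c b g
    using linear_map.preimage_submodule[OF g module.zero_submodule[OF Fmod]]
    by (simp add: ker_def del: free_module_simps)
  \<comment> \<open>A state consists of the rank of the target, the rank of the source and the map
    between them. The clause for \<open>n = 0\<close> ties the sequence to the kernel of
    \<open>e\<close>, and the condition on \<open>ker\<close> is the minimality of the next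
    map.\<close>
  define P where "P n st \<longleftrightarrow> (case st of (c, b, g) \<Rightarrow> linear_map R (?F b) (?F c) g \<and>
    (\<forall>f\<in>ker c b g. \<forall>i. f i \<in> max_ideal R) \<and>
    (n = 0 \<longrightarrow> c = b0 \<and> g ` carrier (?F b) = kere))" for n :: nat and st
  define Q where "Q st st' \<longleftrightarrow> (case st of (c, b, g) \<Rightarrow> case st' of (c', b', g') \<Rightarrow>
    c' = b \<and> g' ` carrier (?F b') = ker c b g)"
    for st st' :: "nat \<times> nat \<times> ((nat \<Rightarrow> 'a) \<Rightarrow> nat \<Rightarrow> 'a)"
  have "\<exists>st. P 0 st"
  proof -
    obtain b g where "linear_map R (?F b) (?F b0) g" "g ` carrier (?F b) = kere"
      "\<forall>f\<in>carrier (?F b). g f = \<zero>\<^bsub>?F b0\<^esub> \<longrightarrow> (\<forall>i. f i \<in> max_ideal R)"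
      using step[OF kere] by blast
    then have "P 0 (b0, b, g)" unfolding P_def ker_def by simp
    then show ?thesis by blast
  qed
  moreover have "\<exists>st'. P (Suc n) st' \<and> Q st st'" if "P n st" for n st
  proof -
    obtain c b g where st: "st = (c, b, g)" by (cases st)
    then have g: "linear_map R (?F b) (?F c) g" using that unfolding P_def by simp
    obtain b' g' where "linear_map R (?F b') (?F b) g'" "g' ` carrier (?F b') = ker c b g"
      "\<forall>f\<in>carrier (?F b'). g' f = \<zero>\<^bsub>?F b\<^esub> \<longrightarrow> (\<forall>i. f i \<in> max_ideal R)"
      using step[OF ker[OF g]] by blast
    then have "P (Suc n) (b, b', g') \<and> Q st (b, b', g')" unfolding P_def Q_def st ker_def by simp
    then show ?thesis by blast
  qed
  ultimately obtain st where st: "\<And>n. P n (st n)" "\<And>n. Q (st n) (st (Suc n))"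
    using dependent_nat_choice[of P "\<lambda>_. Q"] by blast
  \<comment> \<open>The indices are shifted by one: \<open>g n\<close> goes from rank
    \<open>r (Suc n)\<close> to rank \<open>r n\<close> and becomes the differential
    \<open>diff F (Suc n)\<close>.\<close>
  define r where "r i = (case i of 0 \<Rightarrow> b0 | Suc n \<Rightarrow> fst (snd (st n)))" for i
  define g where "g n = snd (snd (st n))" for n
  have fst_st: "fst (st n) = r n" for n
  proof (cases n)
    case 0
    then show ?thesis using st(1)[of 0] unfolding P_def r_def by (auto split: prod.splits)
  next
    case (Suc k)
    then show ?thesis using st(2)[of k] unfolding Q_def r_def by (auto split: prod.splits)
  qed
  have st_eq: "st n = (r n, r (Suc n), g n)" for n
    using fst_st[of n] by (simp add: r_def g_def prod_eq_iff)
  have lin: "linear_map R (?F (r (Suc n))) (?F (r n)) (g n)" for n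
    using st(1)[of n] unfolding P_def st_eq by simp
  have min: "f i \<in> max_ideal R" if "f \<in> ker (r n) (r (Suc n)) (g n)" for f n i
    using st(1)[of n] that unfolding P_def st_eq by simp
  have im0: "g 0 ` carrier (?F (r (Suc 0))) = kere"
    using st(1)[of 0] unfolding P_def st_eq by simp
  have imS: "g (Suc n) ` carrier (?F (r (Suc (Suc n)))) = ker (r n) (r (Suc n)) (g n)" for n
    using st(2)[of n] unfolding Q_def st_eq by simp
  have r0: "r 0 = b0" by (simp add: r_def)
  define F where "F = \<lparr>rank = r,
    diff = (\<lambda>i. restrict (g (i - 1)) (carrier (?F (r i)))),
    aug = restrict e (carrier (?F b0))\<rparr>"
  have resF: "res_module R F i = ?F (r i)" for i by (simp add: res_module_def F_def)
  have augF: "aug F = restrict e (carrier (?F b0))" by (simp add: F_def)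
  have dF: "diff F (Suc n) = restrict (g n) (carrier (?F (r (Suc n))))" for n by (simp add: F_def)
  have im_dF: "diff F (Suc n) ` carrier (?F (r (Suc n))) = g n ` carrier (?F (r (Suc n)))" for n
    unfolding dF by (rule image_cong) auto
  have pos: "(\<forall>i\<ge>1. p i) \<longleftrightarrow> (\<forall>n. p (Suc n))" for p :: "nat \<Rightarrow> bool"
    by (metis Suc_le_D One_nat_def le_add1 plus_1_eq_Suc)
  have "is_resolution R M (res_module R F) (diff F) (aug F)"
    unfolding is_resolution_def pos
  proof (intro conjI allI)
    show "module R (res_module R F i)" for i unfolding resF by (rule Fmod)
    show "diff F (Suc n) \<in> mod_hom R (res_module R F (Suc n)) (res_module R F (Suc n - 1))" for n
      unfolding resF dF diff_Suc_1 by (rule linear_map_restrict_mod_hom[OF lin])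
    show "aug F \<in> mod_hom R (res_module R F 0) M"
      unfolding resF r0 augF by (rule linear_map_restrict_mod_hom[OF e(1)])
    show "aug F ` carrier (res_module R F 0) = carrier M"
      unfolding resF r0 augF using e(2) by simp
    show "a_kernel (res_module R F 0) M (aug F) = diff F 1 ` carrier (res_module R F 1)"
      using im0 im_dF[of 0] unfolding resF a_kernel_def' r0 kere_def augF by (simp cong: conj_cong)
    show "a_kernel (res_module R F (Suc n)) (res_module R F (Suc n - 1)) (diff F (Suc n)) =
        diff F (Suc n + 1) ` carrier (res_module R F (Suc n + 1))" for n
      using imS[of n] im_dF[of "Suc n"] unfolding resF a_kernel_def' ker_def dF[of n]
      by (simp cong: conj_cong del: free_module_simps)
  qed
  moreover have "diff F i ` carrier (res_module R F i) \<subseteq> ideal_smult R (max_ideal R) (res_module R F (i - 1))"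
    if i: "i \<ge> 1" for i
  proof -
    obtain n where n: "i = Suc n" using i by (cases i) auto
    have sub: "g n ` carrier (?F (r (Suc n))) \<subseteq> carrier (?F (r n))"
      using linear_map.map_closed[OF lin] by blast
    have "f j \<in> max_ideal R" if "f \<in> g n ` carrier (?F (r (Suc n)))" for f j
    proof (cases n)
      case 0
      then have "f \<in> kere" using that im0 by simp
      then show ?thesis using e(3) unfolding kere_def by blast
    next
      case (Suc k)
      then show ?thesis using that imS[of k] min by auto
    qed
    then show ?thesis
      unfolding n resF im_dF diff_Suc_1 ideal_smult_free_module[OF m.is_ideal] using sub by blast
  qed
  ultimately show ?thesis unfolding minimal_free_resolution_def by blast
qed

end

section \<open>Tor and exactness\<close>

locale free_resolution = module R M for R (structure) and M (structure) +
  fixes F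
  assumes minimal_res: "minimal_free_resolution R M F"
begin

abbreviation "Fr i \<equiv> free_module R {..<rank F i}"

lemma res_module_eq: "res_module R F i = Fr i"
  by (simp add: res_module_def)

lemma resolution: "is_resolution R M Fr (diff F) (aug F)"
  using minimal_res unfolding minimal_free_resolution_def
  by (simp add: is_resolution_def res_module_eq)

lemma Fr_module: "module R (Fr i)"
  by (rule R.free_module_is_module)

lemma aug_linear: "linear_map R (Fr 0) M (aug F)"
  using resolution unfolding is_resolution_def
  by (intro mod_hom_linear[OF Fr_module module_axioms]) blast

lemma diff_linear: "linear_map R (Fr (Suc i)) (Fr i) (diff F (Suc i))"
proof (rule mod_hom_linear[OF Fr_module Fr_module])
  have "\<forall>i\<ge>1. diff F i \<in> mod_hom R (Fr i) (Fr (i - 1))"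
    using resolution unfolding is_resolution_def by blast
  then show "diff F (Suc i) \<in> mod_hom R (Fr (Suc i)) (Fr i)" by (metis diff_Suc_1 le_add1 plus_1_eq_Suc)
qed

lemma aug_surj: "aug F ` carrier (Fr 0) = carrier M"
  using resolution unfolding is_resolution_def by blast

lemma aug_kernel: "{f \<in> carrier (Fr 0). aug F f = \<zero>\<^bsub>M\<^esub>} = diff F (Suc 0) ` carrier (Fr (Suc 0))"
  using resolution unfolding is_resolution_def a_kernel_def' One_nat_def by blast

lemma diff_kernel: "{f \<in> carrier (Fr (Suc i)). diff F (Suc i) f = \<zero>\<^bsub>Fr i\<^esub>} =
    diff F (Suc (Suc i)) ` carrier (Fr (Suc (Suc i)))"
proof -
  have "\<forall>i\<ge>1. a_kernel (Fr i) (Fr (i - 1)) (diff F i) = diff F (i + 1) ` carrier (Fr (i + 1))"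
    using resolution unfolding is_resolution_def by blast
  from this[rule_format, of "Suc i"] show ?thesis unfolding a_kernel_def' by simp
qed

lemma diff_minimal:
  assumes R: "noetherian_local_ring R" and f: "f \<in> carrier (Fr (Suc i))"
  shows "diff F (Suc i) f t \<in> max_ideal R"
proof -
  interpret m: maximalideal "max_ideal R" R by (rule noetherian_local_maximalideal[OF R])
  have "\<forall>i\<ge>1. diff F i ` carrier (Fr i) \<subseteq> ideal_smult R (max_ideal R) (Fr (i - 1))"
    using minimal_res unfolding minimal_free_resolution_def res_module_eq by blast
  from this[rule_format, of "Suc i"]
  have "diff F (Suc i) ` carrier (Fr (Suc i)) \<subseteq> {f \<in> carrier (Fr i). \<forall>s. f s \<in> max_ideal R}"
    by (simp add: R.ideal_smult_free_module[OF m.is_ideal])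
  then show ?thesis using f by blast
qed

end

text \<open>The presentation lemma is applied to the identity of R^S, whose kernel is zero and hence
  the image of the free module on the empty set.\<close>

lemma (in module) tensor_free:
  obtains \<theta> where "linear_map R (direct_power M S) (tensor R (free_module R S) M) \<theta>"
    "bij_betw \<theta> (carrier (direct_power M S)) (carrier (tensor R (free_module R S) M))"
    "\<And>f n. f \<in> carrier (free_module R S) \<Longrightarrow> n \<in> carrier M \<Longrightarrow>
      \<theta> (outer M f n) = pure_tensor R (free_module R S) M f n"
proof -
  interpret F: module R "free_module R S" by (rule R.free_module_is_module)
  interpret DP: module R "direct_power M S" by (rule direct_power_is_module)
  note [simp del] = R.free_module_simps direct_power_simps
  have "\<exists>d. linear_map R (free_module R ({} :: nat set)) (free_module R S) d"
    by (rule R.free_module_map_exists[OF F.module_axioms, of "{} :: nat set" undefined]) auto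
  then obtain d where d: "linear_map R (free_module R ({} :: nat set)) (free_module R S) d" ..
  obtain D where D: "scalar_ext R M {} S d D" using scalar_ext_exists[OF d] .
  interpret D: scalar_extension R M "{}" S d D by unfold_locales (rule D)
  have F0: "carrier (free_module R ({} :: nat set)) = {\<zero>\<^bsub>free_module R {}\<^esub>}"
    by (auto simp: free_module_def)
  have M0: "carrier (direct_power M ({} :: nat set)) = {\<zero>\<^bsub>direct_power M {}\<^esub>}"
    by (auto simp: direct_power_def)
  have ker: "{f \<in> carrier (free_module R S). f = \<zero>\<^bsub>free_module R S\<^esub>} = d ` carrier (free_module R {})"
    unfolding F0 by (auto simp: D.d.map_zero)
  obtain \<theta> where \<theta>: "linear_map R (direct_power M S) (tensor R (free_module R S) M) \<theta>"
    "\<theta> ` carrier (direct_power M S) = carrier (tensor R (free_module R S) M)"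
    "{u \<in> carrier (direct_power M S). \<theta> u = \<zero>\<^bsub>tensor R (free_module R S) M\<^esub>} = D ` carrier (direct_power M {})"
    "\<And>f n. f \<in> carrier (free_module R S) \<Longrightarrow> n \<in> carrier M \<Longrightarrow>
      \<theta> (outer M f n) = pure_tensor R (free_module R S) M f n"
    using tensor_presentation[OF F.linear_map_id image_ident module_axioms D ker] by blast
  interpret \<theta>: linear_map R "direct_power M S" "tensor R (free_module R S) M" \<theta> by (rule \<theta>(1))
  have ker0: "{u \<in> carrier (direct_power M S). \<theta> u = \<zero>\<^bsub>tensor R (free_module R S) M\<^esub>} = {\<zero>\<^bsub>direct_power M S\<^esub>}"
    unfolding \<theta>(3) M0 by (simp add: D.D.map_zero)
  have "inj_on \<theta> (carrier (direct_power M S))"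
  proof (rule inj_onI)
    fix u v assume u: "u \<in> carrier (direct_power M S)" and v: "v \<in> carrier (direct_power M S)" and eq: "\<theta> u = \<theta> v"
    have "\<theta> (u \<ominus>\<^bsub>direct_power M S\<^esub> v) = \<zero>\<^bsub>tensor R (free_module R S) M\<^esub>"
      using \<theta>.map_diff[OF u v] eq \<theta>.map_closed[OF v] by (simp add: \<theta>.P.M.minus_eq \<theta>.P.M.r_neg)
    then have "u \<ominus>\<^bsub>direct_power M S\<^esub> v = \<zero>\<^bsub>direct_power M S\<^esub>"
      using ker0 DP.M.minus_closed[OF u v] by blast
    then show "u = v" by (rule DP.diff_zero_imp_eq[OF u v])
  qed
  then show thesis using that[OF \<theta>(1) _ \<theta>(4)] \<theta>(2) unfolding bij_betw_def by blast
qed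

lemma (in module) tensor_free_natural:
  assumes G: "scalar_ext R M S T g G"
    and \<theta>: "linear_map R (direct_power M S) (tensor R (free_module R S) M) \<theta>"
      "\<And>f n. f \<in> carrier (free_module R S) \<Longrightarrow> n \<in> carrier M \<Longrightarrow>
        \<theta> (outer M f n) = pure_tensor R (free_module R S) M f n"
    and \<theta>': "linear_map R (direct_power M T) (tensor R (free_module R T) M) \<theta>'"
      "\<And>f n. f \<in> carrier (free_module R T) \<Longrightarrow> n \<in> carrier M \<Longrightarrow>
        \<theta>' (outer M f n) = pure_tensor R (free_module R T) M f n"
    and v: "v \<in> carrier (direct_power M S)"
  shows "tensor_map R (free_module R S) (free_module R T) M g (\<theta> v) = \<theta>' (G v)"
proof -
  interpret G: scalar_extension R M S T g G by unfold_locales (rule G)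
  note spec = tensor_map_spec[OF G.d.linear_map_axioms module_axioms]
  show ?thesis
  proof (rule direct_power_map_eqI[OF linear_map_comp[OF \<theta>(1) spec(1)]
        linear_map_comp[OF G.D.linear_map_axioms \<theta>'(1)] _ v])
    fix s n assume s: "s \<in> S" and n: "n \<in> carrier M"
    have gen: "free_gen R s \<in> carrier (free_module R S)" by (rule R.free_gen_closed[OF s])
    show "tensor_map R (free_module R S) (free_module R T) M g (\<theta> (single M s n)) = \<theta>' (G (single M s n))"
      using \<theta>(2)[OF gen n] \<theta>'(2)[OF G.d.map_closed[OF gen] n] spec(2)[OF gen n]
      by (simp add: outer_gen[OF n] G.ext_single[OF s n])
  qed
qed

text \<open>Exactness moves from the tensor products in the definition of Tor to direct powers,
  where it can be handled by coordinates. The isomorphisms commute with the maps by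
  \<open>tensor_free_natural\<close>.\<close>

lemma (in module) tensor_exact_imp:
  assumes D: "scalar_ext R M S T d D" and D': "scalar_ext R M T U d' D'"
    and exact: "{z \<in> carrier (tensor R (free_module R T) M).
        tensor_map R (free_module R T) (free_module R U) M d' z = \<zero>\<^bsub>tensor R (free_module R U) M\<^esub>}
      \<subseteq> tensor_map R (free_module R S) (free_module R T) M d ` carrier (tensor R (free_module R S) M)"
    and u: "u \<in> carrier (direct_power M T)" "D' u = \<zero>\<^bsub>direct_power M U\<^esub>"
  shows "u \<in> D ` carrier (direct_power M S)"
proof -
  interpret D: scalar_extension R M S T d D by unfold_locales (rule D)
  interpret D': scalar_extension R M T U d' D' by unfold_locales (rule D')
  obtain \<theta>S where \<theta>S: "linear_map R (direct_power M S) (tensor R (free_module R S) M) \<theta>S"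
    "bij_betw \<theta>S (carrier (direct_power M S)) (carrier (tensor R (free_module R S) M))"
    "\<And>f n. f \<in> carrier (free_module R S) \<Longrightarrow> n \<in> carrier M \<Longrightarrow>
      \<theta>S (outer M f n) = pure_tensor R (free_module R S) M f n"
    using tensor_free[of S] by blast
  obtain \<theta>T where \<theta>T: "linear_map R (direct_power M T) (tensor R (free_module R T) M) \<theta>T"
    "bij_betw \<theta>T (carrier (direct_power M T)) (carrier (tensor R (free_module R T) M))"
    "\<And>f n. f \<in> carrier (free_module R T) \<Longrightarrow> n \<in> carrier M \<Longrightarrow>
      \<theta>T (outer M f n) = pure_tensor R (free_module R T) M f n"
    using tensor_free[of T] by blast
  obtain \<theta>U where \<theta>U: "linear_map R (direct_power M U) (tensor R (free_module R U) M) \<theta>U"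
    "bij_betw \<theta>U (carrier (direct_power M U)) (carrier (tensor R (free_module R U) M))"
    "\<And>f n. f \<in> carrier (free_module R U) \<Longrightarrow> n \<in> carrier M \<Longrightarrow>
      \<theta>U (outer M f n) = pure_tensor R (free_module R U) M f n"
    using tensor_free[of U] by blast
  have "tensor_map R (free_module R T) (free_module R U) M d' (\<theta>T u) = \<zero>\<^bsub>tensor R (free_module R U) M\<^esub>"
    using tensor_free_natural[OF D' \<theta>T(1,3) \<theta>U(1,3) u(1)] u(2) linear_map.map_zero[OF \<theta>U(1)] by simp
  moreover have "\<theta>T u \<in> carrier (tensor R (free_module R T) M)"
    by (rule linear_map.map_closed[OF \<theta>T(1) u(1)])
  ultimately have "\<theta>T u \<in> tensor_map R (free_module R S) (free_module R T) M d ` carrier (tensor R (free_module R S) M)"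
    using exact by blast
  then obtain z where z: "z \<in> carrier (tensor R (free_module R S) M)"
    "\<theta>T u = tensor_map R (free_module R S) (free_module R T) M d z" by blast
  obtain v where v: "v \<in> carrier (direct_power M S)" "z = \<theta>S v"
    using z(1) \<theta>S(2) unfolding bij_betw_def by blast
  have "\<theta>T u = \<theta>T (D v)" using z(2) v(2) tensor_free_natural[OF D \<theta>S(1,3) \<theta>T(1,3) v(1)] by simp
  then have "u = D v"
    using \<theta>T(2) u(1) D.D.map_closed[OF v(1)] unfolding bij_betw_def inj_on_def by blast
  then show ?thesis using v(1) by blast
qed

text \<open>Over R itself f tensor n is n f, so a map is its own extension. This makes the case N =
  R available without any tensor product.\<close>

lemma (in cring) scalar_ext_self:
  assumes d: "linear_map R (free_module R S) (free_module R T) d"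
  shows "scalar_ext R (self_module R) S T d d"
proof -
  interpret d: linear_map R "free_module R S" "free_module R T" d by (rule d)
  have "d (outer (self_module R) f n) = outer (self_module R) (d f) n"
    if f: "f \<in> carrier (free_module R S)" and n: "n \<in> carrier R" for f n
  proof -
    have "outer (self_module R) f n = n \<odot>\<^bsub>free_module R S\<^esub> f"
      using free_module_apply[OF f] n by (auto simp: outer_def m_comm)
    moreover have "outer (self_module R) (d f) n = n \<odot>\<^bsub>free_module R T\<^esub> d f"
      using free_module_apply[OF d.map_closed[OF f]] n by (auto simp: outer_def m_comm)
    ultimately show ?thesis using d.map_smult[OF n f] by simp
  qed
  then show ?thesis unfolding scalar_ext_def using d by (simp add: free_module_eq)
qed

lemma (in module) exact_modI:
  assumes E: "scalar_ext R M T S e E"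
    and exact: "\<And>u. u \<in> carrier (direct_power M S) \<Longrightarrow> D u = \<zero>\<^bsub>direct_power M T\<^esub> \<Longrightarrow>
      u \<in> E ` carrier (direct_power M T)"
  shows "exact_mod M S T D E {\<zero>\<^bsub>M\<^esub>}"
  unfolding exact_mod_def powers_in_zero
proof (intro ballI impI)
  interpret E: scalar_extension R M T S e E by unfold_locales (rule E)
  fix u assume u: "u \<in> carrier (direct_power M S)" "D u \<in> {\<zero>\<^bsub>direct_power M T\<^esub>}"
  then obtain v where v: "v \<in> carrier (direct_power M T)" "u = E v" using exact by blast
  have "u \<ominus>\<^bsub>direct_power M S\<^esub> E v = \<zero>\<^bsub>direct_power M S\<^esub>"
    unfolding v(2)[symmetric] using u(1) by (simp add: E.D.P.M.minus_eq E.D.P.M.r_neg del: direct_power_simps)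
  then show "\<exists>v\<in>carrier (direct_power M T). u \<ominus>\<^bsub>direct_power M S\<^esub> E v \<in> {\<zero>\<^bsub>direct_power M S\<^esub>}"
    using v(1) by blast
qed

section \<open>Two-periodic modules\<close>

text \<open>Free modules are projective: preimages are chosen for the basis vectors and extended
  linearly.\<close>

lemma (in cring) free_module_lift:
  assumes f: "linear_map R (free_module R S) P f" and g: "linear_map R Q P g"
    and sub: "f ` carrier (free_module R S) \<subseteq> g ` carrier Q"
  obtains h where "linear_map R (free_module R S) Q h"
    "\<And>x. x \<in> carrier (free_module R S) \<Longrightarrow> g (h x) = f x"
proof -
  interpret g: linear_map R Q P g by (rule g)
  have "\<exists>y. y \<in> carrier Q \<and> g y = f (free_gen R s)" if s: "s \<in> S" for s
  proof -
    have "f (free_gen R s) \<in> g ` carrier Q" using sub imageI[OF free_gen_closed[OF s], of f] by blast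
    then show ?thesis by (auto simp: image_iff)
  qed
  then obtain p where p: "\<And>s. s \<in> S \<Longrightarrow> p s \<in> carrier Q \<and> g (p s) = f (free_gen R s)" by metis
  then obtain h where h: "linear_map R (free_module R S) Q h" "\<And>s. s \<in> S \<Longrightarrow> h (free_gen R s) = p s"
    using free_module_map_exists[OF g.M.module_axioms, of S p] by blast
  have "g (h x) = f x" if "x \<in> carrier (free_module R S)" for x
    by (rule free_module_map_eqI[OF linear_map_comp[OF h(1) g] f _ that]) (use h(2) p in simp)
  then show thesis using that h(1) by blast
qed

context module
begin

lemma scalar_ext_comp:
  assumes "scalar_ext R M S T d D" "scalar_ext R M T U e E"
  shows "scalar_ext R M S U (\<lambda>f. e (d f)) (\<lambda>u. E (D u))"
proof -
  interpret D: scalar_extension R M S T d D by unfold_locales fact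
  interpret E: scalar_extension R M T U e E by unfold_locales fact
  show ?thesis
    unfolding scalar_ext_def
    using linear_map_comp[OF D.d.linear_map_axioms E.d.linear_map_axioms]
      linear_map_comp[OF D.D.linear_map_axioms E.D.linear_map_axioms]
      D.ext_outer E.ext_outer[OF D.d.map_closed] by simp
qed

lemma scalar_ext_cong:
  assumes "scalar_ext R M S T d D" "scalar_ext R M S T e E"
    and eq: "\<And>f. f \<in> carrier (free_module R S) \<Longrightarrow> d f = e f"
    and u: "u \<in> carrier (direct_power M S)"
  shows "D u = E u"
proof -
  interpret D: scalar_extension R M S T d D by unfold_locales fact
  interpret E: scalar_extension R M S T e E by unfold_locales fact
  show ?thesis
    by (rule direct_power_map_eqI[OF D.D.linear_map_axioms E.D.linear_map_axioms _ u])
      (simp add: D.ext_single E.ext_single eq R.free_gen_closed)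
qed

lemma scalar_ext_zero:
  assumes "scalar_ext R M S T d D"
    and zero: "\<And>f. f \<in> carrier (free_module R S) \<Longrightarrow> d f = \<zero>\<^bsub>free_module R T\<^esub>"
    and u: "u \<in> carrier (direct_power M S)"
  shows "D u = \<zero>\<^bsub>direct_power M T\<^esub>"
proof -
  interpret D: scalar_extension R M S T d D by unfold_locales fact
  have "D u \<in> {\<zero>\<^bsub>direct_power M T\<^esub>}"
  proof (rule D.ext_mem[OF u D.D.P.zero_submodule])
    fix s assume s: "s \<in> S"
    show "outer M (d (free_gen R s)) (u s) \<in> {\<zero>\<^bsub>direct_power M T\<^esub>}"
      unfolding zero[OF R.free_gen_closed[OF s]]
      using linear_map.map_zero[OF outer_linear_left[OF direct_power_apply[OF u]]] by blast
  qed
  then show ?thesis by simp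
qed

text \<open>Applied to the composite of two comparison maps between resolutions, which differs from
  the identity by boundaries.\<close>

lemma scalar_ext_diff_id:
  assumes "scalar_ext R M S S d D"
  shows "scalar_ext R M S S (\<lambda>f. f \<ominus>\<^bsub>free_module R S\<^esub> d f) (\<lambda>u. u \<ominus>\<^bsub>direct_power M S\<^esub> D u)"
proof -
  interpret D: scalar_extension R M S S d D by unfold_locales fact
  have "outer M f n \<ominus>\<^bsub>direct_power M S\<^esub> D (outer M f n) = outer M (f \<ominus>\<^bsub>free_module R S\<^esub> d f) n"
    if f: "f \<in> carrier (free_module R S)" and n: "n \<in> carrier M" for f n
    using linear_map.map_diff[OF outer_linear_left[OF n] f D.d.map_closed[OF f]] D.ext_outer[OF f n]
    by simp
  then show ?thesis
    unfolding scalar_ext_def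
    using linear_map_diff[OF D.d.M.linear_map_id D.d.linear_map_axioms]
      linear_map_diff[OF D.D.M.linear_map_id D.D.linear_map_axioms] by blast
qed

text \<open>The complexes \<open>d3, d2\<close> and \<open>d1, e\<close> begin free resolutions of the cokernel of \<open>e\<close>. Comparison
  maps \<open>a\<close> and \<open>b\<close> carry exactness of the first after extension to \<open>M\<close> over to the second.\<close>

lemma exact_by_comparison:
  assumes e: "scalar_ext R M T S e E" and d1: "scalar_ext R M S T d1 D1"
    and d2: "scalar_ext R M U S d2 D2" and d3: "scalar_ext R M V U d3 D3"
    and im: "e ` carrier (free_module R T) = d2 ` carrier (free_module R U)"
    and ker: "{f \<in> carrier (free_module R T). e f = \<zero>\<^bsub>free_module R S\<^esub>} \<subseteq> d1 ` carrier (free_module R S)"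
    and complex: "\<And>f. f \<in> carrier (free_module R V) \<Longrightarrow> d2 (d3 f) = \<zero>\<^bsub>free_module R S\<^esub>"
    and exact: "\<And>u. u \<in> carrier (direct_power M U) \<Longrightarrow> D2 u = \<zero>\<^bsub>direct_power M S\<^esub> \<Longrightarrow>
      u \<in> D3 ` carrier (direct_power M V)"
    and u: "u \<in> carrier (direct_power M T)" "E u = \<zero>\<^bsub>direct_power M S\<^esub>"
  shows "u \<in> D1 ` carrier (direct_power M S)"
proof -
  interpret FT: module R "free_module R T" by (rule R.free_module_is_module)
  interpret MT: module R "direct_power M T" by (rule direct_power_is_module)
  interpret e: scalar_extension R M T S e E by unfold_locales (rule e)
  interpret d1: scalar_extension R M S T d1 D1 by unfold_locales (rule d1)
  interpret d2: scalar_extension R M U S d2 D2 by unfold_locales (rule d2)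
  interpret d3: scalar_extension R M V U d3 D3 by unfold_locales (rule d3)
  note [simp del] = R.free_module_simps direct_power_simps
  \<comment> \<open>The images of \<open>e\<close> and \<open>d2\<close> agree, so freeness gives
    lifts in both directions, with d2 a = e and e b = d2.\<close>
  obtain a where a: "linear_map R (free_module R T) (free_module R U) a"
    "\<And>f. f \<in> carrier (free_module R T) \<Longrightarrow> d2 (a f) = e f"
    using R.free_module_lift[OF e.d.linear_map_axioms d2.d.linear_map_axioms equalityD1[OF im]] by blast
  obtain b where b: "linear_map R (free_module R U) (free_module R T) b"
    "\<And>f. f \<in> carrier (free_module R U) \<Longrightarrow> e (b f) = d2 f"
    using R.free_module_lift[OF d2.d.linear_map_axioms e.d.linear_map_axioms equalityD2[OF im]] by blast
  obtain A where A: "scalar_ext R M T U a A" using scalar_ext_exists[OF a(1)] .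
  obtain B where B: "scalar_ext R M U T b B" using scalar_ext_exists[OF b(1)] .
  interpret A: scalar_extension R M T U a A by unfold_locales (rule A)
  interpret B: scalar_extension R M U T b B by unfold_locales (rule B)
  have "D2 (A u) = E u" by (rule scalar_ext_cong[OF scalar_ext_comp[OF A d2] e a(2) u(1)])
  then have "A u \<in> D3 ` carrier (direct_power M V)" using exact[OF A.D.map_closed[OF u(1)]] u(2) by simp
  then obtain v where v: "v \<in> carrier (direct_power M V)" "A u = D3 v" by blast
  interpret bd3: scalar_extension R M V T "\<lambda>f. b (d3 f)" "\<lambda>u. B (D3 u)"
    by unfold_locales (rule scalar_ext_comp[OF d3 B])
  \<comment> \<open>Here e b d3 = d2 d3 = 0, so b d3 takes values in the image of \<open>d1\<close>.
    This persists after extension and puts B A u into the image of \<open>D1\<close>.\<close>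
  have "(\<lambda>f. b (d3 f)) ` carrier (free_module R V) \<subseteq> d1 ` carrier (free_module R S)"
  proof (rule image_subsetI)
    fix f assume f: "f \<in> carrier (free_module R V)"
    have "e (b (d3 f)) = \<zero>\<^bsub>free_module R S\<^esub>"
      using b(2)[OF d3.d.map_closed[OF f]] complex[OF f] by simp
    then show "b (d3 f) \<in> d1 ` carrier (free_module R S)"
      using B.d.map_closed[OF d3.d.map_closed[OF f]] by (intro subsetD[OF ker]) simp
  qed
  from subsetD[OF bd3.ext_image_subset[OF d1 this] imageI[OF v(1)]]
  have BA: "B (A u) \<in> D1 ` carrier (direct_power M S)" unfolding v(2) .
  interpret c: scalar_extension R M T T "\<lambda>f. f \<ominus>\<^bsub>free_module R T\<^esub> b (a f)" "\<lambda>u. u \<ominus>\<^bsub>direct_power M T\<^esub> B (A u)"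
    by unfold_locales (rule scalar_ext_diff_id[OF scalar_ext_comp[OF A B]])
  \<comment> \<open>Since e b a = d2 a = e, the map 1 - b a also lands in the kernel of
    \<open>e\<close>. Thus both u - B A u and B A u are in the image of \<open>D1\<close>.\<close>
  have "(\<lambda>f. f \<ominus>\<^bsub>free_module R T\<^esub> b (a f)) ` carrier (free_module R T) \<subseteq> d1 ` carrier (free_module R S)"
  proof (rule image_subsetI)
    fix f assume f: "f \<in> carrier (free_module R T)"
    have baf: "b (a f) \<in> carrier (free_module R T)" by (rule B.d.map_closed[OF A.d.map_closed[OF f]])
    have "e (f \<ominus>\<^bsub>free_module R T\<^esub> b (a f)) = \<zero>\<^bsub>free_module R S\<^esub>"
      using e.d.map_diff[OF f baf] b(2)[OF A.d.map_closed[OF f]] a(2)[OF f] e.d.map_closed[OF f]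
      by (simp add: e.d.P.M.minus_eq e.d.P.M.r_neg)
    then show "f \<ominus>\<^bsub>free_module R T\<^esub> b (a f) \<in> d1 ` carrier (free_module R S)"
      using FT.M.minus_closed[OF f baf] by (intro subsetD[OF ker]) simp
  qed
  from subsetD[OF c.ext_image_subset[OF d1 this] imageI[OF u(1)]]
  have "u \<ominus>\<^bsub>direct_power M T\<^esub> B (A u) \<in> D1 ` carrier (direct_power M S)" .
  then show ?thesis
    by (rule MT.submodule_diff_cancel[OF d1.D.image_submodule[OF e.D.P.carrier_is_submodule] BA u(1)])
qed

end

lemma depth_zero_module: "zero_module M \<Longrightarrow> depth R M = \<infinity>"
  by (simp add: depth_def)

lemma (in tensor_modules) zero_module_tensor:
  assumes "zero_module M"
  shows "zero_module T"
proof -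
  have "pure x y = \<zero>\<^bsub>T\<^esub>" if "x \<in> carrier M" "y \<in> carrier N" for x y
    using linear_map.map_zero[OF pure_linear_left[OF that(2)]] that(1) assms
    unfolding zero_module_def by simp
  then have "carrier T \<subseteq> {\<zero>\<^bsub>T\<^esub>}"
    using tensor_mem_submodule[OF T.zero_submodule] by blast
  then show ?thesis unfolding zero_module_def using T.M.zero_closed by blast
qed

text \<open>Stated at degree \<open>Suc i\<close>, so that the degree is positive; there the
  vanishing of Tor makes every cycle of the tensored resolution a boundary.\<close>

lemma tor_zero_exact:
  assumes M: "module R M" and N: "module R N" and tor: "tor_independent R M N"
    and res: "minimal_free_resolution R M (min_res R M)"
  defines "F \<equiv> min_res R M"
  shows "{z \<in> carrier (tensor R (res_module R F (Suc i)) N).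
      tensor_map R (res_module R F (Suc i)) (res_module R F i) N (diff F (Suc i)) z
        = \<zero>\<^bsub>tensor R (res_module R F i) N\<^esub>}
    \<subseteq> tensor_map R (res_module R F (Suc (Suc i))) (res_module R F (Suc i)) N (diff F (Suc (Suc i)))
      ` carrier (tensor R (res_module R F (Suc (Suc i))) N)"
proof -
  interpret fr: free_resolution R M F
    unfolding F_def by (rule free_resolution.intro[OF M free_resolution_axioms.intro[OF res]])
  let ?C = "\<lambda>j. tensor R (res_module R F j) N"
  let ?bd = "\<lambda>j. tensor_map R (res_module R F j) (res_module R F (j - 1)) N (diff F j)"
  have C: "module R (?C j)" for j
    unfolding fr.res_module_eq
    using tensor_modules.intro[OF fr.Fr_module N] linear_map.axioms(2)[OF tensor_modules.pure_linear_left]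
      module.carrier_is_submodule[OF N] by (metis N abelian_group.axioms(1) abelian_monoid.zero_closed module.axioms(2))
  have bd: "linear_map R (?C (Suc j)) (?C j) (?bd (Suc j))" for j
    unfolding fr.res_module_eq diff_Suc_1 by (rule tensor_map_spec(1)[OF fr.diff_linear N])
  have "zero_module (tor R M N (Suc i))" using tor unfolding tor_independent_def by simp
  then have "zero_module (homology (?C (Suc i)) (a_kernel (?C (Suc i)) (?C i) (?bd (Suc i)))
      (?bd (Suc (Suc i)) ` carrier (?C (Suc (Suc i)))))"
    unfolding tor_def F_def[symmetric] Let_def by simp
  then have "a_kernel (?C (Suc i)) (?C i) (?bd (Suc i)) \<subseteq> ?bd (Suc (Suc i)) ` carrier (?C (Suc (Suc i)))"
  proof (rule zero_homology_subset[OF C, rotated 2])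
    show "a_kernel (?C (Suc i)) (?C i) (?bd (Suc i)) \<subseteq> carrier (?C (Suc i))"
      unfolding a_kernel_def' by blast
    interpret b: linear_map R "?C (Suc (Suc i))" "?C (Suc i)" "?bd (Suc (Suc i))" by (rule bd)
    show "\<zero>\<^bsub>?C (Suc i)\<^esub> \<in> ?bd (Suc (Suc i)) ` carrier (?C (Suc (Suc i)))"
      using imageI[OF b.M.M.zero_closed, of "?bd (Suc (Suc i))"] unfolding b.map_zero .
  qed
  then show ?thesis unfolding a_kernel_def' by simp
qed

text \<open>\<open>P\<close> is to be R or N. The composites vanish over \<open>P\<close> because
  they vanish over R, and minimality comes from the resolution; exactness over \<open>P\<close> is
  the part that has to be supplied.\<close>

lemma (in free_resolution) periodic_pairI:
  assumes local: "noetherian_local_ring R" and P: "fg_module R P"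
    and D: "scalar_ext R P {..<rank F (Suc 0)} {..<rank F 0} (diff F (Suc 0)) D"
    and E: "scalar_ext R P {..<rank F 0} {..<rank F (Suc 0)} e E"
    and ker_d: "{f \<in> carrier (Fr (Suc 0)). diff F (Suc 0) f = \<zero>\<^bsub>Fr 0\<^esub>} = e ` carrier (Fr 0)"
    and ker_e: "{f \<in> carrier (Fr 0). e f = \<zero>\<^bsub>Fr (Suc 0)\<^esub>} = diff F (Suc 0) ` carrier (Fr (Suc 0))"
    and nonempty: "{..<rank F (Suc 0)} \<noteq> {}" "{..<rank F 0} \<noteq> {}"
    and exD: "\<And>u. u \<in> carrier (direct_power P {..<rank F (Suc 0)}) \<Longrightarrow>
      D u = \<zero>\<^bsub>direct_power P {..<rank F 0}\<^esub> \<Longrightarrow> u \<in> E ` carrier (direct_power P {..<rank F 0})"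
    and exE: "\<And>u. u \<in> carrier (direct_power P {..<rank F 0}) \<Longrightarrow>
      E u = \<zero>\<^bsub>direct_power P {..<rank F (Suc 0)}\<^esub> \<Longrightarrow> u \<in> D ` carrier (direct_power P {..<rank F (Suc 0)})"
  shows "minimal_periodic_pair R P {..<rank F (Suc 0)} {..<rank F 0} (diff F (Suc 0)) D e E"
proof -
  interpret P: module R P using P unfolding fg_module_def by blast
  note [simp del] = R.free_module_simps direct_power_simps
  have "diff F (Suc 0) (e f) = \<zero>\<^bsub>Fr 0\<^esub>" if "f \<in> carrier (Fr 0)" for f
    using imageI[OF that, of e] unfolding ker_d[symmetric] by blast
  then have DE: "D (E v) = \<zero>\<^bsub>direct_power P {..<rank F 0}\<^esub>"
    if "v \<in> carrier (direct_power P {..<rank F 0})" for v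
    by (rule P.scalar_ext_zero[OF P.scalar_ext_comp[OF E D] _ that])
  have "e (diff F (Suc 0) f) = \<zero>\<^bsub>Fr (Suc 0)\<^esub>" if "f \<in> carrier (Fr (Suc 0))" for f
    using imageI[OF that, of "diff F (Suc 0)"] unfolding ker_e[symmetric] by blast
  then have ED: "E (D u) = \<zero>\<^bsub>direct_power P {..<rank F (Suc 0)}\<^esub>"
    if "u \<in> carrier (direct_power P {..<rank F (Suc 0)})" for u
    by (rule P.scalar_ext_zero[OF P.scalar_ext_comp[OF D E] _ that])
  have ex: "exact_mod P {..<rank F (Suc 0)} {..<rank F 0} D E {\<zero>\<^bsub>P\<^esub>}"
    "exact_mod P {..<rank F 0} {..<rank F (Suc 0)} E D {\<zero>\<^bsub>P\<^esub>}"
    using P.exact_modI[OF E exD] P.exact_modI[OF D exE] by blast+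
  show ?thesis
    by (intro minimal_periodic_pair.intro periodic_pair.intro periodic_pair_axioms.intro
        fg_local_module.intro fg_local_module_axioms.intro minimal_periodic_pair_axioms.intro
        P.module_axioms D E DE ED ex nonempty finite_lessThan diff_minimal[OF local] local P)
qed

theorem theorem2:
  fixes R :: "('r, 's) ring_scheme"
    and M :: "('r, 'm, 'c) module_scheme"
    and N :: "('r, 'n, 'd) module_scheme"
  assumes "noetherian_local_ring R"
    and "depth R (self_module R) > 0"
    and "fg_module R M"
    and "two_periodic R M"
    and "Gdim R M < \<infinity>"
    and "fg_module R N"
    and "tor_independent R M N"
  shows "depth R M + depth R N = depth R (self_module R) + depth R (tensor R M N)"
proof -
  note local = assms(1)
  interpret M: module R M using assms(3) unfolding fg_module_def by blast
  interpret N: module R N using assms(6) unfolding fg_module_def by blast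
  interpret t: tensor_modules R M N by unfold_locales
  show ?thesis
  proof (cases "zero_module M")
    case True
    \<comment> \<open>With M zero, its depth and that of the tensor product are infinite, hence so
      are both sums.\<close>
    then show ?thesis using t.zero_module_tensor by (simp add: depth_zero_module)
  next
    case nz: False
    define F where "F = min_res R M"
    have res: "minimal_free_resolution R M F"
      unfolding F_def min_res_def
      by (rule someI_ex[OF M.R.minimal_free_resolution_exists[OF local assms(3)]])
    interpret fr: free_resolution R M F by unfold_locales (rule res)
    let ?T = "{..<rank F 0}" and ?S = "{..<rank F (Suc 0)}"
    let ?d1 = "diff F (Suc 0)" and ?d2 = "diff F (Suc (Suc 0))" and ?d3 = "diff F (Suc (Suc (Suc 0)))"
    note [simp del] = M.R.free_module_simps direct_power_simps
    interpret aug: linear_map R "fr.Fr 0" M "aug F" by (rule fr.aug_linear)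
    interpret d2: linear_map R "fr.Fr (Suc (Suc 0))" "fr.Fr (Suc 0)" ?d2 by (rule fr.diff_linear)
    define Y where "Y = syzygy R M 2"
    have Y: "Y = (fr.Fr (Suc 0))\<lparr>carrier := ?d2 ` carrier (fr.Fr (Suc (Suc 0)))\<rparr>"
      unfolding Y_def syzygy_def Let_def F_def[symmetric] fr.res_module_eq by (simp add: numeral_2_eq_2)
    obtain \<iota> where \<iota>: "\<iota> \<in> mod_hom R M Y" "bij_betw \<iota> (carrier M) (carrier Y)"
      using assms(4) unfolding two_periodic_def mod_isomorphic_def Y_def by blast
    have im_\<iota>: "\<iota> ` carrier M = ?d2 ` carrier (fr.Fr (Suc (Suc 0)))"
      using \<iota>(2) unfolding bij_betw_def Y by simp
    have lin_\<iota>: "linear_map R M (fr.Fr (Suc 0)) \<iota>"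
    proof (rule linear_map.intro[OF M.module_axioms fr.Fr_module], unfold_locales)
      show "\<iota> x \<in> carrier (fr.Fr (Suc 0))" if "x \<in> carrier M" for x
        using imageI[OF that, of \<iota>] unfolding im_\<iota> by (elim imageE) simp
    qed (use \<iota>(1) in \<open>auto simp: mod_hom_def Y\<close>)
    interpret \<iota>: linear_map R M "fr.Fr (Suc 0)" \<iota> by (rule lin_\<iota>)
    \<comment> \<open>This is F_0 onto M, followed by M onto its second syzygy inside F_1. Its image
      is that of \<open>?d2\<close> and its kernel that of the augmentation, which closes the
      resolution to a complex of period two.\<close>
    define e where "e f = \<iota> (aug F f)" for f
    have e: "linear_map R (fr.Fr 0) (fr.Fr (Suc 0)) e"
      unfolding e_def by (rule linear_map_comp[OF fr.aug_linear lin_\<iota>])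
    have im_e: "e ` carrier (fr.Fr 0) = ?d2 ` carrier (fr.Fr (Suc (Suc 0)))"
      unfolding im_\<iota>[symmetric] fr.aug_surj[symmetric] e_def by (simp add: image_image)
    have "\<iota> x = \<zero>\<^bsub>fr.Fr (Suc 0)\<^esub> \<longleftrightarrow> x = \<zero>\<^bsub>M\<^esub>" if "x \<in> carrier M" for x
      using inj_onD[OF bij_betw_imp_inj_on[OF \<iota>(2)], of x "\<zero>\<^bsub>M\<^esub>"] that by auto
    then have ker_e: "{f \<in> carrier (fr.Fr 0). e f = \<zero>\<^bsub>fr.Fr (Suc 0)\<^esub>} = ?d1 ` carrier (fr.Fr (Suc 0))"
      unfolding fr.aug_kernel[symmetric] e_def by auto
    have ker_d1: "{f \<in> carrier (fr.Fr (Suc 0)). ?d1 f = \<zero>\<^bsub>fr.Fr 0\<^esub>} = e ` carrier (fr.Fr 0)"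
      unfolding im_e by (rule fr.diff_kernel)
    have "carrier (fr.Fr 0) = {\<zero>\<^bsub>fr.Fr 0\<^esub>}" if "?T = {}"
      unfolding that by (auto simp: free_module_def)
    \<comment> \<open>If F_0 were zero, M would be zero as its image; if F_1 were zero, the
      embedding \<open>\<iota>\<close> would give the same.\<close>
    then have neT: "?T \<noteq> {}"
      using nz fr.aug_surj aug.map_zero unfolding zero_module_def by (metis image_empty image_insert)
    have "carrier (fr.Fr (Suc 0)) = {\<zero>\<^bsub>fr.Fr (Suc 0)\<^esub>}" if "?S = {}"
      unfolding that by (auto simp: free_module_def)
    moreover have "\<exists>x\<in>carrier M. \<iota> x \<noteq> \<zero>\<^bsub>fr.Fr (Suc 0)\<^esub>"
      using \<open>\<And>x. x \<in> carrier M \<Longrightarrow> \<iota> x = \<zero>\<^bsub>fr.Fr (Suc 0)\<^esub> \<longleftrightarrow> x = \<zero>\<^bsub>M\<^esub>\<close> nz M.M.zero_closed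
      unfolding zero_module_def by blast
    ultimately have neS: "?S \<noteq> {}" using \<iota>.map_closed by blast
    have "depth R M = depth R (self_module R)"
    proof -
      \<comment> \<open>Over R the complex is exact by \<open>ker_d1\<close> and
        \<open>ker_e\<close>, and the augmentation presents M as the cokernel of
        \<open>?d1\<close>.\<close>
      interpret p: minimal_periodic_pair R "self_module R" ?S ?T ?d1 ?d1 e e
        by (rule fr.periodic_pairI[OF local M.R.fg_self_module M.R.scalar_ext_self[OF fr.diff_linear]
              M.R.scalar_ext_self[OF e] ker_d1 ker_e neS neT])
          (use ker_d1 ker_e in \<open>auto simp: free_module_eq\<close>)
      show ?thesis
        by (rule p.depth_cokernel) (use fr.aug_linear fr.aug_surj fr.aug_kernel in \<open>auto simp: free_module_eq\<close>)
    qed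
    moreover have "depth R (tensor R M N) = depth R N"
    proof -
      obtain D1 where D1: "scalar_ext R N ?S ?T ?d1 D1" using N.scalar_ext_exists[OF fr.diff_linear] .
      obtain D2 where D2: "scalar_ext R N {..<rank F (Suc (Suc 0))} ?S ?d2 D2"
        using N.scalar_ext_exists[OF fr.diff_linear] .
      obtain D3 where D3: "scalar_ext R N {..<rank F (Suc (Suc (Suc 0)))} {..<rank F (Suc (Suc 0))} ?d3 D3"
        using N.scalar_ext_exists[OF fr.diff_linear] .
      obtain E where E: "scalar_ext R N ?T ?S e E" using N.scalar_ext_exists[OF e] .
      interpret E: scalar_extension R N ?T ?S e E by unfold_locales (rule E)
      interpret D2: scalar_extension R N "{..<rank F (Suc (Suc 0))}" ?S ?d2 D2 by unfold_locales (rule D2)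
      note tor = tor_zero_exact[OF M.module_axioms N.module_axioms assms(7), folded F_def, OF res,
          unfolded fr.res_module_eq]
      \<comment> \<open>Equality of images survives extension of scalars, so exactness of
        \<open>D1\<close> and \<open>E\<close> at F_1 tensor N follows from the vanishing of
        Tor_1.\<close>
      have im_E: "E ` carrier (direct_power N ?T) = D2 ` carrier (direct_power N {..<rank F (Suc (Suc 0))})"
        using E.ext_image_subset[OF D2] D2.ext_image_subset[OF E] im_e by blast
      have exD: "u \<in> E ` carrier (direct_power N ?T)"
        if "u \<in> carrier (direct_power N ?S)" "D1 u = \<zero>\<^bsub>direct_power N ?T\<^esub>" for u
        unfolding im_E by (rule N.tensor_exact_imp[OF D2 D1 tor that])
      \<comment> \<open>\<open>E\<close> on F_0 tensor N is not a differential of the tensored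
        resolution. The vanishing of Tor_2 gives exactness of \<open>D3\<close> and
        \<open>D2\<close> one period higher, and the comparison carries it over.\<close>
      have exE: "u \<in> D1 ` carrier (direct_power N ?S)"
        if "u \<in> carrier (direct_power N ?T)" "E u = \<zero>\<^bsub>direct_power N ?S\<^esub>" for u
      proof (rule N.exact_by_comparison[OF E D1 D2 D3 im_e equalityD1[OF ker_e] _ _ that])
        show "?d2 (?d3 f) = \<zero>\<^bsub>fr.Fr (Suc 0)\<^esub>" if "f \<in> carrier (fr.Fr (Suc (Suc (Suc 0))))" for f
          using imageI[OF that, of ?d3] unfolding fr.diff_kernel[symmetric] by blast
        show "v \<in> D3 ` carrier (direct_power N {..<rank F (Suc (Suc (Suc 0)))})"
          if "v \<in> carrier (direct_power N {..<rank F (Suc (Suc 0))})" "D2 v = \<zero>\<^bsub>direct_power N ?S\<^esub>" for v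
          by (rule N.tensor_exact_imp[OF D3 D2 tor that])
      qed
      interpret p: minimal_periodic_pair R N ?S ?T ?d1 D1 e E
        by (rule fr.periodic_pairI[OF local assms(6) D1 E ker_d1 ker_e neS neT exD exE])
      obtain \<theta> where \<theta>: "linear_map R (direct_power N ?T) (tensor R M N) \<theta>"
        "\<theta> ` carrier (direct_power N ?T) = carrier (tensor R M N)"
        "{u \<in> carrier (direct_power N ?T). \<theta> u = \<zero>\<^bsub>tensor R M N\<^esub>} = D1 ` carrier (direct_power N ?S)"
        "\<And>f n. f \<in> carrier (fr.Fr 0) \<Longrightarrow> n \<in> carrier N \<Longrightarrow> \<theta> (outer N f n) = t.pure (aug F f) n"
        using tensor_presentation[OF fr.aug_linear fr.aug_surj N.module_axioms D1 fr.aug_kernel] by blast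
      show ?thesis by (rule p.depth_cokernel[OF \<theta>(1-3)])
    qed
    ultimately show ?thesis by simp
  qed
qed

end
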